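(* Let $(\Omega,\mu)$ be a measure space, $1<p<\infty$, and let $T\colon L^p(\Omega)\to L^p(\Omega)$ be an analytic contractively regular operator. Then for every integer $m\ge0$ there is a constant $C\ge0$ such that $$\Big\|\sup_{n\ge0}(n+1)^m\big|T^n(T-I)^m x\big|\Big\|_p\le C\|x\|_p,\qquad x\in L^p(\Omega).$$ In particular (case $m=0$), $\|\sup_{n\ge0}|T^nx|\|_p\le C\|x\|_p$.
   Context: $T$ is contractively regular if $\|\sup_k|T(x_k)|\|_p\le\|\sup_k|x_k|\|_p$ for all finite sequences $(x_k)$ in $L^p(\Omega)$ (e.g. any positive contraction). $T$ is analytic if $\sup_{n\ge0}\|T^n\|<\infty$ and $\sup_{n\ge1}n\|T^n-T^{n-1}\|<\infty$. *)

theory Defs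
  imports "HOL-Analysis.Analysis"
begin

(* real powers of extended nonnegative reals (used for r > 0 only) *)
definition epowr :: "ennreal \<Rightarrow> real \<Rightarrow> ennreal" where
  "epowr a r = (if a = top then top else ennreal (enn2real a powr r))"

definition lpnormE :: "'a measure \<Rightarrow> real \<Rightarrow> ('a \<Rightarrow> ennreal) \<Rightarrow> ennreal" where
  "lpnormE M p g = epowr (\<integral>\<^sup>+ \<omega>. epowr (g \<omega>) p \<partial>M) (1 / p)"

definition lpnorm :: "'a measure \<Rightarrow> real \<Rightarrow> ('a \<Rightarrow> complex) \<Rightarrow> ennreal" where
  "lpnorm M p f = lpnormE M p (\<lambda>\<omega>. ennreal (cmod (f \<omega>)))"

(* representatives of elements of L^p(\<Omega>) (complex scalars) *)
definition Lp :: "'a measure \<Rightarrow> real \<Rightarrow> ('a \<Rightarrow> complex) set" where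
  "Lp M p = {f. f \<in> borel_measurable M \<and> (\<integral>\<^sup>+ \<omega>. ennreal (cmod (f \<omega>) powr p) \<partial>M) < \<infinity>}"

definition Lp_operator :: "'a measure \<Rightarrow> real \<Rightarrow> (('a \<Rightarrow> complex) \<Rightarrow> ('a \<Rightarrow> complex)) \<Rightarrow> bool" where
  "Lp_operator M p T \<longleftrightarrow>
     (\<forall>f\<in>Lp M p. T f \<in> Lp M p) \<and>
     (\<forall>f\<in>Lp M p. \<forall>g\<in>Lp M p. (AE \<omega> in M. f \<omega> = g \<omega>) \<longrightarrow> (AE \<omega> in M. T f \<omega> = T g \<omega>)) \<and>
     (\<forall>f\<in>Lp M p. \<forall>g\<in>Lp M p. \<forall>c::complex.
        AE \<omega> in M. T (\<lambda>\<xi>. f \<xi> + c * g \<xi>) \<omega> = T f \<omega> + c * T g \<omega>) \<and>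
     (\<exists>K::real. \<forall>f\<in>Lp M p. lpnorm M p (T f) \<le> ennreal K * lpnorm M p f)"

definition contractively_regular :: "'a measure \<Rightarrow> real \<Rightarrow> (('a \<Rightarrow> complex) \<Rightarrow> ('a \<Rightarrow> complex)) \<Rightarrow> bool" where
  "contractively_regular M p T \<longleftrightarrow>
     (\<forall>(N::nat) (xs :: nat \<Rightarrow> 'a \<Rightarrow> complex). (\<forall>k<N. xs k \<in> Lp M p) \<longrightarrow>
        lpnormE M p (\<lambda>\<omega>. SUP k\<in>{..<N}. ennreal (cmod (T (xs k) \<omega>)))
          \<le> lpnormE M p (\<lambda>\<omega>. SUP k\<in>{..<N}. ennreal (cmod (xs k \<omega>))))"

(* sup_{n\<ge>0} \<parallel>T^n\<parallel> < \<infinity> and sup_{n\<ge>1} n \<parallel>T^n - T^(n-1)\<parallel> < \<infinity>,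
   with operator norms written out as uniform bounds *)
definition analytic_op :: "'a measure \<Rightarrow> real \<Rightarrow> (('a \<Rightarrow> complex) \<Rightarrow> ('a \<Rightarrow> complex)) \<Rightarrow> bool" where
  "analytic_op M p T \<longleftrightarrow>
     (\<exists>K::real. \<forall>n. \<forall>f\<in>Lp M p. lpnorm M p ((T ^^ n) f) \<le> ennreal K * lpnorm M p f) \<and>
     (\<exists>K::real. \<forall>n\<ge>1. \<forall>f\<in>Lp M p.
        ennreal (real n) * lpnorm M p (\<lambda>\<omega>. (T ^^ n) f \<omega> - (T ^^ (n - 1)) f \<omega>)
          \<le> ennreal K * lpnorm M p f)"

definition minus_id :: "(('a \<Rightarrow> complex) \<Rightarrow> ('a \<Rightarrow> complex)) \<Rightarrow> (('a \<Rightarrow> complex) \<Rightarrow> ('a \<Rightarrow> complex))" where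
  "minus_id T = (\<lambda>f \<omega>. T f \<omega> - f \<omega>)"

end

theory Submission
  imports Defs
begin

text \<open>
  Let \<open>A\<^sub>j\<close> be the mean of \<open>T\<^sup>i\<close> over \<open>i < 2 ^ j\<close>. Three ingredients suffice.

  \<^item> Maximal inequality: a nonnegative contraction \<open>S\<close> on \<open>\<ell>\<^sup>q\<close> satisfies
    \<open>\<parallel>\<Sum>\<^sub>k S\<^sup>k \<phi>\<^sub>k\<parallel> \<le> q \<parallel>\<Sum>\<^sub>k \<phi>\<^sub>k\<parallel>\<close> whenever \<open>\<phi>\<^sub>k \<ge> 0\<close> is decreasing in \<open>k\<close>: the tails
    \<open>u\<^sub>n = \<phi>\<^sub>n + S u\<^sub>n\<^sub>+\<^sub>1\<close> obey \<open>\<parallel>u\<^sub>n\<parallel>\<^sup>q \<le> \<parallel>u\<^sub>n\<^sub>+\<^sub>1\<parallel>\<^sup>q + q \<integral> \<phi>\<^sub>n u\<^sub>n\<^sup>q\<^sup>-\<^sup>1\<close> and \<open>u\<^sub>n \<le> u\<^sub>0\<close>. By duality this is the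
    ergodic maximal inequality for nonnegative matrices. Conditional expectations onto finite partitions
    carry it over to contractively regular operators: the moduli of the matrix entries still form a contraction.

  \<^item> Energy: \<open>A\<^sub>j\<^sub>+\<^sub>1 x\<close> is the midpoint of \<open>A\<^sub>j x\<close> and its image under a power of \<open>T\<close>, so pointwise uniform convexity of
    \<open>\<bar>\<cdot>\<bar>\<^sup>p\<close> bounds \<open>\<Sum>\<^sub>j \<parallel>D\<^sub>j x 1{\<bar>D\<^sub>j x\<bar> > \<lambda> G}\<parallel>\<^sup>p\<close> by \<open>C \<lambda>\<^sup>-\<^sup>2 \<parallel>x\<parallel>\<^sup>p\<close>, where \<open>D\<^sub>j = A\<^sub>j - A\<^sub>j\<^sub>+\<^sub>1\<close> and
    \<open>G = sup\<^sub>j \<bar>A\<^sub>j x\<bar>\<close>.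

  \<^item> Band decomposition: with \<open>P(a) = 1 - (1 - a\<^sup>r)\<^sup>L\<close>, write \<open>1 = P(A\<^sub>J) + \<Sum>\<^sub>l Q\<^sub>J\<^sub>-\<^sub>l D\<^sub>J\<^sub>-\<^sub>l\<close>. For \<open>2 ^ J \<le> n < 2 ^ (J + 1)\<close>
    the polynomial \<open>2\<^sup>J\<^sup>m T\<^sup>n (1 - T)\<^sup>m Q\<^sub>J\<^sub>-\<^sub>l\<close> has operator norm \<open>O(2 ^ (- (L - 1) l))\<close> by
    analyticity, whereas its coefficients are \<open>2 ^ ((m + 1) l)\<close> times those of a mean. Splitting \<open>D\<^sub>J\<^sub>-\<^sub>l x\<close> at height
    \<open>2 ^ (- (m + 2) l) G\<close>, the small part is controlled by the maximal inequality and the large part by the energy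
    inequality, each with the summable factor \<open>2 ^ (- l)\<close>.
\<close>

section \<open>Uniform convexity of the scalar field\<close>

text \<open>Young's inequality for \<open>t\<close> and \<open>s powr (p - 1)\<close> with exponents
  \<open>p\<close> and \<open>p / (p - 1)\<close> is this tangent bound in disguise, so no
  derivative enters. It is the convexity input for the scalar estimates, for the matrix energy and
  for Jensen's inequality.\<close>

lemma powr_tangent_le:
  fixes s t p :: real
  assumes "1 < p" "0 \<le> s" "0 \<le> t"
  shows "s powr p + p * s powr (p - 1) * (t - s) \<le> t powr p"
proof (cases "s = 0")
  case False
  have q: "p / (p - 1) > 1" "1 / p + 1 / (p / (p - 1)) = 1" using assms by (auto simp: field_simps)
  have "t * s powr (p - 1) \<le> t powr p / p + (s powr (p - 1)) powr (p / (p - 1)) / (p / (p - 1))"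
    by (rule Youngs_inequality) (use assms q in auto)
  also have "(s powr (p - 1)) powr (p / (p - 1)) = s powr p"
    using assms by (simp add: powr_powr)
  finally have "p * (t * s powr (p - 1)) \<le> t powr p + (p - 1) * s powr p"
    using assms by (simp add: field_simps)
  moreover have "s powr (p - 1) * s = s powr p"
    using assms False by (simp add: powr_diff)
  ultimately show ?thesis by (simp add: algebra_simps)
qed (use assms in auto)

text \<open>Two tangent steps, from 1 to \<open>1 + x / 2\<close> and on to \<open>1 + x\<close>:
  the slope at the midpoint exceeds the slope at 1 by an amount of order \<open>x\<close>, and this
  surplus is the quadratic term. The argument is uniform in \<open>p > 1\<close>, including
  \<open>p < 2\<close>.\<close>

lemma powr_second_order:
  fixes x p :: real
  assumes "1 < p" "0 \<le> x" "x \<le> 1"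
  shows "1 + p * x + p * (p - 1) / 6 * x\<^sup>2 \<le> (1 + x) powr p"
proof -
  define y where "y = x / 2"
  have y: "0 \<le> y" "y \<le> 1/2" using assms by (auto simp: y_def)
  have "1 + p * y \<le> (1 + y) powr p"
    using powr_tangent_le[of p 1 "1 + y"] assms y by simp
  moreover have "(1 + y) powr p + p * (1 + y) powr (p - 1) * y \<le> (1 + x) powr p"
    using powr_tangent_le[of p "1 + y" "1 + x"] assms y by (simp add: y_def)
  \<comment> \<open>\<open>2/3\<close> is the least value of \<open>1 / (1 + y)\<close> for
    \<open>y <= 1/2\<close>; the power is bounded below through its exponential form and
    \<open>ln (1 + y) >= y / (1 + y)\<close>.\<close>
  moreover have "1 + (p - 1) * y * (2/3) \<le> (1 + y) powr (p - 1)"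
  proof -
    have "y * (2/3) \<le> y / (1 + y)" using y mult_left_mono[of "2 * y" 1 y] by (simp add: field_simps)
    also have "y / (1 + y) \<le> ln (1 + y)"
      using ln_le_minus_one[of "1 / (1 + y)"] y by (simp add: ln_div field_simps)
    finally have "(p - 1) * (y * (2/3)) \<le> (p - 1) * ln (1 + y)"
      using assms by (intro mult_left_mono) auto
    moreover have "1 + (p - 1) * ln (1 + y) \<le> (1 + y) powr (p - 1)"
      using exp_ge_add_one_self[of "(p - 1) * ln (1 + y)"] y by (simp add: powr_def)
    ultimately show ?thesis by (simp only: mult.assoc)
  qed
  then have "p * y * (1 + (p - 1) * y * (2/3)) \<le> p * y * (1 + y) powr (p - 1)"
    using assms y by (intro mult_left_mono) auto
  ultimately have "1 + p * y + p * y * (1 + (p - 1) * y * (2/3)) \<le> (1 + x) powr p"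
    by (simp add: mult_ac)
  then show ?thesis by (simp add: y_def field_simps power2_eq_square)
qed

text \<open>After scaling by \<open>s\<close>, the point \<open>s + h\<close> gets the second-order
  bound and \<open>s - h\<close> only the tangent bound; the linear terms cancel and the quadratic
  one survives. The bound \<open>1/2 <= s\<close> turns the prefactor \<open>s powr p\<close> into
  \<open>2 powr (- p)\<close>.\<close>

lemma powr_mean_gap:
  fixes s h p :: real
  assumes "1 < p" "0 \<le> h" "h \<le> s" "s \<le> 1" "1/2 \<le> s"
  shows "2 * s powr p + p * (p - 1) / 6 * 2 powr (- p) * h\<^sup>2 \<le> (s + h) powr p + (s - h) powr p"
proof -
  define x where "x = h / s"
  have x: "0 \<le> x" "x \<le> 1" "h = s * x" "h \<le> x" using assms by (auto simp: x_def field_simps mult_left_le)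
  have "s powr p * (1 + p * x + p * (p - 1) / 6 * x\<^sup>2) \<le> s powr p * (1 + x) powr p"
    using powr_second_order[of p x] x assms by (intro mult_left_mono) auto
  also have "\<dots> = (s + h) powr p" using assms x by (simp add: powr_mult[symmetric] algebra_simps)
  finally have 1: "s powr p * (1 + p * x + p * (p - 1) / 6 * x\<^sup>2) \<le> (s + h) powr p" .
  have "s powr p * (1 - p * x) \<le> s powr p * (1 - x) powr p"
    using powr_tangent_le[of p 1 "1 - x"] x assms by (intro mult_left_mono) auto
  also have "\<dots> = (s - h) powr p" using assms x by (simp add: powr_mult[symmetric] algebra_simps)
  finally have 2: "s powr p * (1 - p * x) \<le> (s - h) powr p" .
  have "(2 powr (- p)) * h\<^sup>2 \<le> s powr p * x\<^sup>2"
  proof (intro mult_mono)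
    have "(1/2) powr p \<le> s powr p" using assms by (intro powr_mono2) auto
    then show "2 powr (- p) \<le> s powr p" by (simp add: powr_divide powr_minus field_simps)
    show "h\<^sup>2 \<le> x\<^sup>2" using x assms by (intro power_mono) auto
  qed auto
  then have "p * (p - 1) / 6 * ((2 powr (- p)) * h\<^sup>2) \<le> p * (p - 1) / 6 * (s powr p * x\<^sup>2)"
    using assms by (intro mult_left_mono) auto
  moreover have "s powr p * (1 + p * x + p * (p - 1) / 6 * x\<^sup>2) + s powr p * (1 - p * x)
     = 2 * s powr p + p * (p - 1) / 6 * (s powr p * x\<^sup>2)" by algebra
  ultimately show ?thesis using 1 2 by (simp only: mult.assoc)
qed

text \<open>The two entries of the minimum belong to the two cases of the midpoint estimate:
  different moduli (\<open>p * (p - 1) / 6\<close> times a ratio \<open>1/8\<close>), and nearly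
  equal moduli with different arguments (\<open>1/8\<close>).\<close>

definition cvx_const :: "real \<Rightarrow> real" where
  "cvx_const p = 2 powr (- p) * min (1/8) (p * (p - 1) / 48)"

lemma cvx_const_pos: "1 < p \<Longrightarrow> 0 < cvx_const p"
  by (simp add: cvx_const_def)

text \<open>Two scalars are apart because their moduli differ or because their arguments do. The
  parallelogram law \<open>z^2 = s^2 + h^2 - d^2 / 4\<close> quantifies this: either
  \<open>h\<close> is comparable to \<open>d\<close>, and strict convexity of the power gives the
  gap, or the midpoint is visibly shorter than the mean modulus \<open>s\<close>.\<close>

lemma midpoint_powr_gap_unit:
  fixes a b :: complex and p :: real
  assumes p: "1 < p" and "cmod a \<le> 1" "cmod b = 1"
  shows "2 * cmod ((a + b) / 2) powr p + cvx_const p * (cmod (a - b))\<^sup>2 \<le> cmod a powr p + cmod b powr p"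
proof -
  define s h z d where "s = (cmod a + 1) / 2" and "h = (1 - cmod a) / 2"
    and "z = cmod ((a + b) / 2)" and "d = cmod (a - b)"
  have sh: "0 \<le> h" "h \<le> s" "s \<le> 1" "1/2 \<le> s" "cmod a = s - h" "cmod b = s + h"
    using assms by (auto simp: s_def h_def field_simps)
  have zs: "z \<le> s" "0 \<le> z" using norm_triangle_ineq[of a b] assms
    by (auto simp: z_def s_def norm_divide)
  have d: "0 \<le> d" "d \<le> 2" using norm_triangle_ineq4[of a b] assms by (auto simp: d_def)
  have par: "z\<^sup>2 = s\<^sup>2 + h\<^sup>2 - d\<^sup>2 / 4"
  proof -
    have "(cmod (a + b))\<^sup>2 + d\<^sup>2 = 2 * (cmod a)\<^sup>2 + 2 * (cmod b)\<^sup>2"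
      unfolding d_def cmod_power2 by (simp add: power2_eq_square algebra_simps)
    then have "4 * z\<^sup>2 + d\<^sup>2 = 2 * (cmod a)\<^sup>2 + 2 * (cmod b)\<^sup>2"
      by (simp add: z_def norm_divide power_divide)
    then show ?thesis unfolding sh(5,6) by (simp add: power2_eq_square algebra_simps)
  qed
  have gap: "2 * s powr p + p * (p - 1) / 6 * 2 powr (- p) * h\<^sup>2 \<le> cmod a powr p + cmod b powr p"
    using powr_mean_gap[OF p sh(1-4)] sh(5,6) by (simp add: add.commute)
  have "2 * z powr p + cvx_const p * d\<^sup>2 \<le> cmod a powr p + cmod b powr p"
  proof (cases "h\<^sup>2 \<ge> d\<^sup>2 / 8")
    case True
    have "z powr p \<le> s powr p" using zs p by (intro powr_mono2) auto
    moreover have "cvx_const p * d\<^sup>2 \<le> (2 powr (-p) * (p * (p - 1) / 48)) * (8 * h\<^sup>2)"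
      unfolding cvx_const_def using True p by (intro mult_mono mult_left_mono) auto
    moreover have "(2 powr (-p) * (p * (p - 1) / 48)) * (8 * h\<^sup>2) = p * (p - 1) / 6 * 2 powr (- p) * h\<^sup>2"
      by simp
    ultimately show ?thesis using gap by linarith
  next
    case False
    \<comment> \<open>Now \<open>h^2 < d^2 / 8\<close>, so the parallelogram identity leaves a loss
      of \<open>d^2 / 8\<close> in \<open>z^2\<close>; as \<open>s <= 1\<close>, the loss can be
      taken proportional to \<open>s^2\<close>.\<close>
    define y where "y = d\<^sup>2 / 8"
    have y: "0 \<le> y" "y \<le> 1/2" using d power_mono[of d 2 2] by (auto simp: y_def)
    have "z\<^sup>2 \<le> s\<^sup>2 - y" using False par by (simp add: y_def)
    also have "\<dots> \<le> s\<^sup>2 * (1 - y)" using sh y mult_left_le[of "s\<^sup>2" y] power_mono[of s 1 2]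
      by (simp add: algebra_simps)
    finally have "sqrt (z\<^sup>2) \<le> sqrt (s\<^sup>2 * (1 - y))" by (rule real_sqrt_le_mono)
    then have z1: "z \<le> s * sqrt (1 - y)" using zs sh by (simp add: real_sqrt_mult)
    have "sqrt (1 - y) powr p \<le> sqrt (1 - y) powr 1" using y p by (intro powr_mono') auto
    also have "\<dots> = sqrt (1 - y)" using y by simp
    also have "\<dots> \<le> 1 - y / 2"
      by (rule real_le_lsqrt) (use y in \<open>auto simp: power2_eq_square algebra_simps\<close>)
    finally have sq: "sqrt (1 - y) powr p \<le> 1 - y / 2" .
    have "z powr p \<le> (s * sqrt (1 - y)) powr p" using z1 zs p by (intro powr_mono2) auto
    also have "\<dots> = s powr p * sqrt (1 - y) powr p" using sh y by (simp add: powr_mult)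
    also have "\<dots> \<le> s powr p * (1 - y / 2)" using sq by (intro mult_left_mono) auto
    finally have zp: "z powr p \<le> s powr p - s powr p * (y / 2)" by (simp add: algebra_simps)
    have "(1/2) powr p \<le> s powr p" using sh p by (intro powr_mono2) auto
    then have "2 powr (- p) * (y / 2) \<le> s powr p * (y / 2)"
      using y by (intro mult_right_mono) (auto simp: powr_divide powr_minus field_simps)
    moreover have "cvx_const p * d\<^sup>2 \<le> (2 powr (-p) * (1/8)) * d\<^sup>2"
      unfolding cvx_const_def by (intro mult_right_mono mult_left_mono) auto
    moreover have "0 \<le> p * (p - 1) / 6 * 2 powr (- p) * h\<^sup>2" using p by simp
    ultimately show ?thesis using gap zp by (simp add: y_def)
  qed
  then show ?thesis by (simp add: z_def d_def)
qed

text \<open>By homogeneity the larger modulus may be taken to be 1. Then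
  \<open>l <= |a - b| <= 2\<close>, and in this range the square of \<open>|a - b|\<close> dominates
  \<open>l^2 * 2 powr (- p) * |a - b| powr p\<close>. The quadratic gap thus becomes one of degree
  \<open>p\<close>, which scales back.\<close>

lemma midpoint_powr_gap:
  fixes a b :: complex and p :: real
  assumes p: "1 < p" and "0 < l" "l * cmod a \<le> cmod (a - b)" "l * cmod b \<le> cmod (a - b)"
  shows "2 * cmod ((a + b) / 2) powr p + cvx_const p * l\<^sup>2 * 2 powr (- p) * cmod (a - b) powr p
          \<le> cmod a powr p + cmod b powr p"
proof -
  have *: "2 * cmod ((a + b) / 2) powr p + cvx_const p * l\<^sup>2 * 2 powr (- p) * cmod (a - b) powr p
          \<le> cmod a powr p + cmod b powr p"
    if ab: "cmod a \<le> cmod b" and l: "l * cmod b \<le> cmod (a - b)" for a b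
  proof (cases "b = 0")
    case False
    define m a' b' where "m = cmod b" and "a' = a / complex_of_real m" and "b' = b / complex_of_real m"
    have m: "m > 0" using False by (simp add: m_def)
    have ab': "a = complex_of_real m * a'" "b = complex_of_real m * b'" using m by (auto simp: a'_def b'_def)
    have n: "cmod a' \<le> 1" "cmod b' = 1" using m ab by (auto simp: a'_def b'_def norm_divide m_def)
    have d: "l \<le> cmod (a' - b')"
      using l m by (simp add: a'_def b'_def diff_divide_distrib[symmetric] norm_divide m_def field_simps)
    have d2: "cmod (a' - b') \<le> 2" using norm_triangle_ineq4[of a' b'] n by simp
    have "cmod (a' - b') powr p \<le> 2 powr p" using d2 p by (intro powr_mono2) auto
    then have "2 powr (- p) * cmod (a' - b') powr p \<le> 1" by (simp add: powr_minus field_simps)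
    then have "l\<^sup>2 * (2 powr (- p) * cmod (a' - b') powr p) \<le> (cmod (a' - b'))\<^sup>2 * 1"
      using d assms(2) by (intro mult_mono power_mono) auto
    then have "cvx_const p * (l\<^sup>2 * (2 powr (- p) * cmod (a' - b') powr p)) \<le> cvx_const p * (cmod (a' - b'))\<^sup>2"
      using cvx_const_pos[OF p] by (intro mult_left_mono) auto
    then have "m powr p * (2 * (cmod ((a' + b') / 2)) powr p + cvx_const p * l\<^sup>2 * 2 powr (- p) * cmod (a' - b') powr p)
        \<le> m powr p * (cmod a' powr p + cmod b' powr p)"
      using midpoint_powr_gap_unit[OF p n] by (intro mult_left_mono) (auto simp: mult_ac)
    moreover have "cmod ((a + b) / 2) powr p = m powr p * cmod ((a' + b') / 2) powr p"
      using m unfolding ab' by (subst powr_mult[symmetric]) (auto simp: norm_mult norm_divide simp flip: distrib_left)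
    moreover have "cmod (a - b) = m * cmod (a' - b')"
      "cmod a = m * cmod a'" "cmod b = m * cmod b'"
      using m unfolding ab' by (auto simp: norm_mult norm_divide simp flip: distrib_left right_diff_distrib)
    ultimately show ?thesis using m by (simp only: powr_mult distrib_left mult_ac norm_ge_zero less_imp_le)
  qed (use ab in simp)
  show ?thesis
  proof (cases "cmod a \<le> cmod b")
    case True
    then show ?thesis using *[of a b] assms by simp
  next
    case False
    then show ?thesis using *[of b a] assms by (simp add: norm_minus_commute add.commute)
  qed
qed

text \<open>Tangent line at the mean of the moduli. It covers the points where the difference is too
  small for a quantitative gap.\<close>

lemma midpoint_powr_convex:
  fixes a b :: complex
  assumes p: "1 < p"
  shows "2 * cmod ((a + b) / 2) powr p \<le> cmod a powr p + cmod b powr p"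
proof -
  define s where "s = (cmod a + cmod b) / 2"
  have "cmod ((a + b) / 2) \<le> s" using norm_triangle_ineq[of a b] by (simp add: s_def norm_divide)
  then have "cmod ((a + b) / 2) powr p \<le> s powr p" using p by (intro powr_mono2) auto
  moreover have "s powr p + p * s powr (p - 1) * (cmod a - s) \<le> cmod a powr p"
    "s powr p + p * s powr (p - 1) * (cmod b - s) \<le> cmod b powr p"
    using p by (auto intro!: powr_tangent_le simp: s_def)
  moreover have "p * s powr (p - 1) * (cmod a - s) + p * s powr (p - 1) * (cmod b - s) = 0"
    unfolding distrib_left[symmetric] by (simp add: s_def)
  ultimately show ?thesis by linarith
qed

section \<open>The maximal inequality for nonnegative matrices\<close>

lemma Holder_inequality_sum:
  fixes a b :: "'i \<Rightarrow> real"
  assumes "1 < p" "1 < q" "1 / p + 1 / q = 1"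
    and a: "\<And>i. i \<in> I \<Longrightarrow> 0 \<le> a i" and b: "\<And>i. i \<in> I \<Longrightarrow> 0 \<le> b i"
  shows "(\<Sum>i\<in>I. a i * b i) \<le> (\<Sum>i\<in>I. a i powr p) powr (1 / p) * (\<Sum>i\<in>I. b i powr q) powr (1 / q)"
proof (cases "finite I \<and> (\<Sum>i\<in>I. a i powr p) \<noteq> 0 \<and> (\<Sum>i\<in>I. b i powr q) \<noteq> 0")
  case True
  define A B where "A = (\<Sum>i\<in>I. a i powr p)" and "B = (\<Sum>i\<in>I. b i powr q)"
  define A' B' where "A' = A powr (1 / p)" and "B' = B powr (1 / q)"
  have AB: "A > 0" "B > 0" using True sum_nonneg[of I "\<lambda>i. a i powr p"] sum_nonneg[of I "\<lambda>i. b i powr q"]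
    by (force simp: A_def B_def)+
  then have AB': "A' > 0" "B' > 0" "A' powr p = A" "B' powr q = B"
    using assms(1,2) by (auto simp: A'_def B'_def powr_powr)
  have "(\<Sum>i\<in>I. (a i / A') * (b i / B')) \<le> (\<Sum>i\<in>I. (a i / A') powr p / p + (b i / B') powr q / q)"
    using a b AB' assms(1-3) by (intro sum_mono Youngs_inequality) auto
  also have "\<dots> = (\<Sum>i\<in>I. a i powr p / A) / p + (\<Sum>i\<in>I. b i powr q / B) / q"
    using a b AB' by (simp add: sum.distrib powr_divide sum_divide_distrib)
  also have "\<dots> = 1" using AB assms(3) by (simp flip: sum_divide_distrib add: A_def[symmetric] B_def[symmetric])
  finally have "(\<Sum>i\<in>I. a i * b i) / (A' * B') \<le> 1" by (simp add: sum_divide_distrib)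
  then show ?thesis using AB' by (simp add: A'_def B'_def A_def B_def)
next
  case False
  then consider "infinite I" | "finite I" "(\<Sum>i\<in>I. a i powr p) = 0" | "finite I" "(\<Sum>i\<in>I. b i powr q) = 0" by blast
  then have "(\<Sum>i\<in>I. a i * b i) = 0"
    by cases (auto simp: sum_nonneg_eq_0_iff)
  then show ?thesis by simp
qed

text \<open>The scalars are generic because the operation is applied both to the complex matrix of
  averages of \<open>T\<close> and to the real matrix of its moduli.\<close>

definition mapply :: "'i set \<Rightarrow> ('i \<Rightarrow> 'i \<Rightarrow> 'b::semiring_0) \<Rightarrow> ('i \<Rightarrow> 'b) \<Rightarrow> 'i \<Rightarrow> 'b" where
  "mapply I s a = (\<lambda>i. \<Sum>j\<in>I. s i j * a j)"

text \<open>Testing nonnegative vectors only is, for a nonnegative matrix, equivalent to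
  contractivity on all vectors.\<close>

definition lp_contraction :: "'i set \<Rightarrow> real \<Rightarrow> ('i \<Rightarrow> 'i \<Rightarrow> real) \<Rightarrow> bool" where
  "lp_contraction I p s \<longleftrightarrow> (\<forall>a. (\<forall>i\<in>I. 0 \<le> a i) \<longrightarrow>
     (\<Sum>i\<in>I. mapply I s a i powr p) \<le> (\<Sum>i\<in>I. a i powr p))"

lemma mapply_nonneg:
  fixes s :: "'i \<Rightarrow> 'i \<Rightarrow> real"
  assumes "\<And>i j. i \<in> I \<Longrightarrow> j \<in> I \<Longrightarrow> 0 \<le> s i j" "\<And>j. j \<in> I \<Longrightarrow> 0 \<le> a j" "i \<in> I"
  shows "0 \<le> mapply I s a i"
  using assms by (auto simp: mapply_def intro!: sum_nonneg)

lemma mapply_mono: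
  fixes s :: "'i \<Rightarrow> 'i \<Rightarrow> real"
  assumes "\<And>i j. i \<in> I \<Longrightarrow> j \<in> I \<Longrightarrow> 0 \<le> s i j" "\<And>j. j \<in> I \<Longrightarrow> a j \<le> b j" "i \<in> I"
  shows "mapply I s a i \<le> mapply I s b i"
  using assms by (auto simp: mapply_def intro!: sum_mono mult_left_mono)

lemma mapply_transpose:
  "(\<Sum>i\<in>I. b i * mapply I s a i) = (\<Sum>j\<in>I. mapply I (\<lambda>j i. s i j) b j * (a j :: real))"
  unfolding mapply_def sum_distrib_left sum_distrib_right by (subst sum.swap) (simp add: mult_ac)

text \<open>For \<open>c\<close> the transpose applied to \<open>b\<close>, the sum \<open>X\<close>
  of \<open>c powr q\<close> is the pairing of \<open>b\<close> with the matrix applied to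
  \<open>c powr (q - 1)\<close>. Hoelder and the contraction bound it by the norm of
  \<open>b\<close> times \<open>X powr (1 / p)\<close>, which is then divided out.\<close>

lemma lp_contraction_transpose:
  assumes pq: "1 < p" "1 < q" "1 / p + 1 / q = 1" and "finite I"
    and s: "\<And>i j. i \<in> I \<Longrightarrow> j \<in> I \<Longrightarrow> 0 \<le> s i j" and c: "lp_contraction I p s"
  shows "lp_contraction I q (\<lambda>j i. s i j)"
  unfolding lp_contraction_def
proof (intro allI impI)
  fix b :: "'a \<Rightarrow> real" assume b: "\<forall>i\<in>I. 0 \<le> b i"
  define c where "c = mapply I (\<lambda>j i. s i j) b"
  define X Y where "X = (\<Sum>j\<in>I. c j powr q)" and "Y = (\<Sum>i\<in>I. b i powr q)"
  have c0: "0 \<le> c j" if "j \<in> I" for j using that s b by (auto simp: c_def intro!: mapply_nonneg)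
  have X0: "0 \<le> X" "0 \<le> Y" by (auto simp: X_def Y_def sum_nonneg)
  have pq': "(q - 1) * p = q" using pq by (simp add: field_simps)
  have "X = (\<Sum>j\<in>I. c j * c j powr (q - 1))"
    unfolding X_def using c0 pq by (intro sum.cong) (auto simp: powr_diff)
  also have "\<dots> = (\<Sum>i\<in>I. b i * mapply I s (\<lambda>j. c j powr (q - 1)) i)"
    unfolding c_def mapply_transpose ..
  also have "\<dots> \<le> (\<Sum>i\<in>I. b i powr q) powr (1 / q) *
      (\<Sum>i\<in>I. mapply I s (\<lambda>j. c j powr (q - 1)) i powr p) powr (1 / p)"
    using pq s b by (intro Holder_inequality_sum) (auto intro!: mapply_nonneg)
  also have "\<dots> \<le> Y powr (1 / q) * X powr (1 / p)"
  proof -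
    have "(\<Sum>i\<in>I. mapply I s (\<lambda>j. c j powr (q - 1)) i powr p) \<le> (\<Sum>j\<in>I. (c j powr (q - 1)) powr p)"
      using \<open>lp_contraction I p s\<close> unfolding lp_contraction_def by simp
    also have "\<dots> = X" unfolding X_def by (simp add: powr_powr pq')
    finally show ?thesis unfolding Y_def using pq
      by (intro mult_left_mono powr_mono2) (auto intro!: sum_nonneg)
  qed
  finally have le: "X \<le> Y powr (1 / q) * X powr (1 / p)" .
  have "X \<le> Y"
  proof (cases "X = 0")
    case False
    then have "X > 0" using X0 by simp
    have "X powr (1 / q) * X powr (1 / p) = X" using \<open>X > 0\<close> pq by (simp flip: powr_add add: add.commute)
    then have "X powr (1 / q) * X powr (1 / p) \<le> Y powr (1 / q) * X powr (1 / p)" using le by simp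
    then have "X powr (1 / q) \<le> Y powr (1 / q)" using \<open>X > 0\<close> by simp
    then have "(X powr (1 / q)) powr q \<le> (Y powr (1 / q)) powr q" using pq by (simp add: powr_mono2)
    then show ?thesis using X0 pq by (simp add: powr_powr)
  qed (use X0 in simp)
  then show "(\<Sum>i\<in>I. mapply I (\<lambda>j i. s i j) b i powr q) \<le> (\<Sum>i\<in>I. b i powr q)"
    by (simp add: X_def Y_def c_def)
qed

text \<open>Horner form of a tail: \<open>back_sum I s phi K j\<close> is the sum over
  \<open>k < j\<close> of the \<open>k\<close>-th matrix power applied to
  \<open>phi (K - j + k)\<close>, that is, the tail starting at index \<open>K - j\<close>. Counting
  from the end makes the recursion structural.\<close>

fun back_sum :: "'i set \<Rightarrow> ('i \<Rightarrow> 'i \<Rightarrow> real) \<Rightarrow> (nat \<Rightarrow> 'i \<Rightarrow> real) \<Rightarrow> nat \<Rightarrow> nat \<Rightarrow> 'i \<Rightarrow> real" where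
  "back_sum I s \<phi> K 0 = (\<lambda>i. 0)"
| "back_sum I s \<phi> K (Suc j) = (\<lambda>i. \<phi> (K - Suc j) i + mapply I s (back_sum I s \<phi> K j) i)"

context
  fixes I :: "'i set" and s :: "'i \<Rightarrow> 'i \<Rightarrow> real" and \<phi> :: "nat \<Rightarrow> 'i \<Rightarrow> real" and K :: nat
  assumes fin: "finite I" and s: "\<And>i j. i \<in> I \<Longrightarrow> j \<in> I \<Longrightarrow> 0 \<le> s i j"
    and \<phi>0: "\<And>k i. i \<in> I \<Longrightarrow> 0 \<le> \<phi> k i"
begin

lemma back_sum_nonneg: "i \<in> I \<Longrightarrow> 0 \<le> back_sum I s \<phi> K j i"
proof (induction j arbitrary: i)
  case (Suc j)
  then show ?case using \<phi>0 s by (auto intro!: add_nonneg_nonneg mapply_nonneg)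
qed simp

text \<open>Going from \<open>j\<close> to \<open>Suc j\<close> starts the tail one index earlier
  (or again at 0, by truncated subtraction), and as \<open>phi\<close> decreases in its index every
  term can only grow.\<close>

lemma back_sum_Suc_mono:
  assumes dec: "\<And>k l i. i \<in> I \<Longrightarrow> k \<le> l \<Longrightarrow> \<phi> l i \<le> \<phi> k i"
  shows "i \<in> I \<Longrightarrow> back_sum I s \<phi> K j i \<le> back_sum I s \<phi> K (Suc j) i"
proof (induction j arbitrary: i)
  case 0
  then show ?case using \<phi>0 by (simp add: mapply_def)
next
  case (Suc j)
  have "\<phi> (K - Suc j) i \<le> \<phi> (K - Suc (Suc j)) i" using Suc.prems by (intro dec) auto
  moreover have "mapply I s (back_sum I s \<phi> K j) i \<le> mapply I s (back_sum I s \<phi> K (Suc j)) i"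
    using Suc s by (intro mapply_mono) auto
  ultimately show ?case by simp
qed

lemma back_sum_mono:
  assumes dec: "\<And>k l i. i \<in> I \<Longrightarrow> k \<le> l \<Longrightarrow> \<phi> l i \<le> \<phi> k i" and "i \<in> I" "j \<le> j'"
  shows "back_sum I s \<phi> K j i \<le> back_sum I s \<phi> K j' i"
  using lift_Suc_mono_le[of "\<lambda>j. back_sum I s \<phi> K j i"] back_sum_Suc_mono[OF dec] assms by blast

text \<open>The powers of the matrix move one at a time onto the test vector, where they become
  powers of the transpose. Applied to a transposed matrix, this makes the iterates of the original
  one appear.\<close>

lemma back_sum_pairing:
  "j \<le> K \<Longrightarrow> (\<Sum>i\<in>I. back_sum I s \<phi> K j i * g i) =
    (\<Sum>k<j. \<Sum>i\<in>I. \<phi> (K - j + k) i * (mapply I (\<lambda>i j. s j i) ^^ k) g i)"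
proof (induction j arbitrary: g)
  case (Suc j)
  have "(\<Sum>i\<in>I. back_sum I s \<phi> K (Suc j) i * g i) = (\<Sum>i\<in>I. \<phi> (K - Suc j) i * g i)
      + (\<Sum>i\<in>I. g i * mapply I s (back_sum I s \<phi> K j) i)"
    by (simp add: algebra_simps sum.distrib)
  also have "(\<Sum>i\<in>I. g i * mapply I s (back_sum I s \<phi> K j) i) =
     (\<Sum>i\<in>I. back_sum I s \<phi> K j i * mapply I (\<lambda>i j. s j i) g i)"
    unfolding mapply_transpose[of g] by (simp add: mult_ac)
  also have "\<dots> = (\<Sum>k<j. \<Sum>i\<in>I. \<phi> (K - j + k) i * (mapply I (\<lambda>i j. s j i) ^^ Suc k) g i)"
    using Suc by (subst Suc.IH) (auto simp: funpow_swap1)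
  also have "\<dots> = (\<Sum>k<j. \<Sum>i\<in>I. \<phi> (K - Suc j + Suc k) i * (mapply I (\<lambda>i j. s j i) ^^ Suc k) g i)"
  proof -
    have *: "K - j + k = K - Suc j + Suc k" for k using Suc.prems by simp
    show ?thesis unfolding * ..
  qed
  finally show ?case by (subst sum.lessThan_Suc_shift) simp
qed simp

text \<open>The tangent line at the new tail, evaluated at the matrix applied to the old tail,
  bounds the growth of the \<open>q\<close>-th powers in one step by
  \<open>q * phi * u powr (q - 1)\<close>; the contraction returns to the old tail. Monotonicity
  then replaces \<open>u\<close> by the full tail, the same in all steps.\<close>

lemma back_sum_energy:
  assumes dec: "\<And>k l i. i \<in> I \<Longrightarrow> k \<le> l \<Longrightarrow> \<phi> l i \<le> \<phi> k i"
    and q: "1 < q" and c: "lp_contraction I q s"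
  shows "j \<le> K \<Longrightarrow> (\<Sum>i\<in>I. back_sum I s \<phi> K j i powr q) \<le>
    q * (\<Sum>k<j. \<Sum>i\<in>I. \<phi> (K - Suc k) i * back_sum I s \<phi> K K i powr (q - 1))"
proof (induction j)
  case (Suc j)
  let ?u = "back_sum I s \<phi> K"
  have "?u (Suc j) i powr q \<le> mapply I s (?u j) i powr q + q * (\<phi> (K - Suc j) i * ?u K i powr (q - 1))"
    if "i \<in> I" for i
  proof -
    have "?u (Suc j) i powr q \<le> mapply I s (?u j) i powr q + q * (\<phi> (K - Suc j) i * ?u (Suc j) i powr (q - 1))"
      using powr_tangent_le[OF q back_sum_nonneg[OF that, of "Suc j"], of "mapply I s (?u j) i"] that s
      by (auto simp: algebra_simps intro!: mapply_nonneg back_sum_nonneg)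
    also have "\<phi> (K - Suc j) i * ?u (Suc j) i powr (q - 1) \<le> \<phi> (K - Suc j) i * ?u K i powr (q - 1)"
      using q \<phi>0 that Suc.prems by (intro mult_left_mono powr_mono2 back_sum_mono dec back_sum_nonneg) auto
    finally show ?thesis using q by (simp add: mult_left_mono)
  qed
  then have "(\<Sum>i\<in>I. ?u (Suc j) i powr q) \<le> (\<Sum>i\<in>I. mapply I s (?u j) i powr q) +
     q * (\<Sum>i\<in>I. \<phi> (K - Suc j) i * ?u K i powr (q - 1))"
    unfolding sum_distrib_left sum.distrib[symmetric] by (rule sum_mono)
  also have "(\<Sum>i\<in>I. mapply I s (?u j) i powr q) \<le> (\<Sum>i\<in>I. ?u j i powr q)"
    using c back_sum_nonneg unfolding lp_contraction_def by blast
  also have "(\<Sum>i\<in>I. ?u j i powr q) \<le> q * (\<Sum>k<j. \<Sum>i\<in>I. \<phi> (K - Suc k) i * ?u K i powr (q - 1))"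
    using Suc by simp
  finally show ?case by (simp add: distrib_left)
qed simp

text \<open>For \<open>j = K\<close> the energy estimate bounds \<open>X\<close> by \<open>q\<close>
  times a pairing with \<open>u powr (q - 1)\<close>. Hoelder turns the latter factor into
  \<open>X powr (1 / p)\<close>, and dividing leaves the exponent \<open>1 / q\<close>.\<close>

lemma back_sum_bound:
  assumes dec: "\<And>k l i. i \<in> I \<Longrightarrow> k \<le> l \<Longrightarrow> \<phi> l i \<le> \<phi> k i"
    and pq: "1 < p" "1 < q" "1 / p + 1 / q = 1" and c: "lp_contraction I q s"
  shows "(\<Sum>i\<in>I. back_sum I s \<phi> K K i powr q) powr (1 / q) \<le> q * (\<Sum>i\<in>I. (\<Sum>k<K. \<phi> k i) powr q) powr (1 / q)"
proof -
  let ?u = "back_sum I s \<phi> K K"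
  define X where "X = (\<Sum>i\<in>I. ?u i powr q)"
  have X0: "0 \<le> X" by (auto simp: X_def sum_nonneg)
  have pq': "(q - 1) * p = q" using pq by (simp add: field_simps)
  have "X \<le> q * (\<Sum>k<K. \<Sum>i\<in>I. \<phi> (K - Suc k) i * ?u i powr (q - 1))"
    unfolding X_def by (rule back_sum_energy[OF dec pq(2) c]) auto
  also have "(\<Sum>k<K. \<Sum>i\<in>I. \<phi> (K - Suc k) i * ?u i powr (q - 1)) = (\<Sum>i\<in>I. (\<Sum>k<K. \<phi> k i) * ?u i powr (q - 1))"
    unfolding sum_distrib_right by (subst sum.nat_diff_reindex[where g = "\<lambda>k. \<Sum>i\<in>I. \<phi> k i * ?u i powr (q - 1)"]) (rule sum.swap)
  also have "\<dots> \<le> (\<Sum>i\<in>I. (\<Sum>k<K. \<phi> k i) powr q) powr (1 / q) * (\<Sum>i\<in>I. (?u i powr (q - 1)) powr p) powr (1 / p)"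
    using pq \<phi>0 by (intro Holder_inequality_sum) (auto intro!: sum_nonneg)
  also have "(\<Sum>i\<in>I. (?u i powr (q - 1)) powr p) = X" unfolding X_def by (simp add: powr_powr pq')
  finally have le: "X \<le> q * (\<Sum>i\<in>I. (\<Sum>k<K. \<phi> k i) powr q) powr (1 / q) * X powr (1 / p)"
    using pq by (simp add: mult_ac)
  show ?thesis
  proof (cases "X = 0")
    case True
    then show ?thesis using pq X_def by simp
  next
    case False
    then have "X > 0" using X0 by simp
    have "X powr (1 / q) * X powr (1 / p) = X" using \<open>X > 0\<close> pq by (simp flip: powr_add add: add.commute)
    then have "X powr (1 / q) * X powr (1 / p) \<le> q * (\<Sum>i\<in>I. (\<Sum>k<K. \<phi> k i) powr q) powr (1 / q) * X powr (1 / p)"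
      using le by simp
    then show ?thesis using \<open>X > 0\<close> unfolding X_def[symmetric] by simp
  qed
qed

end

text \<open>The function \<open>N\<close> picks the averaging time separately at each coordinate,
  which linearises the supremum of the averages. Pairing with \<open>v powr (p - 1)\<close> moves
  the estimate to the transpose in exponent \<open>q\<close>, where \<open>back_sum_bound\<close>
  applies.\<close>

lemma matrix_maximal_unweighted:
  fixes s :: "'i \<Rightarrow> 'i \<Rightarrow> real" and N :: "'i \<Rightarrow> nat"
  assumes fin: "finite I" and pq: "1 < p" "1 < q" "1 / p + 1 / q = 1"
    and s: "\<And>i j. i \<in> I \<Longrightarrow> j \<in> I \<Longrightarrow> 0 \<le> s i j" and c: "lp_contraction I p s"
    and F: "\<And>i. i \<in> I \<Longrightarrow> 0 \<le> F i" and N: "\<And>i. i \<in> I \<Longrightarrow> 0 < N i"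
  shows "(\<Sum>i\<in>I. ((\<Sum>k<N i. (mapply I s ^^ k) F i) / N i) powr p) \<le> q powr p * (\<Sum>i\<in>I. F i powr p)"
proof -
  define v where "v = (\<lambda>i. (\<Sum>k<N i. (mapply I s ^^ k) F i) / N i)"
  \<comment> \<open>The weight \<open>1 / N i\<close> on the times \<open>k < N i\<close> decreases
    in \<open>k\<close>, as \<open>back_sum_bound\<close> demands, and the sum of
    \<open>\<phi>\<close> over \<open>k\<close> is \<open>v i powr (p - 1)\<close>.\<close>
  define \<phi> where "\<phi> = (\<lambda>k i. if k < N i then v i powr (p - 1) / N i else 0)"
  define K where "K = Max (insert 0 (N ` I))"
  define X where "X = (\<Sum>i\<in>I. v i powr p)"
  define Y where "Y = (\<Sum>i\<in>I. F i powr p)"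
  have NK: "N i \<le> K" if "i \<in> I" for i using that fin by (auto simp: K_def)
  have SkF: "0 \<le> (mapply I s ^^ k) F i" if "i \<in> I" for i k
    using that by (induction k arbitrary: i) (auto intro!: mapply_nonneg s F)
  have v0: "0 \<le> v i" if "i \<in> I" for i using that by (auto simp: v_def intro!: divide_nonneg_nonneg sum_nonneg SkF)
  have X0: "0 \<le> X" "0 \<le> Y" by (auto simp: X_def Y_def sum_nonneg)
  have sum\<phi>: "(\<Sum>k<K. \<phi> k i) = v i powr (p - 1)" if "i \<in> I" for i
  proof -
    have "(\<Sum>k<K. \<phi> k i) = (\<Sum>k<N i. v i powr (p - 1) / N i)"
      unfolding \<phi>_def using NK[OF that] by (intro sum.mono_neutral_cong_right) auto
    then show ?thesis using N[OF that] by simp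
  qed
  have \<phi>0: "0 \<le> \<phi> k i" for k i by (auto simp: \<phi>_def)
  have pq': "(p - 1) * q = p" using pq by (simp add: field_simps)
  let ?u = "back_sum I (\<lambda>j i. s i j) \<phi> K K"
  have "X = (\<Sum>i\<in>I. v i powr (p - 1) * v i)"
    unfolding X_def using v0 pq by (intro sum.cong) (auto simp: powr_diff)
  also have "\<dots> = (\<Sum>i\<in>I. \<Sum>k<K. \<phi> k i * (mapply I s ^^ k) F i)"
  proof (intro sum.cong refl)
    fix i assume "i \<in> I"
    have "(\<Sum>k<K. \<phi> k i * (mapply I s ^^ k) F i) = (\<Sum>k<N i. v i powr (p - 1) / N i * (mapply I s ^^ k) F i)"
      unfolding \<phi>_def using NK[OF \<open>i \<in> I\<close>] by (intro sum.mono_neutral_cong_right) auto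
    then show "v i powr (p - 1) * v i = (\<Sum>k<K. \<phi> k i * (mapply I s ^^ k) F i)"
      by (simp add: v_def sum_distrib_left sum_divide_distrib)
  qed
  also have "\<dots> = (\<Sum>k<K. \<Sum>i\<in>I. \<phi> (K - K + k) i * (mapply I s ^^ k) F i)"
    by (subst sum.swap) simp
  also have "\<dots> = (\<Sum>i\<in>I. ?u i * F i)"
    using back_sum_pairing[of I "\<lambda>j i. s i j" \<phi> K K F] fin s \<phi>0 by simp
  also have "\<dots> \<le> (\<Sum>i\<in>I. ?u i powr q) powr (1 / q) * Y powr (1 / p)"
    unfolding Y_def using pq fin s \<phi>0 F by (intro Holder_inequality_sum back_sum_nonneg) auto
  also have "(\<Sum>i\<in>I. ?u i powr q) powr (1 / q) \<le> q * (\<Sum>i\<in>I. (\<Sum>k<K. \<phi> k i) powr q) powr (1 / q)"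
    using fin s \<phi>0 pq
    by (intro back_sum_bound[where p = p] lp_contraction_transpose[OF pq] c) (auto simp: \<phi>_def)
  also have "(\<Sum>i\<in>I. (\<Sum>k<K. \<phi> k i) powr q) = X"
    unfolding X_def by (intro sum.cong) (auto simp: sum\<phi> powr_powr pq')
  finally have le: "X \<le> q * X powr (1 / q) * Y powr (1 / p)" by (simp add: mult_right_mono)
  have "X \<le> q powr p * Y"
  proof (cases "X = 0")
    case False
    then have "X > 0" using X0 by simp
    have "X powr (1 / p) * X powr (1 / q) = X" using \<open>X > 0\<close> pq by (simp flip: powr_add)
    moreover have "X \<le> (q * Y powr (1 / p)) * X powr (1 / q)" using le by (simp add: mult_ac)
    ultimately have "X powr (1 / p) * X powr (1 / q) \<le> (q * Y powr (1 / p)) * X powr (1 / q)" by simp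
    then have "X powr (1 / p) \<le> q * Y powr (1 / p)" using \<open>X > 0\<close> by simp
    then have "(X powr (1 / p)) powr p \<le> (q * Y powr (1 / p)) powr p" using pq by (intro powr_mono2) auto
    then show ?thesis using X0 pq by (simp add: powr_powr powr_mult)
  qed (use X0 in simp)
  then show ?thesis by (simp add: X_def Y_def v_def)
qed

text \<open>Conjugation by the diagonal matrix with entries \<open>w i powr (1 / p)\<close> removes
  the weights. They will be the measures of the cells of a partition.\<close>

lemma matrix_maximal:
  fixes s :: "'i \<Rightarrow> 'i \<Rightarrow> real" and N :: "'i \<Rightarrow> nat" and w :: "'i \<Rightarrow> real"
  assumes fin: "finite I" and pq: "1 < p" "1 < q" "1 / p + 1 / q = 1"
    and w: "\<And>i. i \<in> I \<Longrightarrow> 0 < w i"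
    and s: "\<And>i j. i \<in> I \<Longrightarrow> j \<in> I \<Longrightarrow> 0 \<le> s i j"
    and c: "\<And>a. (\<And>i. i \<in> I \<Longrightarrow> 0 \<le> a i) \<Longrightarrow>
       (\<Sum>i\<in>I. w i * mapply I s a i powr p) \<le> (\<Sum>i\<in>I. w i * a i powr p)"
    and F: "\<And>i. i \<in> I \<Longrightarrow> 0 \<le> F i" and N: "\<And>i. i \<in> I \<Longrightarrow> 0 < N i"
  shows "(\<Sum>i\<in>I. w i * ((\<Sum>k<N i. (mapply I s ^^ k) F i) / N i) powr p)
    \<le> q powr p * (\<Sum>i\<in>I. w i * F i powr p)"
proof -
  define r where "r = (\<lambda>i. w i powr (1 / p))"
  define s' where "s' = (\<lambda>i j. r i * s i j / r j)"
  have r: "0 < r i" "r i powr p = w i" if "i \<in> I" for i using w[OF that] pq by (auto simp: r_def powr_powr)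
  have app: "mapply I s' a i = r i * mapply I s (\<lambda>j. a j / r j) i" for a i
    by (simp add: mapply_def s'_def sum_distrib_left mult_ac)
  have s0: "0 \<le> s' i j" if "i \<in> I" "j \<in> I" for i j
    using r[OF that(1)] r[OF that(2)] s[OF that] by (simp add: s'_def)
  have pow: "(mapply I s' ^^ k) (\<lambda>j. r j * F j) i = r i * (mapply I s ^^ k) F i" if "i \<in> I" for k i
    using that
  proof (induction k arbitrary: i)
    case (Suc k)
    have "(mapply I s' ^^ Suc k) (\<lambda>j. r j * F j) i = r i * mapply I s (\<lambda>j. (mapply I s' ^^ k) (\<lambda>j. r j * F j) j / r j) i"
      by (simp add: app)
    also have "mapply I s (\<lambda>j. (mapply I s' ^^ k) (\<lambda>j. r j * F j) j / r j) i = mapply I s ((mapply I s ^^ k) F) i"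
      unfolding mapply_def[of I s]
    proof (rule sum.cong)
      fix j assume "j \<in> I"
      then show "s i j * ((mapply I s' ^^ k) (\<lambda>j. r j * F j) j / r j) =
         s i j * ((\<lambda>a i. \<Sum>j\<in>I. s i j * a j) ^^ k) F j"
        using Suc.IH[OF \<open>j \<in> I\<close>] r[OF \<open>j \<in> I\<close>] by (simp add: mapply_def[abs_def])
    qed simp
    finally show ?case by simp
  qed simp
  have mat0: "0 \<le> mapply I s (\<lambda>j. a j / r j) i" if "\<And>j. j \<in> I \<Longrightarrow> 0 \<le> a j" "i \<in> I" for a i
    using that r s by (intro mapply_nonneg) (auto intro!: divide_nonneg_nonneg simp: less_imp_le)
  have c': "lp_contraction I p s'"
    unfolding lp_contraction_def
  proof (intro allI impI)
    fix a :: "'i \<Rightarrow> real" assume a: "\<forall>i\<in>I. 0 \<le> a i"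
    have "(\<Sum>i\<in>I. mapply I s' a i powr p) = (\<Sum>i\<in>I. w i * mapply I s (\<lambda>j. a j / r j) i powr p)"
      unfolding app using r mat0 a by (intro sum.cong) (auto simp: powr_mult)
    also have "\<dots> \<le> (\<Sum>i\<in>I. w i * (a i / r i) powr p)"
      using a r by (intro c) (auto simp: less_imp_le)
    also have "\<dots> = (\<Sum>i\<in>I. a i powr p)"
    proof (intro sum.cong refl)
      fix i assume "i \<in> I" then show "w i * (a i / r i) powr p = a i powr p"
        using r(1)[of i] r(2)[of i] w[of i] a by (simp add: powr_divide)
    qed
    finally show "(\<Sum>i\<in>I. mapply I s' a i powr p) \<le> (\<Sum>i\<in>I. a i powr p)" .
  qed
  have SkF: "0 \<le> (mapply I s ^^ k) F i" if "i \<in> I" for i k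
    using that by (induction k arbitrary: i) (auto intro!: mapply_nonneg s F)
  have "(\<Sum>i\<in>I. w i * ((\<Sum>k<N i. (mapply I s ^^ k) F i) / N i) powr p) =
     (\<Sum>i\<in>I. ((\<Sum>k<N i. (mapply I s' ^^ k) (\<lambda>j. r j * F j) i) / N i) powr p)"
  proof (intro sum.cong refl)
    fix i assume i: "i \<in> I"
    have "(\<Sum>k<N i. (mapply I s' ^^ k) (\<lambda>j. r j * F j) i) / N i = r i * ((\<Sum>k<N i. (mapply I s ^^ k) F i) / N i)"
      by (simp add: pow[OF i] sum_distrib_left)
    moreover have "0 \<le> (\<Sum>k<N i. (mapply I s ^^ k) F i) / N i"
      by (auto intro!: divide_nonneg_nonneg sum_nonneg SkF i)
    ultimately show "w i * ((\<Sum>k<N i. (mapply I s ^^ k) F i) / N i) powr p =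
      ((\<Sum>k<N i. (mapply I s' ^^ k) (\<lambda>j. r j * F j) i) / N i) powr p"
      using r[OF i] by (simp only: powr_mult less_imp_le)
  qed
  also have "\<dots> \<le> q powr p * (\<Sum>i\<in>I. (r i * F i) powr p)"
    using fin pq s0 c' F N r by (intro matrix_maximal_unweighted) (auto simp: less_imp_le)
  also have "(\<Sum>i\<in>I. (r i * F i) powr p) = (\<Sum>i\<in>I. w i * F i powr p)"
    using r F by (intro sum.cong) (auto simp: powr_mult less_imp_le)
  finally show ?thesis .
qed

section \<open>Norm bounds in \<open>L\<^sup>p\<close>\<close>

abbreviation Lp_pow :: "'a measure \<Rightarrow> real \<Rightarrow> ('a \<Rightarrow> 'b::real_normed_vector) \<Rightarrow> ennreal" where
  "Lp_pow M p f \<equiv> \<integral>\<^sup>+ w. ennreal (norm (f w) powr p) \<partial>M"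

text \<open>A relation with a real bound avoids roots and infinite values, and carries measurability
  along. The range is arbitrary so that complex functions and real maximal functions share the same
  rules.\<close>

definition Lp_le :: "'a measure \<Rightarrow> real \<Rightarrow> ('a \<Rightarrow> 'b::real_normed_vector) \<Rightarrow> real \<Rightarrow> bool" where
  "Lp_le M p f B \<longleftrightarrow> f \<in> borel_measurable M \<and> 0 \<le> B \<and>
     Lp_pow M p f \<le> ennreal (B powr p)"

lemma Lp_leD:
  assumes "Lp_le M p f B"
  shows "f \<in> borel_measurable M" "0 \<le> B" "Lp_pow M p f \<le> ennreal (B powr p)"
  using assms by (auto simp: Lp_le_def)

lemma Lp_le_mono:
  assumes "Lp_le M p g B" "0 \<le> p" "f \<in> borel_measurable M" "AE w in M. norm (f w) \<le> norm (g w)" "B \<le> B'"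
  shows "Lp_le M p f B'"
  unfolding Lp_le_def
proof (intro conjI)
  note B = Lp_leD[OF assms(1)]
  have "Lp_pow M p f \<le> Lp_pow M p g"
    by (rule nn_integral_mono_AE) (use assms(4) in eventually_elim, use assms(2) in \<open>auto intro!: ennreal_leI powr_mono2\<close>)
  also note B(3)
  also have "ennreal (B powr p) \<le> ennreal (B' powr p)"
    using B assms by (auto intro!: ennreal_leI powr_mono2)
  finally show "Lp_pow M p f \<le> ennreal (B' powr p)" .
  show "0 \<le> B'" using B assms by simp
qed (use assms in auto)

lemma Lp_le_0_AE:
  assumes "Lp_le M p f 0" "0 < p"
  shows "AE w in M. f w = 0"
proof -
  have [measurable]: "f \<in> borel_measurable M" by (rule Lp_leD[OF assms(1)])
  have "Lp_pow M p f = 0" using Lp_leD(3)[OF assms(1)] assms(2) by simp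
  then have "AE w in M. ennreal (norm (f w) powr p) = 0" by (subst (asm) nn_integral_0_iff_AE) auto
  then show ?thesis by eventually_elim (auto simp: powr_def split: if_splits)
qed

lemma powr_convex_combination:
  fixes a b t p :: real
  assumes "1 < p" "0 \<le> a" "0 \<le> b" "0 \<le> t" "t \<le> 1"
  shows "(t * a + (1 - t) * b) powr p \<le> t * a powr p + (1 - t) * b powr p"
proof -
  define s where "s = t * a + (1 - t) * b"
  have s0: "0 \<le> s" using assms by (auto simp: s_def)
  have "t * (s powr p + p * s powr (p - 1) * (a - s)) \<le> t * a powr p"
    using powr_tangent_le[OF assms(1) s0 assms(2)] assms by (intro mult_left_mono)
  moreover have "(1 - t) * (s powr p + p * s powr (p - 1) * (b - s)) \<le> (1 - t) * b powr p"
    using powr_tangent_le[OF assms(1) s0 assms(3)] assms by (intro mult_left_mono) auto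
  moreover have "t * (s powr p + p * s powr (p - 1) * (a - s)) + (1 - t) * (s powr p + p * s powr (p - 1) * (b - s))
     = s powr p + p * s powr (p - 1) * (t * (a - s) + (1 - t) * (b - s))" by (simp add: algebra_simps)
  moreover have "t * (a - s) + (1 - t) * (b - s) = 0" unfolding s_def by (simp add: algebra_simps)
  ultimately show ?thesis by (simp add: s_def)
qed

text \<open>Minkowski's inequality without roots: \<open>f + g\<close> is \<open>A + B\<close> times
  the convex combination of \<open>f / A\<close> and \<open>g / B\<close> with weight
  \<open>t = A / (A + B)\<close>, and convexity of the power is integrated. A bound 0 makes the
  function vanish almost everywhere and is treated apart.\<close>

lemma Lp_le_add:
  fixes f g :: "'a \<Rightarrow> 'b::{real_normed_vector, second_countable_topology}"
  assumes p: "1 < p" and f: "Lp_le M p f A" and g: "Lp_le M p g B"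
  shows "Lp_le M p (\<lambda>w. f w + g w) (A + B)"
proof -
  note fD = Lp_leD[OF f] and gD = Lp_leD[OF g]
  note [measurable] = fD(1) gD(1)
  consider "A = 0" | "B = 0" | "A > 0" "B > 0" using fD(2) gD(2) by linarith
  then show ?thesis
  proof cases
    case 1
    then have "AE w in M. f w = 0" using Lp_le_0_AE f p by force
    then have "AE w in M. norm (f w + g w) \<le> norm (g w)" by eventually_elim simp
    then show ?thesis using 1 p by (intro Lp_le_mono[OF g]) auto
  next
    case 2
    then have "AE w in M. g w = 0" using Lp_le_0_AE g p by force
    then have "AE w in M. norm (f w + g w) \<le> norm (f w)" by eventually_elim simp
    then show ?thesis using 2 p by (intro Lp_le_mono[OF f]) auto
  next
    case 3
    define t where "t = A / (A + B)"
    define c1 c2 where "c1 = (A + B) powr p * t / A powr p" and "c2 = (A + B) powr p * (1 - t) / B powr p"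
    have t: "0 \<le> t" "t \<le> 1" "1 - t = B / (A + B)" using 3 by (auto simp: t_def field_simps)
    have c: "0 \<le> c1" "0 \<le> c2" using t(1,2) by (auto simp: c1_def c2_def)
    have pt: "norm (f w + g w) powr p \<le> c1 * norm (f w) powr p + c2 * norm (g w) powr p" for w
    proof -
      have "norm (f w + g w) powr p \<le> (norm (f w) + norm (g w)) powr p"
        using p by (intro powr_mono2 norm_triangle_ineq) auto
      also have "norm (f w) + norm (g w) = (A + B) * (t * (norm (f w) / A) + (1 - t) * (norm (g w) / B))"
      proof -
        have "(A + B) * (t * (norm (f w) / A) + (1 - t) * (norm (g w) / B)) =
          (A + B) * t * (norm (f w) / A) + (A + B) * (1 - t) * (norm (g w) / B)"
          by (simp only: distrib_left mult.assoc)
        moreover have "(A + B) * t = A" "(A + B) * (1 - t) = B" using 3 unfolding t(3) by (auto simp: t_def)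
        ultimately show ?thesis using 3 by simp
      qed
      also have "\<dots> powr p = (A + B) powr p * (t * (norm (f w) / A) + (1 - t) * (norm (g w) / B)) powr p"
        using 3 t by (simp add: powr_mult)
      also have "\<dots> \<le> (A + B) powr p * (t * (norm (f w) / A) powr p + (1 - t) * (norm (g w) / B) powr p)"
        using p 3 t by (intro mult_left_mono powr_convex_combination) auto
      also have "\<dots> = c1 * norm (f w) powr p + c2 * norm (g w) powr p"
        using 3 by (simp add: c1_def c2_def powr_divide field_simps)
      finally show ?thesis .
    qed
    have "(\<integral>\<^sup>+ w. ennreal (norm (f w + g w) powr p) \<partial>M) \<le>
      (\<integral>\<^sup>+ w. ennreal c1 * ennreal (norm (f w) powr p) + ennreal c2 * ennreal (norm (g w) powr p) \<partial>M)"
      using pt c by (intro nn_integral_mono) (simp flip: ennreal_mult ennreal_plus)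
    also have "\<dots> = ennreal c1 * Lp_pow M p f + ennreal c2 * Lp_pow M p g"
      by (simp add: nn_integral_add nn_integral_cmult)
    also have "\<dots> \<le> ennreal c1 * ennreal (A powr p) + ennreal c2 * ennreal (B powr p)"
      by (intro add_mono mult_left_mono fD gD) auto
    also have "\<dots> = ennreal (c1 * A powr p + c2 * B powr p)" using c by (simp flip: ennreal_mult ennreal_plus)
    also have "c1 * A powr p + c2 * B powr p = (A + B) powr p" using 3 by (simp add: c1_def c2_def field_simps)
    finally show ?thesis using 3 by (simp add: Lp_le_def)
  qed
qed

lemma Lp_le_zero: "0 \<le> B \<Longrightarrow> Lp_le M p (\<lambda>w. 0) B"
  by (simp add: Lp_le_def)

lemma Lp_le_sum:
  fixes f :: "'i \<Rightarrow> 'a \<Rightarrow> 'b::{real_normed_vector, second_countable_topology}"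
  assumes p: "1 < p" and f: "\<And>i. i \<in> I \<Longrightarrow> Lp_le M p (f i) (B i)"
  shows "Lp_le M p (\<lambda>w. \<Sum>i\<in>I. f i w) (\<Sum>i\<in>I. B i)"
  using f
proof (induction I rule: infinite_finite_induct)
  case (insert i I)
  then show ?case using Lp_le_add[OF p, of M "f i" "B i" "\<lambda>w. \<Sum>i\<in>I. f i w" "sum B I"] by simp
qed (auto simp: Lp_le_zero)

lemma Lp_le_norm_scale:
  fixes f :: "'a \<Rightarrow> 'b::real_normed_vector" and g :: "'a \<Rightarrow> 'c::real_normed_vector"
  assumes f: "Lp_le M p f A" and p: "0 \<le> p" and "g \<in> borel_measurable M" "0 \<le> c"
    and le: "AE w in M. norm (g w) \<le> c * norm (f w)"
  shows "Lp_le M p g (c * A)"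
proof -
  note fD = Lp_leD[OF f]
  note [measurable] = fD(1)
  have "AE w in M. ennreal (norm (g w) powr p) \<le> ennreal (c powr p) * ennreal (norm (f w) powr p)"
    using le
  proof eventually_elim
    case (elim w)
    then have "norm (g w) powr p \<le> (c * norm (f w)) powr p" using p by (intro powr_mono2) auto
    then show ?case using assms by (simp add: powr_mult flip: ennreal_mult)
  qed
  then have "Lp_pow M p g \<le> (\<integral>\<^sup>+ w. ennreal (c powr p) * ennreal (norm (f w) powr p) \<partial>M)"
    by (rule nn_integral_mono_AE)
  also have "\<dots> = ennreal (c powr p) * Lp_pow M p f" by (simp add: nn_integral_cmult)
  also have "\<dots> \<le> ennreal (c powr p) * ennreal (A powr p)" by (intro mult_left_mono fD) auto
  also have "\<dots> = ennreal ((c * A) powr p)" using fD assms by (simp add: powr_mult flip: ennreal_mult)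
  finally show ?thesis using assms fD by (simp add: Lp_le_def)
qed

lemma Lp_le_dom:
  fixes f :: "'a \<Rightarrow> 'b::real_normed_vector" and g :: "'a \<Rightarrow> 'c::real_normed_vector"
  assumes "Lp_le M p f A" "0 \<le> p" "g \<in> borel_measurable M"
    and "AE w in M. norm (g w) \<le> norm (f w)"
  shows "Lp_le M p g A"
  using Lp_le_norm_scale[of M p f A g 1] assms by simp

text \<open>This removes discretisation errors that can be made arbitrarily small.\<close>

lemma Lp_le_approx:
  assumes p: "1 < p" and f: "\<And>e. 0 < e \<Longrightarrow> Lp_le M p f (B + e)" and B: "0 \<le> B"
  shows "Lp_le M p f B"
proof -
  have lim: "(\<lambda>n. ennreal ((B + 1 / real (Suc n)) powr p)) \<longlonglongrightarrow> ennreal ((B + 0) powr p)"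
    using p by (intro tendsto_ennrealI tendsto_powr' tendsto_add tendsto_const lim_1_over_n[THEN LIMSEQ_Suc]) auto
  have "Lp_pow M p f \<le> ennreal ((B + 0) powr p)"
    by (rule LIMSEQ_le_const[OF lim]) (use f in \<open>auto intro!: exI[of _ 0] Lp_leD(3)\<close>)
  then show ?thesis using B Lp_leD(1)[OF f[of 1]] by (simp add: Lp_le_def)
qed

lemma powr_Max_le_sum:
  fixes a :: "'i \<Rightarrow> real"
  assumes "finite I" "I \<noteq> {}" "\<And>i. i \<in> I \<Longrightarrow> 0 \<le> a i"
  shows "Max (a ` I) powr p \<le> (\<Sum>i\<in>I. a i powr p)"
proof -
  have "Max (a ` I) \<in> a ` I" using assms by (intro Max_in) auto
  then obtain i where "i \<in> I" "Max (a ` I) = a i" by auto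
  then show ?thesis using assms member_le_sum[of i I "\<lambda>i. a i powr p"] by simp
qed

text \<open>The \<open>p\<close>-th power of a maximum is at most the sum of the \<open>p\<close>-th
  powers. This crude bound suffices for pieces whose energies are summable.\<close>

lemma Lp_le_Max:
  fixes f :: "'i \<Rightarrow> 'a \<Rightarrow> real"
  assumes p: "1 < p" and I: "finite I" "I \<noteq> {}" and f: "\<And>i. i \<in> I \<Longrightarrow> f i \<in> borel_measurable M"
    and f0: "\<And>i w. i \<in> I \<Longrightarrow> 0 \<le> f i w"
    and S: "0 \<le> S" "(\<Sum>i\<in>I. \<integral>\<^sup>+ w. ennreal (f i w powr p) \<partial>M) \<le> ennreal (S powr p)"
  shows "Lp_le M p (\<lambda>w. Max ((\<lambda>i. f i w) ` I)) S"
proof -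
  note [measurable] = f
  have [measurable]: "(\<lambda>w. Max ((\<lambda>i. f i w) ` I)) \<in> borel_measurable M"
    using I by (intro borel_measurable_Max) auto
  have M0: "0 \<le> Max ((\<lambda>i. f i w) ` I)" for w using I f0 by (subst Max_ge_iff) auto
  have "(\<integral>\<^sup>+ w. ennreal (norm (Max ((\<lambda>i. f i w) ` I)) powr p) \<partial>M) \<le> (\<integral>\<^sup>+ w. (\<Sum>i\<in>I. ennreal (f i w powr p)) \<partial>M)"
    using M0 powr_Max_le_sum[OF I, of "\<lambda>i. f i w" for w] f0
    by (intro nn_integral_mono) (auto intro!: ennreal_leI)
  also have "\<dots> = (\<Sum>i\<in>I. \<integral>\<^sup>+ w. ennreal (f i w powr p) \<partial>M)" by (rule nn_integral_sum) auto
  also note S(2)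
  finally show ?thesis using S by (simp add: Lp_le_def)
qed

lemma Lp_nn_integral:
  assumes "0 < p" "f \<in> Lp M p"
  obtains B where "0 \<le> B" "Lp_pow M p f = ennreal (B powr p)"
proof -
  define J where "J = Lp_pow M p f"
  have "J < top" using assms by (simp add: Lp_def J_def)
  then have "J = ennreal (enn2real J)" by simp
  also have "\<dots> = ennreal ((enn2real J powr (1 / p)) powr p)" using assms by (simp add: powr_powr)
  finally have "J = ennreal ((enn2real J powr (1 / p)) powr p)" .
  then show ?thesis using that[OF powr_ge_zero] unfolding J_def by blast
qed

lemma Lp_iff_Lp_le:
  assumes "0 < p"
  shows "f \<in> Lp M p \<longleftrightarrow> (\<exists>B. Lp_le M p f B)"
proof
  assume f: "f \<in> Lp M p"
  obtain B where "0 \<le> B" "Lp_pow M p f = ennreal (B powr p)"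
    using Lp_nn_integral[OF assms f] .
  then have "Lp_le M p f B" using f by (simp add: Lp_le_def Lp_def)
  then show "\<exists>B. Lp_le M p f B" ..
next
  assume "\<exists>B. Lp_le M p f B"
  then show "f \<in> Lp M p" by (auto simp: Lp_le_def Lp_def intro: le_less_trans)
qed

section \<open>Translation between extended-valued norms and real bounds\<close>

lemma epowr_ennreal: "0 \<le> x \<Longrightarrow> epowr (ennreal x) r = ennreal (x powr r)"
  by (simp add: epowr_def)

lemma epowr_inverse_le_iff:
  assumes "0 < p" "0 \<le> B"
  shows "epowr a (1 / p) \<le> ennreal B \<longleftrightarrow> a \<le> ennreal (B powr p)"
proof (cases a)
  case (real x)
  have "x powr (1 / p) \<le> B \<longleftrightarrow> x \<le> B powr p"
  proof
    assume "x powr (1 / p) \<le> B"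
    then have "(x powr (1 / p)) powr p \<le> B powr p" using assms by (intro powr_mono2) auto
    then show "x \<le> B powr p" using assms real by (simp add: powr_powr)
  next
    assume "x \<le> B powr p"
    then have "x powr (1 / p) \<le> (B powr p) powr (1 / p)" using assms real by (intro powr_mono2) auto
    then show "x powr (1 / p) \<le> B" using assms by (simp add: powr_powr)
  qed
  then show ?thesis using real assms by (simp add: epowr_ennreal)
qed (auto simp: epowr_def top_unique)

lemma lpnormE_le_iff:
  assumes "0 < p" "0 \<le> B"
  shows "lpnormE M p g \<le> ennreal B \<longleftrightarrow> (\<integral>\<^sup>+ w. epowr (g w) p \<partial>M) \<le> ennreal (B powr p)"
  unfolding lpnormE_def using assms by (rule epowr_inverse_le_iff)

lemma lpnorm_le_iff:
  assumes "0 < p" "0 \<le> B" "f \<in> borel_measurable M"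
  shows "lpnorm M p f \<le> ennreal B \<longleftrightarrow> Lp_le M p f B"
  unfolding lpnorm_def using assms by (simp add: lpnormE_le_iff epowr_ennreal Lp_le_def)

lemma lpnorm_eq_Lp_le:
  assumes "0 < p" "f \<in> Lp M p"
  obtains B where "0 \<le> B" "lpnorm M p f = ennreal B" "Lp_le M p f B"
proof -
  have m: "f \<in> borel_measurable M" using assms by (simp add: Lp_def)
  obtain B where B: "Lp_le M p f B" using assms Lp_iff_Lp_le by blast
  then have "lpnorm M p f \<le> ennreal B" using lpnorm_le_iff[OF assms(1) Lp_leD(2)[OF B] m] by simp
  then obtain B' where B': "0 \<le> B'" "lpnorm M p f = ennreal B'"
    by (metis ennreal_cases ennreal_less_top leD top.not_eq_extremum)
  then show ?thesis using lpnorm_le_iff[OF assms(1) B'(1) m] that by simp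
qed

section \<open>Polynomials in the operator\<close>

text \<open>For a contraction this dominates the operator norm of the polynomial in the
  operator.\<close>

definition l1norm :: "real poly \<Rightarrow> real" where
  "l1norm c = (\<Sum>k\<le>degree c. \<bar>coeff c k\<bar>)"

lemma l1norm_eq: "degree c \<le> n \<Longrightarrow> l1norm c = (\<Sum>k\<le>n. \<bar>coeff c k\<bar>)"
  unfolding l1norm_def by (rule sum.mono_neutral_left) (auto simp: coeff_eq_0)

lemma l1norm_nonneg [simp]: "0 \<le> l1norm c"
  by (simp add: l1norm_def sum_nonneg)

lemma l1norm_0 [simp]: "l1norm 0 = 0"
  by (simp add: l1norm_def)

lemma l1norm_1 [simp]: "l1norm 1 = 1"
  by (simp add: l1norm_def)

lemma l1norm_pCons: "l1norm (pCons a c) = \<bar>a\<bar> + l1norm c"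
  by (subst l1norm_eq[where n = "Suc (degree c)"])
     (auto simp: degree_pCons_le sum.atMost_Suc_shift l1norm_def simp del: sum.atMost_Suc)

lemma l1norm_add: "l1norm (c + d) \<le> l1norm c + l1norm d"
proof -
  define n where "n = max (degree c) (degree d)"
  have "l1norm (c + d) = (\<Sum>k\<le>n. \<bar>coeff c k + coeff d k\<bar>)"
    by (subst l1norm_eq[where n = n]) (auto simp: n_def degree_add_le)
  also have "\<dots> \<le> (\<Sum>k\<le>n. \<bar>coeff c k\<bar> + \<bar>coeff d k\<bar>)" by (intro sum_mono) simp
  also have "\<dots> = l1norm c + l1norm d"
    by (simp add: sum.distrib l1norm_eq[where n = n] n_def)
  finally show ?thesis .
qed

lemma l1norm_smult [simp]: "l1norm (smult a c) = \<bar>a\<bar> * l1norm c"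
  by (simp add: l1norm_def abs_mult sum_distrib_left)

lemma l1norm_minus [simp]: "l1norm (- c) = l1norm c"
  by (simp add: l1norm_def)

lemma l1norm_diff: "l1norm (c - d) \<le> l1norm c + l1norm d"
  using l1norm_add[of c "- d"] by simp

lemma l1norm_mult: "l1norm (c * d) \<le> l1norm c * l1norm d"
proof (induction c)
  case (pCons a c)
  have "l1norm (pCons a c * d) \<le> \<bar>a\<bar> * l1norm d + l1norm (c * d)"
    using l1norm_add[of "smult a d" "pCons 0 (c * d)"] by (simp add: l1norm_pCons)
  also have "\<dots> \<le> \<bar>a\<bar> * l1norm d + l1norm c * l1norm d" using pCons by simp
  finally show ?case by (simp add: l1norm_pCons distrib_right)
qed simp

lemma l1norm_sum: "l1norm (\<Sum>i\<in>I. c i) \<le> (\<Sum>i\<in>I. l1norm (c i))"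
proof (induction I rule: infinite_finite_induct)
  case (insert i I)
  then show ?case using l1norm_add[of "c i" "sum c I"] by simp
qed auto

lemma l1norm_power_le:
  assumes "l1norm c \<le> B"
  shows "l1norm (c ^ n) \<le> B ^ n"
proof (induction n)
  case (Suc n)
  have "0 \<le> B" using assms l1norm_nonneg[of c] by linarith
  have "l1norm (c ^ Suc n) \<le> l1norm c * l1norm (c ^ n)" by (simp add: l1norm_mult)
  also have "\<dots> \<le> B * B ^ n" using assms Suc \<open>0 \<le> B\<close> by (intro mult_mono) auto
  finally show ?case by simp
qed simp

lemma l1norm_mult_le: "l1norm c \<le> A \<Longrightarrow> l1norm d \<le> B \<Longrightarrow> l1norm (c * d) \<le> A * B"
  by (rule order_trans[OF l1norm_mult mult_mono]) (auto intro: order_trans[OF l1norm_nonneg])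

lemma l1norm_monom [simp]: "l1norm (monom a n) = \<bar>a\<bar>"
proof -
  have "l1norm (monom a n) = (\<Sum>k\<le>n. if k = n then \<bar>a\<bar> else 0)"
    unfolding l1norm_eq[OF degree_monom_le] by (rule sum.cong) auto
  then show ?thesis by simp
qed

text \<open>Young's convolution inequality for a bounded and a summable sequence: a polynomial with
  uniformly small coefficients keeps this property after multiplication.\<close>

lemma abs_coeff_mult_le:
  assumes "\<And>k. \<bar>coeff c k\<bar> \<le> B"
  shows "\<bar>coeff (c * d) k\<bar> \<le> B * l1norm d"
proof (induction d arbitrary: k)
  case 0
  then show ?case by simp
next
  case (pCons a d)
  have "coeff (c * pCons a d) k = a * coeff c k + coeff (pCons 0 (c * d)) k" by simp
  also have "\<bar>\<dots>\<bar> \<le> \<bar>a\<bar> * \<bar>coeff c k\<bar> + \<bar>coeff (pCons 0 (c * d)) k\<bar>"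
    by (rule order_trans[OF abs_triangle_ineq]) (simp add: abs_mult)
  also have "\<bar>a\<bar> * \<bar>coeff c k\<bar> \<le> \<bar>a\<bar> * B" using assms by (intro mult_left_mono) auto
  also have "\<bar>coeff (pCons 0 (c * d)) k\<bar> \<le> B * l1norm d"
  proof (cases k)
    case 0
    have "0 \<le> B" using assms[of 0] by linarith
    then show ?thesis using 0 by simp
  qed (use pCons.IH in simp)
  finally show ?case by (simp add: l1norm_pCons algebra_simps)
qed

section \<open>Polynomial calculus of a contractively regular operator\<close>

locale regular_contraction =
  fixes M :: "'a measure" and p :: real and T :: "('a \<Rightarrow> complex) \<Rightarrow> ('a \<Rightarrow> complex)"
  assumes p_gt_1: "1 < p" and operator: "Lp_operator M p T" and regular: "contractively_regular M p T"
begin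

lemma p_pos: "0 < p" and p_nonneg: "0 \<le> p" using p_gt_1 by auto

lemma Lp_I: "Lp_le M p f B \<Longrightarrow> f \<in> Lp M p"
  by (rule iffD2[OF Lp_iff_Lp_le[OF p_pos]]) (rule exI)

lemma Lp_E:
  assumes "f \<in> Lp M p"
  obtains B where "Lp_le M p f B"
  using iffD1[OF Lp_iff_Lp_le[OF p_pos] assms] that by (elim exE)

lemma Lp_measurable: "f \<in> Lp M p \<Longrightarrow> f \<in> borel_measurable M"
  by (simp add: Lp_def)

lemma Lp_add:
  assumes "f \<in> Lp M p" "g \<in> Lp M p" shows "(\<lambda>w. f w + g w) \<in> Lp M p"
proof -
  obtain A B where "Lp_le M p f A" "Lp_le M p g B" using assms Lp_E by meson
  then have "Lp_le M p (\<lambda>w. f w + g w) (A + B)" by (rule Lp_le_add[OF p_gt_1])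
  then show ?thesis by (rule Lp_I)
qed

lemma Lp_scale:
  assumes "f \<in> Lp M p" shows "(\<lambda>w. c * f w) \<in> Lp M p"
proof -
  obtain B where "Lp_le M p f B" using assms by (rule Lp_E)
  then have "Lp_le M p (\<lambda>w. c * f w) (cmod c * B)"
    by (rule Lp_le_norm_scale) (use Lp_measurable[OF assms] p_nonneg in \<open>auto simp: norm_mult\<close>)
  then show ?thesis by (rule Lp_I)
qed

lemma Lp_zero: "(\<lambda>w. 0) \<in> Lp M p"
  by (rule Lp_I[of _ 0]) (simp add: Lp_le_zero)

lemma Lp_sum: "(\<And>i. i \<in> I \<Longrightarrow> f i \<in> Lp M p) \<Longrightarrow> (\<lambda>w. \<Sum>i\<in>I. c i * f i w) \<in> Lp M p"
proof (induction I rule: infinite_finite_induct)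
  case (insert i I)
  then show ?case using Lp_add[OF Lp_scale[of "f i" "c i"], of "\<lambda>w. \<Sum>i\<in>I. c i * f i w"] by simp
qed (auto simp: Lp_zero)

lemma T_Lp: "f \<in> Lp M p \<Longrightarrow> T f \<in> Lp M p"
  using operator by (simp add: Lp_operator_def)

lemma T_cong: "f \<in> Lp M p \<Longrightarrow> g \<in> Lp M p \<Longrightarrow> AE w in M. f w = g w \<Longrightarrow> AE w in M. T f w = T g w"
  using operator by (simp add: Lp_operator_def)

lemma T_linear: "f \<in> Lp M p \<Longrightarrow> g \<in> Lp M p \<Longrightarrow> AE w in M. T (\<lambda>v. f v + c * g v) w = T f w + c * T g w"
  using operator by (simp add: Lp_operator_def)

lemma T_zero: "AE w in M. T (\<lambda>w. 0) w = 0"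
  using T_linear[OF Lp_zero Lp_zero, of 1] by eventually_elim simp

lemma T_sum:
  assumes "\<And>i. i \<in> I \<Longrightarrow> f i \<in> Lp M p"
  shows "AE w in M. T (\<lambda>w. \<Sum>i\<in>I. c i * f i w) w = (\<Sum>i\<in>I. c i * T (f i) w)"
  using assms
proof (induction I rule: infinite_finite_induct)
  case (insert i I)
  have "AE w in M. T (\<lambda>w. (\<Sum>i\<in>I. c i * f i w) + c i * f i w) w = T (\<lambda>w. \<Sum>i\<in>I. c i * f i w) w + c i * T (f i) w"
    using insert by (intro T_linear Lp_sum) auto
  moreover have "AE w in M. T (\<lambda>w. \<Sum>i\<in>I. c i * f i w) w = (\<Sum>i\<in>I. c i * T (f i) w)"
    by (rule insert.IH) (use insert.prems in simp)
  moreover have "(\<lambda>w. (\<Sum>i\<in>I. c i * f i w) + c i * f i w) = (\<lambda>w. \<Sum>i\<in>insert i I. c i * f i w)"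
    using insert by (simp add: add.commute)
  ultimately have "AE w in M. T (\<lambda>w. \<Sum>i\<in>insert i I. c i * f i w) w = (\<Sum>i\<in>I. c i * T (f i) w) + c i * T (f i) w"
    by auto
  then show ?case using insert.hyps by (simp add: add.commute)
qed (auto simp: T_zero)

lemma T_bound:
  assumes f: "Lp_le M p f B"
  shows "Lp_le M p (T f) B"
proof -
  have L: "f \<in> Lp M p" "T f \<in> Lp M p" using f by (auto intro: T_Lp Lp_I)
  \<comment> \<open>Contractive regularity for sequences of length one is plain
    contractivity.\<close>
  have "lpnormE M p (\<lambda>w. SUP k\<in>{..<1::nat}. ennreal (cmod (T f w)))
          \<le> lpnormE M p (\<lambda>w. SUP k\<in>{..<1::nat}. ennreal (cmod (f w)))"
    using regular L(1) unfolding contractively_regular_def by (elim allE[of _ 1] allE[of _ "\<lambda>_. f"]) auto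
  then have "lpnorm M p (T f) \<le> lpnorm M p f" by (simp add: lpnorm_def lessThan_Suc lessThan_0)
  also have "\<dots> \<le> ennreal B" using f L p_pos Lp_leD[OF f] by (subst lpnorm_le_iff) auto
  finally show ?thesis using Lp_leD[OF f] L p_pos Lp_measurable by (subst (asm) lpnorm_le_iff) auto
qed

lemma T_nn_integral:
  assumes "f \<in> Lp M p"
  shows "Lp_pow M p (T f) \<le> Lp_pow M p f"
proof -
  obtain B where B: "0 \<le> B" "Lp_pow M p f = ennreal (B powr p)"
    using Lp_nn_integral[OF p_pos assms] .
  then have "Lp_le M p f B" using assms by (simp add: Lp_le_def Lp_measurable)
  then show ?thesis using Lp_leD(3)[OF T_bound] B by auto
qed

lemma Tpow_Lp: "f \<in> Lp M p \<Longrightarrow> (T ^^ k) f \<in> Lp M p"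
  by (induction k) (auto intro: T_Lp)

lemma Tpow_cong:
  "f \<in> Lp M p \<Longrightarrow> g \<in> Lp M p \<Longrightarrow> AE w in M. f w = g w \<Longrightarrow> AE w in M. (T ^^ k) f w = (T ^^ k) g w"
proof (induction k)
  case (Suc k)
  then have "AE w in M. T ((T ^^ k) f) w = T ((T ^^ k) g) w" by (intro T_cong Tpow_Lp)
  then show ?case by simp
qed simp

lemma Tpow_bound: "Lp_le M p f B \<Longrightarrow> Lp_le M p ((T ^^ k) f) B"
  by (induction k) (auto intro: T_bound)

definition peval :: "real poly \<Rightarrow> ('a \<Rightarrow> complex) \<Rightarrow> 'a \<Rightarrow> complex" where
  "peval c f = (\<lambda>w. \<Sum>k\<le>degree c. complex_of_real (coeff c k) * (T ^^ k) f w)"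

lemma peval_eq: "degree c \<le> n \<Longrightarrow> peval c f w = (\<Sum>k\<le>n. complex_of_real (coeff c k) * (T ^^ k) f w)"
  unfolding peval_def by (rule sum.mono_neutral_left) (auto simp: coeff_eq_0)

lemma peval_0 [simp]: "peval 0 f w = 0"
  by (simp add: peval_def)

lemma peval_1 [simp]: "peval 1 f w = f w"
  by (simp add: peval_def)

lemma peval_add: "peval (c + d) f w = peval c f w + peval d f w"
proof -
  define n where "n = max (degree c) (degree d)"
  have "degree (c + d) \<le> n" "degree c \<le> n" "degree d \<le> n" by (auto simp: n_def degree_add_le)
  then show ?thesis by (simp add: peval_eq[where n = n] sum.distrib distrib_right)
qed

lemma peval_smult: "peval (smult a c) f w = complex_of_real a * peval c f w"
  by (cases "a = 0") (auto simp: peval_def sum_distrib_left mult_ac)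

lemma peval_minus: "peval (- c) f w = - peval c f w"
  using peval_smult[of "-1" c f w] by simp

lemma peval_diff: "peval (c - d) f w = peval c f w - peval d f w"
  using peval_add[of c "- d" f w] by (simp add: peval_minus)

lemma peval_sum: "peval (\<Sum>i\<in>I. c i) f w = (\<Sum>i\<in>I. peval (c i) f w)"
  by (induction I rule: infinite_finite_induct) (auto simp: peval_add)

lemma peval_Lp: "f \<in> Lp M p \<Longrightarrow> peval c f \<in> Lp M p"
  unfolding peval_def by (intro Lp_sum Tpow_Lp)

lemma peval_monom: "peval (monom a n) f w = complex_of_real a * (T ^^ n) f w"
proof -
  have "peval (monom a n) f w = (\<Sum>k\<le>n. if k = n then complex_of_real a * (T ^^ n) f w else 0)"
    unfolding peval_eq[OF degree_monom_le] by (rule sum.cong) auto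
  then show ?thesis by simp
qed

text \<open>\<open>T\<close> acts on representatives and is linear only up to null sets, so this
  Horner rule, and the multiplicativity and additivity derived from it by induction, hold almost
  everywhere.\<close>

lemma peval_pCons:
  assumes "f \<in> Lp M p"
  shows "AE w in M. peval (pCons a c) f w = complex_of_real a * f w + T (peval c f) w"
proof -
  have "AE w in M. T (peval c f) w = (\<Sum>k\<le>degree c. complex_of_real (coeff c k) * T ((T ^^ k) f) w)"
    unfolding peval_def using assms by (intro T_sum Tpow_Lp)
  then show ?thesis
  proof eventually_elim
    case (elim w)
    then show ?case by (subst peval_eq[where n = "Suc (degree c)"])
      (auto simp: degree_pCons_le sum.atMost_Suc_shift simp del: sum.atMost_Suc)
  qed
qed

lemma peval_mult:
  assumes "f \<in> Lp M p"
  shows "AE w in M. peval (c * d) f w = peval c (peval d f) w"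
proof (induction c)
  case (pCons a c)
  have 1: "AE w in M. T (peval (c * d) f) w = T (peval c (peval d f)) w"
    using assms pCons by (intro T_cong peval_Lp)
  have 2: "AE w in M. peval (pCons 0 (c * d)) f w = complex_of_real 0 * f w + T (peval (c * d) f) w"
    using assms by (rule peval_pCons)
  have 3: "AE w in M. peval (pCons a c) (peval d f) w = complex_of_real a * peval d f w + T (peval c (peval d f)) w"
    using assms by (intro peval_pCons peval_Lp)
  show ?case using 1 2 3 by eventually_elim (simp add: peval_add peval_smult)
qed simp

lemma peval_add_arg:
  assumes "f \<in> Lp M p" "g \<in> Lp M p"
  shows "AE w in M. peval c (\<lambda>w. f w + g w) w = peval c f w + peval c g w"
proof (induction c)
  case (pCons a c)
  have "AE w in M. T (peval c (\<lambda>w. f w + g w)) w = T (\<lambda>w. peval c f w + 1 * peval c g w) w"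
  proof (rule T_cong)
    show "peval c (\<lambda>w. f w + g w) \<in> Lp M p" using assms by (intro peval_Lp Lp_add)
    show "(\<lambda>w. peval c f w + 1 * peval c g w) \<in> Lp M p" using assms by (intro Lp_add Lp_scale peval_Lp)
  qed (use pCons in simp)
  moreover have "AE w in M. T (\<lambda>w. peval c f w + 1 * peval c g w) w = T (peval c f) w + 1 * T (peval c g) w"
    using assms by (intro T_linear peval_Lp)
  moreover note peval_pCons[OF assms(1), of a c] peval_pCons[OF assms(2), of a c] peval_pCons[OF Lp_add[OF assms], of a c]
  ultimately show ?case by eventually_elim (simp add: distrib_left)
qed simp

lemma peval_bound:
  assumes f: "Lp_le M p f B"
  shows "Lp_le M p (peval c f) (l1norm c * B)"
  unfolding peval_def l1norm_def sum_distrib_right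
proof (rule Lp_le_sum[OF p_gt_1])
  fix k
  show "Lp_le M p (\<lambda>w. complex_of_real (coeff c k) * (T ^^ k) f w) (\<bar>coeff c k\<bar> * B)"
    using p_nonneg Lp_measurable[OF Tpow_Lp[OF Lp_I[OF f]]]
    by (intro Lp_le_norm_scale[OF Tpow_bound[OF f]]) (auto simp: norm_mult)
qed

definition op_le :: "real poly \<Rightarrow> real \<Rightarrow> bool" where
  "op_le c L \<longleftrightarrow> 0 \<le> L \<and> (\<forall>f B. Lp_le M p f B \<longrightarrow> Lp_le M p (peval c f) (L * B))"

lemma op_le_l1norm: "l1norm c \<le> L \<Longrightarrow> op_le c L"
  unfolding op_le_def
proof (intro conjI allI impI)
  assume le: "l1norm c \<le> L"
  then show "0 \<le> L" using l1norm_nonneg[of c] by linarith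
  fix f :: "'a \<Rightarrow> complex" and B assume f: "Lp_le M p f B"
  have "l1norm c * B \<le> L * B" using le Lp_leD(2)[OF f] by (rule mult_right_mono)
  then show "Lp_le M p (peval c f) (L * B)"
    using Lp_le_mono[OF peval_bound[OF f] p_nonneg] Lp_leD(1)[OF peval_bound[OF f]] by auto
qed

lemma op_le_mult:
  assumes c: "op_le c L" and d: "op_le d K"
  shows "op_le (c * d) (L * K)"
  unfolding op_le_def
proof (intro conjI allI impI)
  show "0 \<le> L * K" using c d by (simp add: op_le_def)
  fix f :: "'a \<Rightarrow> complex" and B assume f: "Lp_le M p f B"
  have fL: "f \<in> Lp M p" using f by (rule Lp_I)
  have "Lp_le M p (peval c (peval d f)) (L * (K * B))"
    using c d f by (simp add: op_le_def)
  moreover have "AE w in M. cmod (peval (c * d) f w) \<le> cmod (peval c (peval d f) w)"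
    using peval_mult[OF fL, of c d] by eventually_elim simp
  ultimately show "Lp_le M p (peval (c * d) f) (L * K * B)"
    using p_nonneg Lp_measurable[OF peval_Lp[OF fL]] by (auto simp: mult.assoc intro: Lp_le_dom)
qed

lemma op_le_mono:
  assumes "op_le c L" "L \<le> L'" shows "op_le c L'"
  unfolding op_le_def
proof (intro conjI allI impI)
  show "0 \<le> L'" using assms by (simp add: op_le_def)
  fix f :: "'a \<Rightarrow> complex" and B assume f: "Lp_le M p f B"
  have 1: "Lp_le M p (peval c f) (L * B)" using assms(1) f by (simp add: op_le_def)
  show "Lp_le M p (peval c f) (L' * B)"
    by (rule Lp_le_mono[OF 1 p_nonneg Lp_leD(1)[OF 1]])
       (use assms(2) Lp_leD(2)[OF f] in \<open>auto intro: mult_right_mono\<close>)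
qed

lemma op_le_power: "op_le c L \<Longrightarrow> op_le (c ^ n) (L ^ n)"
proof (induction n)
  case 0
  then show ?case using op_le_l1norm[of 1 1] by simp
next
  case (Suc n)
  then show ?case using op_le_mult[of c L "c ^ n" "L ^ n"] by simp
qed

lemma op_le_smult:
  assumes "op_le c L" shows "op_le (smult a c) (\<bar>a\<bar> * L)"
  using op_le_mult[OF op_le_l1norm[of "[:a:]" "\<bar>a\<bar>"] assms] by (simp add: l1norm_pCons)

end

section \<open>Averages over finite partitions\<close>

definition avg :: "'a measure \<Rightarrow> 'a set \<Rightarrow> ('a \<Rightarrow> 'b::{banach, second_countable_topology}) \<Rightarrow> 'b" where
  "avg M A f = (\<integral>w. indicator A w *\<^sub>R f w \<partial>M) /\<^sub>R measure M A"

text \<open>With the values \<open>avg M A f\<close> this is the conditional expectation of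
  \<open>f\<close> onto the cells of \<open>P\<close>, set to 0 off the cells.\<close>

definition step :: "'a set set \<Rightarrow> ('a set \<Rightarrow> 'b::real_vector) \<Rightarrow> 'a \<Rightarrow> 'b" where
  "step P a = (\<lambda>w. \<Sum>A\<in>P. indicator A w *\<^sub>R a A)"

text \<open>The cells are not asked to cover the space: a function in \<open>Lp\<close> is
  negligible off a set of finite measure, so arbitrary measure spaces are treated by finitely many
  cells.\<close>

definition atoms :: "'a measure \<Rightarrow> 'a set set \<Rightarrow> bool" where
  "atoms M P \<longleftrightarrow> finite P \<and> disjoint P \<and> (\<forall>A\<in>P. A \<in> sets M \<and> 0 < emeasure M A \<and> emeasure M A < \<infinity>)"

lemma Lp_le_finite: "Lp_le M p f B \<Longrightarrow> Lp_pow M p f < \<infinity>"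
  by (auto simp: Lp_le_def intro: le_less_trans)

text \<open>On a set of finite measure \<open>|f|\<close> is dominated by
  \<open>1 + |f| powr p\<close>.\<close>

lemma Lp_le_integrable_on:
  fixes f :: "'a \<Rightarrow> 'b::{banach, second_countable_topology}"
  assumes p: "1 < p" and f: "Lp_le M p f B" and A: "A \<in> sets M" "emeasure M A < \<infinity>"
  shows "integrable M (\<lambda>w. indicator A w *\<^sub>R f w)"
    and "integrable M (\<lambda>w. indicator A w *\<^sub>R norm (f w) powr p)"
proof -
  note [measurable] = Lp_leD(1)[OF f] A(1)
  have "(\<integral>\<^sup>+ w. ennreal (norm (indicator A w *\<^sub>R f w)) \<partial>M) \<le>
    (\<integral>\<^sup>+ w. indicator A w + ennreal (norm (f w) powr p) \<partial>M)"
  proof (rule nn_integral_mono)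
    fix w
    have "norm (f w) \<le> 1 + norm (f w) powr p"
    proof (cases "norm (f w) \<le> 1")
      case False
      then have "norm (f w) powr 1 \<le> norm (f w) powr p" using p by (intro powr_mono) auto
      then show ?thesis using False by simp
    qed (auto intro: order_trans[of _ 1])
    then show "ennreal (norm (indicator A w *\<^sub>R f w)) \<le> indicator A w + ennreal (norm (f w) powr p)"
      by (auto simp: indicator_def simp flip: ennreal_plus ennreal_1 intro!: ennreal_leI)
  qed
  also have "\<dots> = emeasure M A + Lp_pow M p f"
    by (subst nn_integral_add) auto
  also have "\<dots> < \<infinity>" using A Lp_le_finite[OF f] by simp
  finally show "integrable M (\<lambda>w. indicator A w *\<^sub>R f w)" by (intro integrableI_bounded) auto
  have "(\<integral>\<^sup>+ w. ennreal (norm (indicator A w *\<^sub>R norm (f w) powr p)) \<partial>M) \<le> Lp_pow M p f"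
    by (intro nn_integral_mono) (auto simp: indicator_def)
  also have "\<dots> < \<infinity>" using Lp_le_finite[OF f] .
  finally show "integrable M (\<lambda>w. indicator A w *\<^sub>R norm (f w) powr p)" by (intro integrableI_bounded) auto
qed

lemma norm_avg_le:
  "norm (avg M A f) \<le> avg M A (\<lambda>w. norm (f w))"
proof -
  have "norm (\<integral>w. indicator A w *\<^sub>R f w \<partial>M) \<le> (\<integral>w. norm (indicator A w *\<^sub>R f w) \<partial>M)"
    by (rule integral_norm_bound)
  also have "\<dots> = (\<integral>w. indicator A w *\<^sub>R norm (f w) \<partial>M)" by simp
  finally show ?thesis unfolding avg_def by (simp add: mult_left_mono)
qed

text \<open>Jensen's inequality, by integrating over \<open>A\<close> the tangent line at the mean
  \<open>s\<close> of \<open>|f|\<close>; \<open>k1\<close> and \<open>k2\<close> are its intercept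
  and slope.\<close>

lemma avg_powr_le:
  fixes f :: "'a \<Rightarrow> 'b::{banach, second_countable_topology}"
  assumes p: "1 < p" and f: "Lp_le M p f B" and A: "A \<in> sets M" "0 < emeasure M A" "emeasure M A < \<infinity>"
  shows "ennreal (measure M A * norm (avg M A f) powr p) \<le> (\<integral>\<^sup>+ w. indicator A w * ennreal (norm (f w) powr p) \<partial>M)"
proof -
  note [measurable] = Lp_leD(1)[OF f] A(1)
  define m s where "m = measure M A" and "s = avg M A (\<lambda>w. norm (f w))"
  have m: "m > 0" using A by (simp add: m_def measure_def enn2real_positive_iff)
  have fn: "Lp_le M p (\<lambda>w. norm (f w)) B" using f by (simp add: Lp_le_def)
  note int = Lp_le_integrable_on[OF p f A(1,3)] Lp_le_integrable_on(1)[OF p fn A(1,3)]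
  have s0: "0 \<le> s" using norm_avg_le[of M A f] norm_ge_zero[of "avg M A f"] unfolding s_def by linarith
  have intA: "integrable M (\<lambda>w. indicator A w :: real)" "(\<integral>w. indicator A w \<partial>M) = m"
    using A by (auto simp: m_def integrable_indicator_iff)
  have sm: "(\<integral>w. indicator A w *\<^sub>R norm (f w) \<partial>M) = m * s" using m by (simp add: s_def avg_def m_def)
  define k1 k2 where "k1 = s powr p - p * s powr (p - 1) * s" and "k2 = p * s powr (p - 1)"
  have int': "integrable M (\<lambda>w. k1 * indicator A w)" "integrable M (\<lambda>w. k2 * (indicator A w *\<^sub>R norm (f w)))"
    using int(3) intA(1) by auto
  have "m * s powr p = k1 * m + k2 * (m * s)" by (simp add: k1_def k2_def algebra_simps)
  also have "\<dots> = (\<integral>w. k1 * indicator A w \<partial>M) + (\<integral>w. k2 * (indicator A w *\<^sub>R norm (f w)) \<partial>M)"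
    unfolding integral_mult_right_zero intA(2) sm ..
  also have "\<dots> = (\<integral>w. k1 * indicator A w + k2 * (indicator A w *\<^sub>R norm (f w)) \<partial>M)"
    by (rule Bochner_Integration.integral_add[OF int', symmetric])
  also have "\<dots> \<le> (\<integral>w. indicator A w *\<^sub>R norm (f w) powr p \<partial>M)"
  proof (rule integral_mono)
    fix w assume "w \<in> space M"
    show "k1 * indicator A w + k2 * (indicator A w *\<^sub>R norm (f w)) \<le> indicator A w *\<^sub>R norm (f w) powr p"
      using powr_tangent_le[OF p s0, of "norm (f w)"] by (auto simp: indicator_def algebra_simps k1_def k2_def)
  qed (use int int' in auto)
  finally have "m * s powr p \<le> (\<integral>w. indicator A w *\<^sub>R norm (f w) powr p \<partial>M)" .
  moreover have "norm (avg M A f) powr p \<le> s powr p" unfolding s_def using p by (intro powr_mono2 norm_avg_le) auto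
  ultimately have "m * norm (avg M A f) powr p \<le> (\<integral>w. indicator A w *\<^sub>R norm (f w) powr p \<partial>M)"
    using m mult_left_mono[of "norm (avg M A f) powr p" "s powr p" m] by linarith
  then have "ennreal (m * norm (avg M A f) powr p) \<le> ennreal (\<integral>w. indicator A w *\<^sub>R norm (f w) powr p \<partial>M)"
    by (rule ennreal_leI)
  also have "\<dots> = (\<integral>\<^sup>+ w. ennreal (indicator A w *\<^sub>R norm (f w) powr p) \<partial>M)"
    using int(2) by (subst nn_integral_eq_integral) (auto simp: indicator_def)
  also have "\<dots> = (\<integral>\<^sup>+ w. indicator A w * ennreal (norm (f w) powr p) \<partial>M)"
    by (intro nn_integral_cong) (auto simp: indicator_def)
  finally show ?thesis by (simp add: m_def)
qed

lemma avg_diff: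
  fixes f g :: "'a \<Rightarrow> 'b::{banach, second_countable_topology}"
  assumes p: "1 < p" and "Lp_le M p f B" "Lp_le M p g C" "A \<in> sets M" "emeasure M A < \<infinity>"
  shows "avg M A (\<lambda>w. f w - g w) = avg M A f - avg M A g"
  using Lp_le_integrable_on(1)[OF p assms(2,4,5)] Lp_le_integrable_on(1)[OF p assms(3-5)]
  unfolding avg_def by (simp add: scaleR_diff_right Bochner_Integration.integral_diff)

lemma avg_cong_AE:
  fixes f g :: "'a \<Rightarrow> 'b::{banach, second_countable_topology}"
  assumes "f \<in> borel_measurable M" "g \<in> borel_measurable M" "A \<in> sets M" "AE w in M. f w = g w"
  shows "avg M A f = avg M A g"
proof -
  note [measurable] = assms(1-3)
  have "(\<integral>w. indicator A w *\<^sub>R f w \<partial>M) = (\<integral>w. indicator A w *\<^sub>R g w \<partial>M)"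
    by (rule integral_cong_AE) (use assms(4) in auto)
  then show ?thesis by (simp add: avg_def)
qed

lemma avg_mono:
  fixes f g :: "'a \<Rightarrow> real"
  assumes p: "1 < p" and "Lp_le M p f B" "Lp_le M p g C" "A \<in> sets M" "emeasure M A < \<infinity>"
    and "AE w in M. f w \<le> g w"
  shows "avg M A f \<le> avg M A g"
proof -
  have "(\<integral>w. indicator A w *\<^sub>R f w \<partial>M) \<le> (\<integral>w. indicator A w *\<^sub>R g w \<partial>M)"
    using assms(6) by (intro integral_mono_AE Lp_le_integrable_on(1)[OF p assms(2,4,5)] Lp_le_integrable_on(1)[OF p assms(3-5)])
      (auto elim!: eventually_mono intro!: mult_left_mono)
  then show ?thesis by (simp add: avg_def mult_left_mono)
qed

context
  fixes M :: "'a measure" and P :: "'a set set"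
  assumes P: "atoms M P"
begin

lemma atoms_finite: "finite P" and atomsD: "A \<in> P \<Longrightarrow> A \<in> sets M" "A \<in> P \<Longrightarrow> 0 < emeasure M A"
    "A \<in> P \<Longrightarrow> emeasure M A < \<infinity>" "A \<in> P \<Longrightarrow> 0 < measure M A"
  using P by (auto simp: atoms_def measure_def enn2real_positive_iff)

lemma atoms_eq: "A \<in> P \<Longrightarrow> B \<in> P \<Longrightarrow> w \<in> A \<Longrightarrow> w \<in> B \<Longrightarrow> A = B"
  using P by (auto simp: atoms_def disjoint_def)

lemma step_in:
  assumes "A \<in> P" "w \<in> A" shows "step P a w = a A"
proof -
  have "step P a w = (\<Sum>B\<in>P. if B = A then a A else 0)"
    unfolding step_def using assms atoms_eq by (intro sum.cong) (auto simp: indicator_def)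
  then show ?thesis using assms atoms_finite by simp
qed

lemma step_out: "(\<And>A. A \<in> P \<Longrightarrow> w \<notin> A) \<Longrightarrow> step P a w = 0"
  unfolding step_def by (intro sum.neutral) auto

lemma step_cases:
  obtains (inside) A where "A \<in> P" "w \<in> A" | (outside) "\<And>A. A \<in> P \<Longrightarrow> w \<notin> A"
  by blast

lemma step_measurable [measurable]:
  fixes a :: "'a set \<Rightarrow> 'b::{real_normed_vector, second_countable_topology}"
  shows "step P a \<in> borel_measurable M"
  unfolding step_def using atomsD(1) by (intro borel_measurable_sum borel_measurable_scaleR) auto

lemma sum_indicator_atoms_le: "(\<Sum>A\<in>P. indicator A w) \<le> (1 :: ennreal)"
proof (cases w rule: step_cases)
  case (inside A)
  have "(\<Sum>B\<in>P. indicator B w) = (\<Sum>B\<in>P. if B = A then 1 else 0 :: ennreal)"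
    using inside atoms_eq by (intro sum.cong) (auto simp: indicator_def)
  then show ?thesis using inside atoms_finite by simp
next
  case outside
  then have "(\<Sum>B\<in>P. indicator B w) = (0 :: ennreal)" by (intro sum.neutral) auto
  then show ?thesis by simp
qed

lemma sum_nn_integral_atoms_le:
  assumes [measurable]: "u \<in> borel_measurable M"
  shows "(\<Sum>A\<in>P. \<integral>\<^sup>+ w. indicator A w * u w \<partial>M) \<le> (\<integral>\<^sup>+ w. u w \<partial>M)"
proof -
  note [measurable] = atomsD(1)
  have "(\<Sum>A\<in>P. \<integral>\<^sup>+ w. indicator A w * u w \<partial>M) = (\<integral>\<^sup>+ w. (\<Sum>A\<in>P. indicator A w * u w) \<partial>M)"
    by (rule nn_integral_sum[symmetric]) auto
  also have "\<dots> \<le> (\<integral>\<^sup>+ w. u w \<partial>M)"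
    by (intro nn_integral_mono)
       (auto simp flip: sum_distrib_right intro: mult_right_mono[OF sum_indicator_atoms_le, simplified])
  finally show ?thesis .
qed

lemma nn_integral_step:
  fixes a :: "'a set \<Rightarrow> 'b::{real_normed_vector, second_countable_topology}"
  shows "Lp_pow M p (step P a) = ennreal (\<Sum>A\<in>P. measure M A * norm (a A) powr p)"
proof -
  note [measurable] = atomsD(1)
  have pt: "ennreal (norm (step P a w) powr p) = (\<Sum>A\<in>P. ennreal (norm (a A) powr p) * indicator A w)" for w
  proof (cases w rule: step_cases)
    case (inside A)
    have "(\<Sum>B\<in>P. ennreal (norm (a B) powr p) * indicator B w) = (\<Sum>B\<in>P. if B = A then ennreal (norm (a A) powr p) else 0)"
      using inside atoms_eq by (intro sum.cong) (auto simp: indicator_def)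
    then show ?thesis using inside atoms_finite by (simp add: step_in)
  next
    case outside
    then have "(\<Sum>B\<in>P. ennreal (norm (a B) powr p) * indicator B w) = 0" by (intro sum.neutral) auto
    then show ?thesis using outside by (simp add: step_out)
  qed
  have "Lp_pow M p (step P a) = (\<Sum>A\<in>P. \<integral>\<^sup>+ w. ennreal (norm (a A) powr p) * indicator A w \<partial>M)"
    unfolding pt by (rule nn_integral_sum) auto
  also have "\<dots> = (\<Sum>A\<in>P. ennreal (measure M A * norm (a A) powr p))"
  proof (rule sum.cong)
    fix A assume A: "A \<in> P"
    have "emeasure M A = ennreal (measure M A)" using atomsD(3)[OF A] by (intro emeasure_eq_ennreal_measure) auto
    then show "(\<integral>\<^sup>+ w. ennreal (norm (a A) powr p) * indicator A w \<partial>M) = ennreal (measure M A * norm (a A) powr p)"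
      unfolding nn_integral_cmult_indicator[OF atomsD(1)[OF A]] by (simp add: ennreal_mult mult.commute)
  qed simp
  also have "\<dots> = ennreal (\<Sum>A\<in>P. measure M A * norm (a A) powr p)" by (rule sum_ennreal) simp
  finally show ?thesis .
qed

lemma Lp_le_step_iff:
  fixes a :: "'a set \<Rightarrow> 'b::{real_normed_vector, second_countable_topology}"
  shows "Lp_le M p (step P a) B \<longleftrightarrow> 0 \<le> B \<and> (\<Sum>A\<in>P. measure M A * norm (a A) powr p) \<le> B powr p"
  unfolding Lp_le_def nn_integral_step by simp

text \<open>Contractivity of conditional expectation: Jensen's inequality on each cell, then
  disjointness of the cells.\<close>

lemma sum_avg_powr_le:
  fixes f :: "'a \<Rightarrow> 'b::{banach, second_countable_topology}"
  assumes p: "1 < p" and f: "Lp_le M p f B"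
  shows "Lp_le M p (step P (\<lambda>A. avg M A f)) B"
  unfolding Lp_le_step_iff
proof (intro conjI)
  note [measurable] = Lp_leD(1)[OF f]
  show "0 \<le> B" using f by (rule Lp_leD)
  have "ennreal (\<Sum>A\<in>P. measure M A * norm (avg M A f) powr p) = (\<Sum>A\<in>P. ennreal (measure M A * norm (avg M A f) powr p))"
    by (rule sum_ennreal[symmetric]) simp
  also have "\<dots> \<le> (\<Sum>A\<in>P. \<integral>\<^sup>+ w. indicator A w * ennreal (norm (f w) powr p) \<partial>M)"
    by (intro sum_mono avg_powr_le[OF p f] atomsD)
  also have "\<dots> \<le> Lp_pow M p f"
    by (rule sum_nn_integral_atoms_le) auto
  also have "\<dots> \<le> ennreal (B powr p)" using f by (rule Lp_leD)
  finally show "(\<Sum>A\<in>P. measure M A * norm (avg M A f) powr p) \<le> B powr p" by simp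
qed

end

section \<open>Reduction to matrices\<close>

context regular_contraction
begin

text \<open>The matrix of \<open>T\<close> compressed to step functions: apply \<open>T\<close> to
  the indicator of a cell and average the result over another cell.\<close>

definition avg_mat :: "'a set \<Rightarrow> 'a set \<Rightarrow> complex" where
  "avg_mat A B = avg M A (T (indicator B))"

context
  fixes P :: "'a set set"
  assumes P: "atoms M P"
begin

lemma step_Lp: "step P a \<in> Lp M p"
proof -
  define S where "S = (\<Sum>A\<in>P. measure M A * cmod (a A) powr p)"
  have "0 \<le> S" by (auto simp: S_def sum_nonneg)
  then have "Lp_le M p (step P a) (S powr (1 / p))"
    unfolding Lp_le_step_iff[OF P] S_def[symmetric] using p_pos by (simp add: powr_powr)
  then show ?thesis by (rule Lp_I)
qed

lemma indicator_Lp: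
  assumes "A \<in> P" shows "(indicator A :: 'a \<Rightarrow> complex) \<in> Lp M p"
proof -
  have "step P (\<lambda>B. if B = A then 1 else 0) = (indicator A :: 'a \<Rightarrow> complex)"
  proof
    fix w
    have "step P (\<lambda>B. if B = A then 1 else 0) w = (\<Sum>B\<in>P. if B = A then indicator A w else (0 :: complex))"
      unfolding step_def by (intro sum.cong) (auto simp: indicator_def)
    then show "step P (\<lambda>B. if B = A then 1 else 0) w = (indicator A w :: complex)"
      using assms atoms_finite[OF P] by simp
  qed
  then show ?thesis using step_Lp by metis
qed

lemma avg_T_step:
  assumes A: "A \<in> P"
  shows "avg M A (T (step P a)) = mapply P avg_mat a A"
proof -
  note A' = atomsD[OF P A]
  have st: "step P a = (\<lambda>w. \<Sum>B\<in>P. a B * indicator B w)"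
    by (auto simp: step_def indicator_def intro!: sum.cong)
  have TI: "T (indicator B) \<in> Lp M p" if "B \<in> P" for B using that by (intro T_Lp indicator_Lp)
  have int: "integrable M (\<lambda>w. indicator A w *\<^sub>R T (indicator B) w)" if "B \<in> P" for B
    using Lp_E[OF TI[OF that]] Lp_le_integrable_on(1)[OF p_gt_1 _ A'(1,3)] by metis
  have "avg M A (T (step P a)) = avg M A (\<lambda>w. \<Sum>B\<in>P. a B * T (indicator B) w)"
  proof (rule avg_cong_AE[OF _ _ A'(1)])
    show "AE w in M. T (step P a) w = (\<Sum>B\<in>P. a B * T (indicator B) w)"
      unfolding st by (intro T_sum indicator_Lp)
    show "T (step P a) \<in> borel_measurable M" by (intro Lp_measurable T_Lp step_Lp)
    show "(\<lambda>w. \<Sum>B\<in>P. a B * T (indicator B) w) \<in> borel_measurable M"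
      using TI by (intro Lp_measurable Lp_sum)
  qed
  also have "\<dots> = (\<integral>w. (\<Sum>B\<in>P. a B * (indicator A w *\<^sub>R T (indicator B) w)) \<partial>M) /\<^sub>R measure M A"
    unfolding avg_def by (simp add: scaleR_sum_right)
  also have "(\<integral>w. (\<Sum>B\<in>P. a B * (indicator A w *\<^sub>R T (indicator B) w)) \<partial>M)
    = (\<Sum>B\<in>P. a B * (\<integral>w. indicator A w *\<^sub>R T (indicator B) w \<partial>M))"
  proof -
    have "(\<integral>w. (\<Sum>B\<in>P. a B * (indicator A w *\<^sub>R T (indicator B) w)) \<partial>M)
      = (\<Sum>B\<in>P. \<integral>w. a B * (indicator A w *\<^sub>R T (indicator B) w) \<partial>M)"
      by (intro Bochner_Integration.integral_sum integrable_mult_right int)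
    then show ?thesis by (simp only: integral_mult_right_zero)
  qed
  finally show ?thesis by (simp add: mapply_def avg_mat_def avg_def scaleR_sum_right mult_ac)
qed

text \<open>The entries of the matrix are rotated onto the positive axis row by row; contractive regularity
  handles all rows simultaneously.\<close>

lemma avg_mat_modulus_contraction:
  assumes a: "\<And>A. A \<in> P \<Longrightarrow> 0 \<le> a A"
  shows "(\<Sum>A\<in>P. measure M A * mapply P (\<lambda>A B. cmod (avg_mat A B)) a A powr p)
    \<le> (\<Sum>A\<in>P. measure M A * a A powr p)"
proof -
  \<comment> \<open>The function for row \<open>A\<close> carries the conjugate phases of that row,
    so averaging \<open>T (y A)\<close> over \<open>A\<close> yields the row of moduli applied to
    \<open>a\<close>. All these functions have the common majorant \<open>step P a\<close>, whose
    norm is the right-hand side.\<close>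
  define y where "y = (\<lambda>A. step P (\<lambda>B. complex_of_real (a B) * cnj (sgn (avg_mat A B))))"
  define S where "S = (\<Sum>A\<in>P. measure M A * a A powr p)"
  have S0: "0 \<le> S" by (auto simp: S_def sum_nonneg)
  define B where "B = S powr (1 / p)"
  have B: "0 \<le> B" "B powr p = S" using p_pos S0 by (auto simp: B_def powr_powr)
  obtain e where e: "bij_betw e {0..<card P} P" using ex_bij_betw_nat_finite[OF atoms_finite[OF P]] by blast
  have eP: "e k \<in> P" if "k < card P" for k using e that by (auto simp: bij_betw_def)
  have yL: "y A \<in> Lp M p" for A unfolding y_def by (rule step_Lp)
  let ?N = "card P"
  have y_le: "cmod (y A w) \<le> step P a w" for A w
  proof (cases w rule: step_cases[OF P, case_names inside outside])
    case (inside C)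
    then show ?thesis using a[OF inside(1)] unfolding y_def
      by (simp add: step_in[OF P inside] norm_mult norm_sgn)
  qed (simp add: y_def step_out[OF P])
  have "(\<integral>\<^sup>+ w. epowr (SUP k\<in>{..<?N}. ennreal (cmod (y (e k) w))) p \<partial>M) \<le>
      Lp_pow M p (step P a)"
  proof (rule nn_integral_mono)
    fix w
    have "0 \<le> step P a w" using y_le[of undefined w] norm_ge_zero[of "y undefined w"] by linarith
    have "(SUP k\<in>{..<?N}. ennreal (cmod (y (e k) w))) \<le> ennreal (step P a w)"
      by (intro SUP_least ennreal_leI y_le)
    then obtain t where t: "(SUP k\<in>{..<?N}. ennreal (cmod (y (e k) w))) = ennreal t" "0 \<le> t" "t \<le> step P a w"
      using \<open>0 \<le> step P a w\<close> by (cases "SUP k\<in>{..<?N}. ennreal (cmod (y (e k) w))") (auto simp: top_unique)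
    then have "t powr p \<le> step P a w powr p" using p_nonneg by (intro powr_mono2)
    then show "epowr (SUP k\<in>{..<?N}. ennreal (cmod (y (e k) w))) p \<le> ennreal (norm (step P a w) powr p)"
      unfolding t(1) using t \<open>0 \<le> step P a w\<close> by (simp add: epowr_ennreal ennreal_leI)
  qed
  also have "\<dots> = ennreal (B powr p)"
    unfolding nn_integral_step[OF P] B(2) S_def by (intro arg_cong[where f = ennreal] sum.cong) (auto simp: a)
  finally have "lpnormE M p (\<lambda>w. SUP k\<in>{..<?N}. ennreal (cmod (y (e k) w))) \<le> ennreal B"
    using lpnormE_le_iff[OF p_pos B(1)] by blast
  moreover have "lpnormE M p (\<lambda>w. SUP k\<in>{..<?N}. ennreal (cmod (T (y (e k)) w)))
     \<le> lpnormE M p (\<lambda>w. SUP k\<in>{..<?N}. ennreal (cmod (y (e k) w)))"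
    using regular yL unfolding contractively_regular_def by (elim allE[of _ ?N] allE[of _ "\<lambda>k. y (e k)"]) auto
  ultimately have "lpnormE M p (\<lambda>w. SUP k\<in>{..<?N}. ennreal (cmod (T (y (e k)) w))) \<le> ennreal B" by simp
  then have TB: "(\<integral>\<^sup>+ w. epowr (SUP k\<in>{..<?N}. ennreal (cmod (T (y (e k)) w))) p \<partial>M) \<le> ennreal S"
    using lpnormE_le_iff[OF p_pos B(1)] B(2) by metis
  have TyL: "T (y A) \<in> Lp M p" for A using yL by (rule T_Lp)
  define v where "v = (\<lambda>w. SUP k\<in>{..<?N}. ennreal (cmod (T (y (e k)) w)))"
  have vm: "(\<lambda>w. ennreal (enn2real (v w) powr p)) \<in> borel_measurable M"
    unfolding v_def using TyL[THEN Lp_measurable] by measurable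
  have pt: "ennreal (cmod (T (y A) w) powr p) \<le> ennreal (enn2real (v w) powr p)" if A: "A \<in> P" for A w
  proof -
    have "A \<in> e ` {0..<?N}" using e A by (simp add: bij_betw_def)
    then obtain k where k: "k < ?N" "e k = A" by auto
    have "ennreal (cmod (T (y A) w)) \<le> v w" unfolding v_def using k by (intro SUP_upper2[of k]) auto
    moreover have "v w \<noteq> top"
    proof -
      have "v w \<le> (\<Sum>k<?N. ennreal (cmod (T (y (e k)) w)))"
        unfolding v_def by (intro SUP_least member_le_sum) auto
      also have "\<dots> < top" by simp
      finally show ?thesis by simp
    qed
    ultimately have "cmod (T (y A) w) \<le> enn2real (v w)"
      by (cases "v w") auto
    then show ?thesis using p_nonneg by (intro ennreal_leI powr_mono2) auto
  qed
  have avg_y: "avg M A (T (y A)) = complex_of_real (mapply P (\<lambda>A B. cmod (avg_mat A B)) a A)" if A: "A \<in> P" for A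
  proof -
    have *: "avg_mat A B * cnj (sgn (avg_mat A B)) = complex_of_real (cmod (avg_mat A B))" for B
    proof -
      have "avg_mat A B * cnj (sgn (avg_mat A B)) = complex_of_real ((cmod (avg_mat A B))\<^sup>2 / cmod (avg_mat A B))"
        unfolding of_real_divide complex_norm_square by (simp add: sgn_eq)
      then show ?thesis by (simp add: power2_eq_square)
    qed
    have "avg M A (T (y A)) = (\<Sum>B\<in>P. complex_of_real (a B) * (avg_mat A B * cnj (sgn (avg_mat A B))))"
      unfolding y_def avg_T_step[OF A] by (simp add: mapply_def mult_ac)
    then show ?thesis unfolding * by (simp add: mapply_def mult_ac)
  qed
  have "ennreal (\<Sum>A\<in>P. measure M A * mapply P (\<lambda>A B. cmod (avg_mat A B)) a A powr p)
     = (\<Sum>A\<in>P. ennreal (measure M A * cmod (avg M A (T (y A))) powr p))"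
  proof (subst sum_ennreal)
    have "0 \<le> mapply P (\<lambda>A B. cmod (avg_mat A B)) a A" if "A \<in> P" for A
      using that a by (intro mapply_nonneg) auto
    then show "ennreal (\<Sum>A\<in>P. measure M A * mapply P (\<lambda>A B. cmod (avg_mat A B)) a A powr p)
     = ennreal (\<Sum>A\<in>P. measure M A * cmod (avg M A (T (y A))) powr p)"
      by (intro arg_cong[where f = ennreal] sum.cong) (auto simp: avg_y)
  qed simp
  also have "\<dots> \<le> (\<Sum>A\<in>P. \<integral>\<^sup>+ w. indicator A w * ennreal (cmod (T (y A) w) powr p) \<partial>M)"
  proof (rule sum_mono)
    fix A assume A: "A \<in> P"
    obtain C where "Lp_le M p (T (y A)) C" using TyL by (rule Lp_E)
    then show "ennreal (measure M A * cmod (avg M A (T (y A))) powr p) \<le> (\<integral>\<^sup>+ w. indicator A w * ennreal (cmod (T (y A) w) powr p) \<partial>M)"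
      by (rule avg_powr_le[OF p_gt_1 _ atomsD(1-3)[OF P A]])
  qed
  also have "\<dots> \<le> (\<Sum>A\<in>P. \<integral>\<^sup>+ w. indicator A w * ennreal (enn2real (v w) powr p) \<partial>M)"
    by (intro sum_mono nn_integral_mono mult_left_mono pt) auto
  also have "\<dots> \<le> (\<integral>\<^sup>+ w. ennreal (enn2real (v w) powr p) \<partial>M)"
    by (rule sum_nn_integral_atoms_le[OF P vm])
  also have "\<dots> \<le> (\<integral>\<^sup>+ w. epowr (v w) p \<partial>M)"
    by (intro nn_integral_mono) (auto simp: epowr_def)
  also have "\<dots> \<le> ennreal S" using TB by (simp add: v_def)
  finally show ?thesis using S0 by (simp add: S_def)
qed

text \<open>In each step the accumulated error passes through \<open>T\<close> and the averaging,
  both contractions, without growing; averaging \<open>(T ^^ Suc k) f\<close> adds one new error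
  \<open>e\<close>. Hence the factor \<open>Suc k\<close>.\<close>

lemma Tpow_step_approx:
  assumes f: "f \<in> Lp M p" and e: "0 \<le> e"
    and apx: "\<And>k. k \<le> n \<Longrightarrow> Lp_le M p (\<lambda>w. (T ^^ k) f w - step P (\<lambda>A. avg M A ((T ^^ k) f)) w) e"
  shows "k \<le> n \<Longrightarrow> Lp_le M p (\<lambda>w. (T ^^ k) f w - step P ((mapply P avg_mat ^^ k) (\<lambda>A. avg M A f)) w) (real (Suc k) * e)"
proof (induction k)
  case 0
  then show ?case using apx[of 0] by simp
next
  case (Suc k)
  define s where "s = step P ((mapply P avg_mat ^^ k) (\<lambda>A. avg M A f))"
  define g where "g = (T ^^ k) f"
  have L: "g \<in> Lp M p" "s \<in> Lp M p" "T g \<in> Lp M p" "T s \<in> Lp M p"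
    using f by (auto simp: g_def s_def intro!: Tpow_Lp step_Lp T_Lp)
  have IH: "Lp_le M p (\<lambda>w. g w + (-1) * s w) (real (Suc k) * e)" using Suc by (simp add: g_def s_def)
  have "AE w in M. T (\<lambda>w. g w + (-1) * s w) w = T g w + (-1) * T s w"
    using L by (intro T_linear)
  then have d: "Lp_le M p (\<lambda>w. T g w - T s w) (real (Suc k) * e)"
    using L[THEN Lp_measurable] p_nonneg by (intro Lp_le_dom[OF T_bound[OF IH]]) auto
  have "Lp_le M p (step P (\<lambda>A. avg M A (\<lambda>w. T g w - T s w))) (real (Suc k) * e)"
    by (rule sum_avg_powr_le[OF P p_gt_1 d])
  moreover have "step P (\<lambda>A. avg M A (\<lambda>w. T g w - T s w)) = (\<lambda>w.
     step P (\<lambda>A. avg M A ((T ^^ Suc k) f)) w - step P ((mapply P avg_mat ^^ Suc k) (\<lambda>A. avg M A f)) w)"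
  proof (rule ext)
    fix w
    show "step P (\<lambda>A. avg M A (\<lambda>w. T g w - T s w)) w =
      step P (\<lambda>A. avg M A ((T ^^ Suc k) f)) w - step P ((mapply P avg_mat ^^ Suc k) (\<lambda>A. avg M A f)) w"
    proof (cases w rule: step_cases[OF P, case_names inside outside])
      case (inside A)
      obtain B C where "Lp_le M p (T g) B" "Lp_le M p (T s) C" using L(3,4) Lp_E by meson
      then have "avg M A (\<lambda>w. T g w - T s w) = avg M A (T g) - avg M A (T s)"
        using atomsD[OF P inside(1)] by (intro avg_diff[OF p_gt_1])
      moreover have "avg M A (T s) = (mapply P avg_mat ^^ Suc k) (\<lambda>A. avg M A f) A"
        unfolding s_def by (simp add: avg_T_step[OF inside(1)])
      ultimately show ?thesis by (simp add: step_in[OF P inside] g_def)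
    qed (simp add: step_out[OF P])
    qed
    ultimately have "Lp_le M p (\<lambda>w. step P (\<lambda>A. avg M A ((T ^^ Suc k) f)) w -
       step P ((mapply P avg_mat ^^ Suc k) (\<lambda>A. avg M A f)) w) (real (Suc k) * e)" by simp
    then have "Lp_le M p (\<lambda>w. ((T ^^ Suc k) f w - step P (\<lambda>A. avg M A ((T ^^ Suc k) f)) w) +
      (step P (\<lambda>A. avg M A ((T ^^ Suc k) f)) w -
       step P ((mapply P avg_mat ^^ Suc k) (\<lambda>A. avg M A f)) w)) (e + real (Suc k) * e)"
      by (rule Lp_le_add[OF p_gt_1 apx[OF Suc.prems]])
    then show ?case by (simp add: algebra_simps)
  qed

  end

  section \<open>Approximation by step functions over a common partition\<close>

  lemma simple_function_approx:
    assumes f: "f \<in> Lp M p" and e: "0 < e"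
    obtains s :: "'a \<Rightarrow> complex" where "simple_function M s" "s \<in> Lp M p" "Lp_le M p (\<lambda>w. f w - s w) e"
  proof -
    have [measurable]: "f \<in> borel_measurable M" using f by (rule Lp_measurable)
    obtain s where s: "\<And>i. simple_function M (s i)" "\<And>x. x \<in> space M \<Longrightarrow> (\<lambda>i. s i x) \<longlonglongrightarrow> f x"
      "\<And>i x. x \<in> space M \<Longrightarrow> cmod (s i x) \<le> 2 * cmod (f x)"
      using borel_measurable_implies_sequence_metric[of f M 0] by simp metis
    have [measurable]: "s i \<in> borel_measurable M" for i using s(1) by (rule borel_measurable_simple_function)
    obtain B where B: "Lp_le M p f B" using f by (rule Lp_E)
    have fin: "(\<integral>\<^sup>+ w. ennreal (3 powr p) * ennreal (cmod (f w) powr p) \<partial>M) < \<infinity>"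
      using Lp_le_finite[OF B] by (simp add: nn_integral_cmult ennreal_mult_less_top)
    have "(\<lambda>i. \<integral>\<^sup>+ w. ennreal (cmod (f w - s i w) powr p) \<partial>M) \<longlonglongrightarrow> (\<integral>\<^sup>+ w. 0 \<partial>M)"
    proof (rule nn_integral_dominated_convergence[OF _ _ _ _ fin])
      fix i
      show "AE w in M. ennreal (cmod (f w - s i w) powr p) \<le> ennreal (3 powr p) * ennreal (cmod (f w) powr p)"
      proof (rule AE_I2)
        fix w assume "w \<in> space M"
        then have "cmod (f w - s i w) \<le> 3 * cmod (f w)" using norm_triangle_ineq4[of "f w" "s i w"] s(3)[of w i] by linarith
        then have "cmod (f w - s i w) powr p \<le> (3 * cmod (f w)) powr p" using p_nonneg by (intro powr_mono2) auto
        then show "ennreal (cmod (f w - s i w) powr p) \<le> ennreal (3 powr p) * ennreal (cmod (f w) powr p)"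
          by (simp add: powr_mult flip: ennreal_mult)
      qed
    next
      show "AE w in M. (\<lambda>i. ennreal (cmod (f w - s i w) powr p)) \<longlonglongrightarrow> 0"
      proof (rule AE_I2)
        fix w assume w: "w \<in> space M"
        have "(\<lambda>i. cmod (f w - s i w)) \<longlonglongrightarrow> cmod (f w - f w)" using s(2)[OF w] by (intro tendsto_intros)
        then have "(\<lambda>i. cmod (f w - s i w) powr p) \<longlonglongrightarrow> cmod (f w - f w) powr p"
          using p_pos by (intro tendsto_powr') auto
        then show "(\<lambda>i. ennreal (cmod (f w - s i w) powr p)) \<longlonglongrightarrow> 0"
          using tendsto_ennrealI[of _ "cmod (f w - f w) powr p"] by fastforce
      qed
    qed auto
    then have "\<forall>\<^sub>F i in sequentially. (\<integral>\<^sup>+ w. ennreal (cmod (f w - s i w) powr p) \<partial>M) < ennreal (e powr p)"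
      using e by (intro order_tendstoD(2)) auto
    then obtain i where i: "(\<integral>\<^sup>+ w. ennreal (cmod (f w - s i w) powr p) \<partial>M) < ennreal (e powr p)"
      using eventually_happens'[OF sequentially_bot] by blast
    have "Lp_le M p (s i) (2 * B)"
      using p_nonneg s(3) by (intro Lp_le_norm_scale[OF B]) auto
    moreover have "Lp_le M p (\<lambda>w. f w - s i w) e" using i e by (simp add: Lp_le_def)
    ultimately show ?thesis using that[OF s(1)] Lp_I by blast
  qed

  text \<open>The cells are the joint level sets of the family. The common zero set is left out,
    since it may have infinite measure; on any other level set some member has a fixed nonzero
    modulus, so its integrability forces finite measure. Null level sets are dropped as well, whence
    equality almost everywhere.\<close>

  lemma ex_atoms_simple:
    fixes s :: "'i \<Rightarrow> 'a \<Rightarrow> complex"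
    assumes I: "finite I" and s: "\<And>i. i \<in> I \<Longrightarrow> simple_function M (s i)" "\<And>i. i \<in> I \<Longrightarrow> s i \<in> Lp M p"
    obtains P where "atoms M P" "\<And>i. i \<in> I \<Longrightarrow> AE w in M. step P (\<lambda>A. avg M A (s i)) w = s i w"
  proof -
    define \<Phi> where "\<Phi> = (\<lambda>w. restrict (\<lambda>i. s i w) I)"
    define z where "z = restrict (\<lambda>i. 0 :: complex) I"
    define lev where "lev = (\<lambda>v. {w \<in> space M. \<Phi> w = v})"
    have fin: "finite (\<Phi> ` space M)"
    proof (rule finite_subset)
      show "\<Phi> ` space M \<subseteq> (\<Pi>\<^sub>E i\<in>I. s i ` space M)" by (auto simp: \<Phi>_def)
      show "finite (\<Pi>\<^sub>E i\<in>I. s i ` space M)" using I s(1) by (intro finite_PiE) (auto simp: simple_function_def)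
    qed
    define P where "P = {A \<in> lev ` (\<Phi> ` space M - {z}). 0 < emeasure M A}"
    have lev_sets: "lev v \<in> sets M" if "v \<in> \<Phi> ` space M" for v
    proof -
      have "lev v = {w \<in> space M. \<forall>i\<in>I. s i w = v i}"
        using that by (auto simp: lev_def \<Phi>_def restrict_def fun_eq_iff)
      also have "\<dots> \<in> sets M"
      proof (rule sets.sets_Collect_finite_All[OF _ I])
        fix i assume "i \<in> I"
        then have [measurable]: "s i \<in> borel_measurable M" using s(1) by (intro borel_measurable_simple_function)
        show "{w \<in> space M. s i w = v i} \<in> sets M" by measurable
      qed
      finally show ?thesis .
    qed
    have lev_fin: "emeasure M (lev v) < \<infinity>" if v: "v \<in> \<Phi> ` space M" "v \<noteq> z" for v
    proof -
      obtain w0 where w0: "w0 \<in> space M" "v = \<Phi> w0" using v by auto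
      obtain i where i: "i \<in> I" "v i \<noteq> 0" using v(2) w0 by (auto simp: z_def \<Phi>_def restrict_def fun_eq_iff split: if_splits)
      obtain B where B: "Lp_le M p (s i) B" using s(2)[OF i(1)] by (rule Lp_E)
      have "ennreal (cmod (v i) powr p) * emeasure M (lev v) = (\<integral>\<^sup>+ w. ennreal (cmod (v i) powr p) * indicator (lev v) w \<partial>M)"
        using lev_sets[OF v(1)] by (simp add: nn_integral_cmult_indicator)
      also have "\<dots> \<le> Lp_pow M p (s i)"
        using i by (intro nn_integral_mono) (auto simp: indicator_def lev_def \<Phi>_def)
      also have "\<dots> < \<infinity>" using Lp_le_finite[OF B] .
      finally have "ennreal (cmod (v i) powr p) * emeasure M (lev v) < \<infinity>" .
      then show ?thesis using i by (auto simp: ennreal_mult_less_top)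
    qed
    have PA: "atoms M P"
      unfolding atoms_def
    proof (intro conjI)
      show "finite P" unfolding P_def using fin by auto
      show "disjoint P" unfolding P_def by (auto simp: disjoint_def lev_def)
      show "\<forall>A\<in>P. A \<in> sets M \<and> 0 < emeasure M A \<and> emeasure M A < \<infinity>" unfolding P_def using lev_sets lev_fin by auto
    qed
    have "AE w in M. step P (\<lambda>A. avg M A (s i)) w = s i w" if i: "i \<in> I" for i
    proof -
      have null: "AE w in M. \<forall>v\<in>\<Phi> ` space M - {z}. emeasure M (lev v) = 0 \<longrightarrow> w \<notin> lev v"
      proof (rule AE_finite_allI)
        show "finite (\<Phi> ` space M - {z})" using fin by simp
        fix v assume v: "v \<in> \<Phi> ` space M - {z}"
        show "AE w in M. emeasure M (lev v) = 0 \<longrightarrow> w \<notin> lev v"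
        proof (cases "emeasure M (lev v) = 0")
          case True
          then have "lev v \<in> null_sets M" using lev_sets v by auto
          then show ?thesis by (auto dest: AE_not_in)
        qed simp
      qed
      show ?thesis using null AE_space
      proof eventually_elim
        case (elim w)
        show ?case
        proof (cases "\<Phi> w = z")
          case True
          then have "s i w = 0" using i by (auto simp: \<Phi>_def z_def restrict_def fun_eq_iff split: if_splits)
          moreover have "w \<notin> A" if "A \<in> P" for A using that True by (auto simp: P_def lev_def)
          ultimately show ?thesis by (simp add: step_out[OF PA])
        next
          case False
          define A where "A = lev (\<Phi> w)"
          have wA: "w \<in> A" using elim by (simp add: A_def lev_def)
          have A: "A \<in> P" using elim False wA by (auto simp: P_def A_def zero_less_iff_neq_zero)
          have "(\<integral>x. indicator A x *\<^sub>R s i x \<partial>M) = (\<integral>x. indicator A x *\<^sub>R s i w \<partial>M)"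
          proof (rule arg_cong[where f = "integral\<^sup>L M"], rule ext)
            fix x
            show "indicator A x *\<^sub>R s i x = indicator A x *\<^sub>R s i w"
            proof (cases "x \<in> A")
              case True
              then have "\<Phi> x i = \<Phi> w i" by (simp add: A_def lev_def)
              then show ?thesis using i by (simp add: \<Phi>_def)
            qed simp
          qed
          also have "\<dots> = measure M A *\<^sub>R s i w" using atomsD(1,3)[OF PA A] by simp
          finally have "avg M A (s i) = s i w" using atomsD(4)[OF PA A] by (simp add: avg_def)
          then show ?thesis by (simp add: step_in[OF PA A wA])
        qed
    qed
  qed
  then show ?thesis using that[OF PA] by blast
qed

text \<open>Averaging reproduces the simple approximants \<open>s i\<close>. With
  \<open>d = f i - s i\<close>, the error of averaging \<open>f i\<close> is therefore
  \<open>d\<close> minus its own averages, and both have norm at most \<open>e / 2\<close>.\<close>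

lemma ex_atoms_approx:
  fixes f :: "'i \<Rightarrow> 'a \<Rightarrow> complex"
  assumes I: "finite I" and f: "\<And>i. i \<in> I \<Longrightarrow> f i \<in> Lp M p" and e: "0 < e"
  obtains P where "atoms M P" "\<And>i. i \<in> I \<Longrightarrow> Lp_le M p (\<lambda>w. f i w - step P (\<lambda>A. avg M A (f i)) w) e"
proof -
  have "\<forall>i\<in>I. \<exists>s. simple_function M s \<and> s \<in> Lp M p \<and> Lp_le M p (\<lambda>w. f i w - s w) (e / 2)"
    using f e simple_function_approx[of _ "e / 2"] by (metis half_gt_zero)
  then obtain s where s: "\<And>i. i \<in> I \<Longrightarrow> simple_function M (s i)" "\<And>i. i \<in> I \<Longrightarrow> s i \<in> Lp M p"
    "\<And>i. i \<in> I \<Longrightarrow> Lp_le M p (\<lambda>w. f i w - s i w) (e / 2)" by metis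
  obtain P where P: "atoms M P" "\<And>i. i \<in> I \<Longrightarrow> AE w in M. step P (\<lambda>A. avg M A (s i)) w = s i w"
    using ex_atoms_simple[of I s, OF I s(1,2)] by blast
  have "Lp_le M p (\<lambda>w. f i w - step P (\<lambda>A. avg M A (f i)) w) e" if i: "i \<in> I" for i
  proof -
    define d where "d = (\<lambda>w. f i w - s i w)"
    have d: "Lp_le M p d (e / 2)" using s(3)[OF i] by (simp add: d_def)
    have fm: "f i \<in> borel_measurable M" using f[OF i] by (rule Lp_measurable)
    note Ed = sum_avg_powr_le[OF P(1) p_gt_1 d]
    have "Lp_le M p (\<lambda>w. - step P (\<lambda>A. avg M A d) w) (e / 2)"
      using Lp_leD(1)[OF Ed] p_nonneg by (intro Lp_le_dom[OF Ed]) auto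
    then have sum: "Lp_le M p (\<lambda>w. d w + (- step P (\<lambda>A. avg M A d) w)) (e / 2 + e / 2)"
      by (rule Lp_le_add[OF p_gt_1 d])
    have "step P (\<lambda>A. avg M A d) w = step P (\<lambda>A. avg M A (f i)) w - step P (\<lambda>A. avg M A (s i)) w" for w
    proof (cases w rule: step_cases[OF P(1), case_names inside outside])
      case (inside A)
      obtain B C where "Lp_le M p (f i) B" "Lp_le M p (s i) C" using f[OF i] s(2)[OF i] Lp_E by meson
      then have "avg M A d = avg M A (f i) - avg M A (s i)"
        unfolding d_def using atomsD[OF P(1) inside(1)] by (intro avg_diff[OF p_gt_1])
      then show ?thesis by (simp add: step_in[OF P(1) inside])
    qed (simp add: step_out[OF P(1)])
    then have "AE w in M. norm (f i w - step P (\<lambda>A. avg M A (f i)) w) \<le> norm (d w + (- step P (\<lambda>A. avg M A d) w))"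
      using P(2)[OF i] by (auto simp: d_def)
    then have "Lp_le M p (\<lambda>w. f i w - step P (\<lambda>A. avg M A (f i)) w) (e / 2 + e / 2)"
      by (rule Lp_le_dom[OF sum p_nonneg borel_measurable_diff[OF fm step_measurable[OF P(1)]]])
    then show ?thesis by simp
  qed
  then show ?thesis using that[OF P(1)] by blast
qed

section \<open>Transfer of the maximal inequality to polynomials in the operator\<close>

lemma cmod_peval_measurable:
  assumes "f \<in> Lp M p" shows "(\<lambda>w. cmod (peval c f w)) \<in> borel_measurable M"
  using Lp_measurable[OF peval_Lp[OF assms]] by measurable

text \<open>The coefficients of \<open>c i\<close> are dominated by \<open>K\<close> times those of
  the mean of the first \<open>N i\<close> powers. On a fine partition the averaged orbits are
  dominated by iterates of the modulus matrix applied to the averages of \<open>G\<close>, where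
  \<open>matrix_maximal\<close> applies; the discretisation error is at most
  \<open>\<delta>\<close>. Different polynomials may act on different functions as long as one
  \<open>G\<close> dominates them all.\<close>

lemma maximal_inequality:
  fixes f :: "'i \<Rightarrow> 'a \<Rightarrow> complex" and G :: "'a \<Rightarrow> real"
  assumes I: "finite I" "I \<noteq> {}" and f: "\<And>i. i \<in> I \<Longrightarrow> f i \<in> Lp M p"
    and G: "Lp_le M p G \<Gamma>" and fG: "\<And>i. i \<in> I \<Longrightarrow> AE w in M. cmod (f i w) \<le> G w"
    and K: "0 \<le> K" and deg: "\<And>i. i \<in> I \<Longrightarrow> degree (c i) < N i"
    and coeff: "\<And>i k. i \<in> I \<Longrightarrow> \<bar>coeff (c i) k\<bar> \<le> K / N i"
  shows "Lp_le M p (\<lambda>w. Max ((\<lambda>i. cmod (peval (c i) (f i) w)) ` I)) (p / (p - 1) * K * \<Gamma>)"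
proof (rule Lp_le_approx[OF p_gt_1])
  define q where "q = p / (p - 1)"
  have pq: "1 < p" "1 < q" "1 / p + 1 / q = 1" using p_gt_1 by (auto simp: q_def field_simps)
  have \<Gamma>: "0 \<le> \<Gamma>" using G by (rule Lp_leD)
  show "0 \<le> p / (p - 1) * K * \<Gamma>" using pq K \<Gamma> by (auto simp: q_def)
  fix \<delta> :: real assume \<delta>: "0 < \<delta>"
  define n where "n = Max ((\<lambda>i. degree (c i)) ` I)"
  have degn: "degree (c i) \<le> n" if "i \<in> I" for i using that I by (auto simp: n_def)
  \<comment> \<open>Total weight with which the errors of \<open>Tpow_step_approx\<close> enter;
    \<open>e\<close> is then chosen with \<open>D * e <= \<delta>\<close>, and \<open>D + 1\<close>
    keeps the quotient meaningful for \<open>D = 0\<close>.\<close>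
  define D where "D = (\<Sum>i\<in>I. \<Sum>k\<le>degree (c i). \<bar>coeff (c i) k\<bar> * real (Suc k))"
  have D0: "0 \<le> D" by (auto simp: D_def intro!: sum_nonneg)
  define e where "e = \<delta> / (D + 1)"
  have e: "0 < e" "D * e \<le> \<delta>" using \<delta> D0 by (auto simp: e_def field_simps)
  have finI: "finite (I \<times> {..n})" using I by simp
  define t where "t = (\<lambda>i. (T ^^ snd i) (f (fst i)))"
  have TL: "\<And>i. i \<in> I \<times> {..n} \<Longrightarrow> t i \<in> Lp M p" unfolding t_def using f by (auto intro: Tpow_Lp)
  obtain P where P: "atoms M P" and
    apx: "\<And>i. i \<in> I \<times> {..n} \<Longrightarrow> Lp_le M p (\<lambda>w. t i w - step P (\<lambda>A. avg M A (t i)) w) e"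
    using ex_atoms_approx[of "I \<times> {..n}" t e, OF finI TL e(1)] by blast
  define g where "g = (\<lambda>i k. (mapply P avg_mat ^^ k) (\<lambda>A. avg M A (f i)))"
  have gb: "Lp_le M p (\<lambda>w. (T ^^ k) (f i) w - step P (g i k) w) (real (Suc k) * e)" if "i \<in> I" "k \<le> degree (c i)" for i k
    unfolding g_def
  proof (rule Tpow_step_approx[OF P f[OF that(1)]])
    show "k \<le> n" using that degn[OF that(1)] by simp
    show "0 \<le> e" using e by simp
    show "Lp_le M p (\<lambda>w. (T ^^ l) (f i) w - step P (\<lambda>A. avg M A ((T ^^ l) (f i))) w) e" if "l \<le> n" for l
      using apx[of "(i, l)", unfolded t_def] that \<open>i \<in> I\<close> by simp
  qed
  define S where "S = (\<lambda>A B. cmod (avg_mat A B))"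
  define F where "F = (\<lambda>A. avg M A G)"
  have avg_f: "cmod (avg M A (f i)) \<le> F A" if A: "A \<in> P" and i: "i \<in> I" for A i
  proof -
    obtain B where B: "Lp_le M p (f i) B" using f[OF i] by (rule Lp_E)
    have "Lp_le M p (\<lambda>w. cmod (f i w)) B"
      using Lp_leD(1)[OF B] p_nonneg by (intro Lp_le_dom[OF B]) auto
    then have "avg M A (\<lambda>w. cmod (f i w)) \<le> F A"
      unfolding F_def using fG[OF i] by (intro avg_mono[OF p_gt_1 _ G atomsD(1,3)[OF P A]])
    then show ?thesis using norm_avg_le[of M A "f i"] by simp
  qed
  have F0: "0 \<le> F A" if "A \<in> P" for A using avg_f[OF that] I(2) norm_ge_zero order_trans by blast
  have gS: "cmod (g i k A) \<le> (mapply P S ^^ k) F A" if "i \<in> I" "A \<in> P" for i k A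
    using that(2)
  proof (induction k arbitrary: A)
    case 0
    then show ?case using avg_f that(1) by (simp add: g_def)
  next
    case (Suc k)
    have "cmod (g i (Suc k) A) \<le> (\<Sum>B\<in>P. S A B * cmod (g i k B))"
      unfolding g_def by (auto simp: mapply_def S_def norm_mult[symmetric] intro!: norm_sum)
    also have "\<dots> \<le> (\<Sum>B\<in>P. S A B * (mapply P S ^^ k) F B)"
      using Suc.IH by (intro sum_mono mult_left_mono) (auto simp: S_def)
    finally show ?case by (simp add: mapply_def[of P S "(mapply P S ^^ k) F"])
  qed
  have S0: "0 \<le> (mapply P S ^^ k) F A" if "A \<in> P" for A k
    using gS[OF _ that] I(2) norm_ge_zero order_trans by blast
  define h where "h = (\<lambda>i A. \<Sum>k\<le>degree (c i). complex_of_real (coeff (c i) k) * g i k A)"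
  define V where "V = (\<lambda>A. Max ((\<lambda>i. cmod (h i A)) ` I))"
  have hV: "cmod (h i A) \<le> V A" if "i \<in> I" for i A using that I by (auto simp: V_def)
  \<comment> \<open>A maximising index is fixed on each cell, and \<open>N (j A)\<close> serves as
    the averaging time at the coordinate \<open>A\<close>.\<close>
  define j where "j = (\<lambda>A. SOME i. i \<in> I \<and> V A = cmod (h i A))"
  have j: "j A \<in> I" "V A = cmod (h (j A) A)" for A
  proof -
    have "V A \<in> (\<lambda>i. cmod (h i A)) ` I" unfolding V_def using I by (intro Max_in) auto
    then have "\<exists>i. i \<in> I \<and> V A = cmod (h i A)" by auto
    from someI_ex[OF this] show "j A \<in> I" "V A = cmod (h (j A) A)" unfolding j_def by auto
  qed
  have V_le: "V A \<le> K * ((\<Sum>k<N (j A). (mapply P S ^^ k) F A) / N (j A))" if A: "A \<in> P" for A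
  proof -
    let ?i = "j A"
    have "V A \<le> (\<Sum>k\<le>degree (c ?i). \<bar>coeff (c ?i) k\<bar> * cmod (g ?i k A))"
      unfolding j(2) h_def by (rule order_trans[OF norm_sum]) (simp add: norm_mult)
    also have "\<dots> \<le> (\<Sum>k\<le>degree (c ?i). K / N ?i * (mapply P S ^^ k) F A)"
      using coeff[OF j(1)] gS[OF j(1) A] K by (intro sum_mono mult_mono) auto
    also have "\<dots> \<le> (\<Sum>k<N ?i. K / N ?i * (mapply P S ^^ k) F A)"
      using deg[OF j(1)[of A]] K S0[OF A] by (intro sum_mono2) auto
    finally show ?thesis by (simp add: sum_distrib_left sum_divide_distrib)
  qed
  have V0: "0 \<le> V A" for A unfolding j(2) by simp
  have VB: "Lp_le M p (step P V) (q * K * \<Gamma>)"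
    unfolding Lp_le_step_iff[OF P]
  proof (intro conjI)
    show "0 \<le> q * K * \<Gamma>" using pq K \<Gamma> by auto
    have "(\<Sum>A\<in>P. measure M A * norm (V A) powr p) \<le>
      (\<Sum>A\<in>P. measure M A * (K * ((\<Sum>k<N (j A). (mapply P S ^^ k) F A) / N (j A))) powr p)"
      using V_le V0 p_nonneg by (intro sum_mono mult_left_mono powr_mono2) auto
    also have "\<dots> = K powr p * (\<Sum>A\<in>P. measure M A * ((\<Sum>k<N (j A). (mapply P S ^^ k) F A) / N (j A)) powr p)"
      using K S0 unfolding sum_distrib_left
      by (intro sum.cong refl, subst powr_mult) (auto simp: mult_ac intro!: sum_nonneg divide_nonneg_nonneg)
    also have "(\<Sum>A\<in>P. measure M A * ((\<Sum>k<N (j A). (mapply P S ^^ k) F A) / N (j A)) powr p)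
       \<le> q powr p * (\<Sum>A\<in>P. measure M A * F A powr p)"
    proof (rule matrix_maximal[OF atoms_finite[OF P] pq])
      show "\<And>a. (\<And>i. i \<in> P \<Longrightarrow> 0 \<le> a i) \<Longrightarrow> (\<Sum>i\<in>P. measure M i * mapply P S a i powr p) \<le> (\<Sum>i\<in>P. measure M i * a i powr p)"
        unfolding S_def by (rule avg_mat_modulus_contraction[OF P])
      show "0 < N (j A)" for A using deg[OF j(1)[of A]] by simp
    qed (auto simp: S_def F0 atomsD(4)[OF P])
    also have "(\<Sum>A\<in>P. measure M A * F A powr p) \<le> \<Gamma> powr p"
      using sum_avg_powr_le[OF P p_gt_1 G] F0 unfolding Lp_le_step_iff[OF P] F_def by simp
    finally have "(\<Sum>A\<in>P. measure M A * norm (V A) powr p) \<le> K powr p * (q powr p * \<Gamma> powr p)"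
      by (simp add: mult_left_mono)
    also have "\<dots> = (q * K * \<Gamma>) powr p" using pq K \<Gamma> by (simp add: powr_mult)
    finally show "(\<Sum>A\<in>P. measure M A * norm (V A) powr p) \<le> (q * K * \<Gamma>) powr p" .
  qed
  define err where "err = (\<lambda>i w. \<Sum>k\<le>degree (c i). \<bar>coeff (c i) k\<bar> * cmod ((T ^^ k) (f i) w - step P (g i k) w))"
  have errB: "Lp_le M p (\<lambda>w. \<Sum>i\<in>I. err i w) (\<Sum>i\<in>I. \<Sum>k\<le>degree (c i). \<bar>coeff (c i) k\<bar> * (real (Suc k) * e))"
    unfolding err_def
  proof (intro Lp_le_sum[OF p_gt_1])
    fix i k assume ik: "i \<in> I" "k \<in> {..degree (c i)}"
    then have "Lp_le M p (\<lambda>w. (T ^^ k) (f i) w - step P (g i k) w) (real (Suc k) * e)" by (intro gb) auto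
    note Lp_le_norm_scale[OF this p_nonneg, of "\<lambda>w. \<bar>coeff (c i) k\<bar> * cmod ((T ^^ k) (f i) w - step P (g i k) w)" "\<bar>coeff (c i) k\<bar>"]
    then show "Lp_le M p (\<lambda>w. \<bar>coeff (c i) k\<bar> * cmod ((T ^^ k) (f i) w - step P (g i k) w)) (\<bar>coeff (c i) k\<bar> * (real (Suc k) * e))"
      using Lp_leD(1)[OF \<open>Lp_le M p (\<lambda>w. (T ^^ k) (f i) w - step P (g i k) w) (real (Suc k) * e)\<close>] by simp
  qed
  also have "(\<Sum>i\<in>I. \<Sum>k\<le>degree (c i). \<bar>coeff (c i) k\<bar> * (real (Suc k) * e)) = D * e"
    unfolding D_def sum_distrib_right by (simp only: mult.assoc)
  finally have total: "Lp_le M p (\<lambda>w. step P V w + (\<Sum>i\<in>I. err i w)) (q * K * \<Gamma> + D * e)"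
    by (rule Lp_le_add[OF p_gt_1 VB])
  have "Lp_le M p (\<lambda>w. Max ((\<lambda>i. cmod (peval (c i) (f i) w)) ` I)) (q * K * \<Gamma> + \<delta>)"
  proof (rule Lp_le_mono[OF total p_nonneg])
    show "(\<lambda>w. Max ((\<lambda>i. cmod (peval (c i) (f i) w)) ` I)) \<in> borel_measurable M"
      by (rule borel_measurable_Max[OF I(1) cmod_peval_measurable[OF f]])
    show "q * K * \<Gamma> + D * e \<le> q * K * \<Gamma> + \<delta>" using e by simp
    show "AE w in M. norm (Max ((\<lambda>i. cmod (peval (c i) (f i) w)) ` I)) \<le> norm (step P V w + (\<Sum>i\<in>I. err i w))"
    proof (rule AE_I2)
      fix w
      have err0: "0 \<le> err i w" for i by (auto simp: err_def intro!: sum_nonneg)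
      have main: "cmod (peval (c i) (f i) w) \<le> step P V w + (\<Sum>i\<in>I. err i w)" if i: "i \<in> I" for i
      proof -
        have st: "step P (h i) w = (\<Sum>k\<le>degree (c i). complex_of_real (coeff (c i) k) * step P (g i k) w)"
          by (cases w rule: step_cases[OF P, case_names inside outside]) (simp_all add: step_in[OF P] step_out[OF P] h_def)
        have "peval (c i) (f i) w - step P (h i) w =
            (\<Sum>k\<le>degree (c i). complex_of_real (coeff (c i) k) * ((T ^^ k) (f i) w - step P (g i k) w))"
          unfolding st peval_def by (simp add: right_diff_distrib sum_subtractf)
        also have "cmod \<dots> \<le> err i w"
          unfolding err_def by (rule order_trans[OF norm_sum]) (simp add: norm_mult)
        also have "err i w \<le> (\<Sum>i\<in>I. err i w)" using i I err0 by (intro member_le_sum) auto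
        finally have "cmod (peval (c i) (f i) w - step P (h i) w) \<le> (\<Sum>i\<in>I. err i w)" .
        moreover have "cmod (step P (h i) w) \<le> step P V w"
          using hV[OF i] by (cases w rule: step_cases[OF P, case_names inside outside]) (simp_all add: step_in[OF P] step_out[OF P])
        ultimately show ?thesis using norm_triangle_sub[of "peval (c i) (f i) w" "step P (h i) w"] by linarith
      qed
      have "Max ((\<lambda>i. cmod (peval (c i) (f i) w)) ` I) \<le> step P V w + (\<Sum>i\<in>I. err i w)"
        using main I by (subst Max_le_iff) auto
      moreover have "0 \<le> Max ((\<lambda>i. cmod (peval (c i) (f i) w)) ` I)" using I by (subst Max_ge_iff) auto
      ultimately show "norm (Max ((\<lambda>i. cmod (peval (c i) (f i) w)) ` I)) \<le> norm (step P V w + (\<Sum>i\<in>I. err i w))"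
        by simp
    qed
  qed
  then show "Lp_le M p (\<lambda>w. Max ((\<lambda>i. cmod (peval (c i) (f i) w)) ` I)) (p / (p - 1) * K * \<Gamma> + \<delta>)"
    by (simp add: q_def)
qed

end

section \<open>Dyadic means\<close>

definition pX :: "real poly" where
  "pX = monom 1 1"

lemma pX_power: "pX ^ n = monom 1 n"
  by (induction n) (simp_all add: pX_def mult_monom)

lemma l1norm_X_power [simp]: "l1norm (pX ^ n) = 1"
  unfolding pX_power by simp

lemma l1norm_X [simp]: "l1norm pX = 1"
  by (simp add: pX_def)

lemma degree_X_power [simp]: "degree (pX ^ n) = n"
  unfolding pX_power by (simp add: degree_monom_eq)

definition dmean :: "nat \<Rightarrow> real poly" where
  "dmean j = smult (1 / 2 ^ j) (\<Sum>i<2 ^ j. pX ^ i)"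


lemma dmean_0: "dmean 0 = 1"
  by (simp add: dmean_def)

lemma sum_lessThan_add:
  fixes f :: "nat \<Rightarrow> 'b::comm_monoid_add"
  shows "(\<Sum>i<m + n. f i) = (\<Sum>i<m. f i) + (\<Sum>i<n. f (m + i))"
  by (induction n) (simp_all add: add_ac)

text \<open>The times below \<open>2 ^ Suc j\<close> split into two halves. The product form makes
  each mean divisible by the preceding one, which the cutoff quotients exploit.\<close>

lemma dmean_Suc: "dmean (Suc j) = dmean j * smult (1 / 2) (1 + pX ^ 2 ^ j)"
proof -
  have "(\<Sum>i<2 ^ j. pX ^ (2 ^ j + i)) = (\<Sum>i<2 ^ j. pX ^ i) * pX ^ 2 ^ j"
    unfolding sum_distrib_right by (simp add: power_add mult.commute)
  then have "(\<Sum>i<2 ^ Suc j. pX ^ i) = (\<Sum>i<2 ^ j. pX ^ i) * (1 + pX ^ 2 ^ j)"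
    unfolding power_Suc mult_2 sum_lessThan_add by (simp add: distrib_left)
  then show ?thesis by (simp add: dmean_def mult_ac)
qed

text \<open>The geometric sum telescopes: multiplied by a mean of length \<open>2 ^ j\<close>, a
  factor \<open>1 - pX\<close> gains \<open>2 ^ (- j)\<close>.\<close>

lemma one_minus_X_mult_dmean:
  "(1 - pX) * dmean j = smult (1 / 2 ^ j) (1 - pX ^ 2 ^ j)"
  unfolding dmean_def one_diff_power_eq by simp

lemma l1norm_dmean: "l1norm (dmean j) \<le> 1"
proof -
  have "l1norm (\<Sum>i<2 ^ j. pX ^ i) \<le> 2 ^ j"
    by (rule order_trans[OF l1norm_sum]) simp
  then show ?thesis by (simp add: dmean_def)
qed

lemma abs_coeff_dmean: "\<bar>coeff (dmean j) k\<bar> \<le> 1 / 2 ^ j"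
proof -
  have "coeff (\<Sum>i<2 ^ j. pX ^ i) k = (\<Sum>i<2 ^ j. if i = k then 1 else 0)"
    unfolding pX_power by (simp add: coeff_sum)
  then show ?thesis by (simp add: dmean_def)
qed

lemma degree_dmean: "degree (dmean j) < 2 ^ j"
proof -
  have "degree (\<Sum>i<2 ^ j. pX ^ i) < 2 ^ j"
    by (intro degree_sum_less) (auto simp: degree_X_power)
  then show ?thesis using degree_smult_le[of "1 / 2 ^ j :: real"] unfolding dmean_def by (rule le_less_trans[rotated])
qed

lemma degree_mult_le_add: "degree c \<le> a \<Longrightarrow> degree d \<le> b \<Longrightarrow> degree (c * d) \<le> a + b"
  by (rule order_trans[OF degree_mult_le]) simp

lemma degree_power_le_mult: "degree c \<le> a \<Longrightarrow> degree (c ^ n) \<le> a * n"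
  by (rule order_trans[OF degree_power_le]) simp

text \<open>A factor \<open>1 - X\<close> costs a coefficient norm of order \<open>2 ^ j\<close>; analyticity turns each such
  factor into a gain of \<open>2 ^ (- J)\<close> at times of order \<open>2 ^ J\<close>.\<close>

lemma one_minus_dmean_power:
  obtains g where "1 - dmean j ^ r = (1 - pX) * g" "l1norm g \<le> real r * 2 ^ j"
proof -
  define h where "h = smult (1 / 2 ^ j) (\<Sum>i<2 ^ j. \<Sum>l<i. pX ^ l)"
  have "1 - dmean j = smult (1 / 2 ^ j) (\<Sum>i<2 ^ j. 1 - pX ^ i)"
    by (simp add: dmean_def sum_subtractf smult_diff_right of_nat_poly flip: one_pCons)
  also have "\<dots> = (1 - pX) * h"
    unfolding h_def one_diff_power_eq by (simp add: sum_distrib_left)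
  finally have h: "1 - dmean j = (1 - pX) * h" .
  have "l1norm (\<Sum>i<2 ^ j. \<Sum>l<i. pX ^ l) \<le> (\<Sum>i<(2::nat) ^ j. 2 ^ j)"
  proof (rule order_trans[OF l1norm_sum sum_mono])
    fix i :: nat assume i: "i \<in> {..<2 ^ j}"
    have "l1norm (\<Sum>l<i. pX ^ l) \<le> real i"
      by (rule order_trans[OF l1norm_sum]) simp
    also have "\<dots> \<le> 2 ^ j" using i by (simp add: less_imp_le flip: of_nat_le_iff)
    finally show "l1norm (\<Sum>l<i. pX ^ l) \<le> 2 ^ j" .
  qed
  then have hn: "l1norm h \<le> 2 ^ j" by (simp add: h_def field_simps)
  have gn: "l1norm (\<Sum>i<r. dmean j ^ i) \<le> real r"
  proof -
    have "l1norm (dmean j ^ i) \<le> 1" for i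
      using l1norm_power_le[OF l1norm_dmean] by simp
    then show ?thesis using order_trans[OF l1norm_sum sum_bounded_above[of "{..<r}" _ 1]] by simp
  qed
  show ?thesis
  proof (rule that)
    show "1 - dmean j ^ r = (1 - pX) * (h * (\<Sum>i<r. dmean j ^ i))"
      unfolding one_diff_power_eq[of "dmean j"] h by (simp only: mult.assoc)
    show "l1norm (h * (\<Sum>i<r. dmean j ^ i)) \<le> real r * 2 ^ j"
      using l1norm_mult_le[OF hn gn] by (simp add: mult.commute)
  qed
qed

section \<open>Polynomial cutoffs and their divided differences\<close>

definition cutoff :: "nat \<Rightarrow> nat \<Rightarrow> real poly \<Rightarrow> real poly" where
  "cutoff r L a = 1 - (1 - a ^ r) ^ L"

text \<open>The divided difference of \<open>cutoff r L\<close>, kept as a product of two geometric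
  sums because they play different roles: the first supplies powers of means, the second powers of
  \<open>1 - pX\<close>.\<close>

definition cutoff_quotient :: "nat \<Rightarrow> nat \<Rightarrow> real poly \<Rightarrow> real poly \<Rightarrow> real poly" where
  "cutoff_quotient r L a b =
     (\<Sum>k<r. b ^ (r - Suc k) * a ^ k) * (\<Sum>i<L. (1 - a ^ r) ^ (L - Suc i) * (1 - b ^ r) ^ i)"

lemma cutoff_diff: "cutoff r L a - cutoff r L b = cutoff_quotient r L a b * (a - b)"
proof -
  have "cutoff r L a - cutoff r L b = (1 - b ^ r) ^ L - (1 - a ^ r) ^ L" by (simp add: cutoff_def)
  also have "\<dots> = (a ^ r - b ^ r) * (\<Sum>i<L. (1 - a ^ r) ^ (L - Suc i) * (1 - b ^ r) ^ i)"
    by (subst power_diff_sumr2) simp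
  also have "a ^ r - b ^ r = (a - b) * (\<Sum>k<r. b ^ (r - Suc k) * a ^ k)" by (rule power_diff_sumr2)
  finally show ?thesis by (simp add: cutoff_quotient_def mult_ac)
qed

lemma cutoff_one: "0 < L \<Longrightarrow> cutoff r L 1 = 1"
  by (simp add: cutoff_def)

lemma cutoff_factor: "cutoff r L a = a ^ r * (\<Sum>i<L. (1 - a ^ r) ^ i)"
  unfolding cutoff_def by (subst one_diff_power_eq) simp

lemma l1norm_one_minus_power:
  assumes "l1norm a \<le> 1" shows "l1norm (1 - a ^ r) \<le> 2"
  using l1norm_diff[of 1 "a ^ r"] l1norm_power_le[OF assms, of r] by simp

lemma l1norm_sum_le_card:
  assumes "\<And>i. i < (n::nat) \<Longrightarrow> l1norm (c i) \<le> B"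
  shows "l1norm (\<Sum>i<n. c i) \<le> real n * B"
  using order_trans[OF l1norm_sum sum_bounded_above[of "{..<n}" _ B]] assms by simp

text \<open>The extracted power of the mean is meant to absorb the factors \<open>1 - pX\<close> of
  the orbit. The cofactor has a coefficient norm independent of the scale and a degree proportional
  to \<open>2 ^ j\<close>.\<close>

lemma cutoff_dyadic_factor:
  obtains G where "cutoff (Suc s) L (dmean j) = dmean j ^ Suc s * G"
    "l1norm G \<le> real L * 2 ^ L" "degree G \<le> (Suc s * L) * 2 ^ j"
proof (rule that)
  let ?a = "dmean j" and ?r = "Suc s"
  show "cutoff ?r L ?a = ?a ^ ?r * (\<Sum>i<L. (1 - ?a ^ ?r) ^ i)" by (rule cutoff_factor)
  show "l1norm (\<Sum>i<L. (1 - ?a ^ ?r) ^ i) \<le> real L * 2 ^ L"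
  proof (rule l1norm_sum_le_card)
    fix i assume "i < L"
    have "l1norm ((1 - ?a ^ ?r) ^ i) \<le> 2 ^ i"
      by (intro l1norm_power_le l1norm_one_minus_power l1norm_dmean)
    also have "\<dots> \<le> 2 ^ L" using \<open>i < L\<close> by (intro power_increasing) auto
    finally show "l1norm ((1 - ?a ^ ?r) ^ i) \<le> 2 ^ L" .
  qed
  have a: "degree (1 - ?a ^ ?r) \<le> 2 ^ j * ?r"
    using degree_dmean[of j] by (intro degree_diff_le degree_power_le_mult) auto
  show "degree (\<Sum>i<L. (1 - ?a ^ ?r) ^ i) \<le> (?r * L) * 2 ^ j"
  proof (rule degree_sum_le)
    fix i assume "i \<in> {..<L}"
    have "degree ((1 - ?a ^ ?r) ^ i) \<le> 2 ^ j * ?r * i" using a by (rule degree_power_le_mult)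
    also have "\<dots> \<le> 2 ^ j * ?r * L" using \<open>i \<in> {..<L}\<close> by (intro mult_left_mono) auto
    finally show "degree ((1 - ?a ^ ?r) ^ i) \<le> (?r * L) * 2 ^ j" by (simp only: mult_ac)
  qed simp
qed

text \<open>As \<open>dmean (Suc j)\<close> is \<open>dmean j\<close> times \<open>e\<close>, each
  term of the first geometric sum contains the full power \<open>dmean j ^ s\<close>, while the
  remaining factors have coefficient norms bounded independently of \<open>j\<close>.\<close>

lemma cutoff_quotient_factor:
  obtains G where "cutoff_quotient (Suc s) L (dmean j) (dmean (Suc j)) = dmean j ^ s * G"
    "l1norm G \<le> real (Suc s) * (real L * 2 ^ L)" "degree G \<le> (s + 2 * Suc s * L) * 2 ^ j"
proof -
  let ?a = "dmean j" and ?b = "dmean (Suc j)" and ?r = "Suc s"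
  define e where "e = smult (1 / 2) (1 + pX ^ 2 ^ j)"
  define E where "E = (\<Sum>k<?r. e ^ (?r - Suc k))"
  define F where "F = (\<Sum>i<L. (1 - ?a ^ ?r) ^ (L - Suc i) * (1 - ?b ^ ?r) ^ i)"
  have b: "?b = ?a * e" by (simp only: dmean_Suc e_def)
  have en: "l1norm e \<le> 1" using l1norm_add[of 1 "pX ^ 2 ^ j"] by (simp add: e_def)
  have ed: "degree e \<le> 2 ^ j"
    unfolding e_def by (intro order_trans[OF degree_smult_le] degree_add_le) (auto simp: degree_X_power)
  have "(\<Sum>k<?r. ?b ^ (?r - Suc k) * ?a ^ k) = ?a ^ s * E"
    unfolding E_def sum_distrib_left
  proof (rule sum.cong)
    fix k assume "k \<in> {..<?r}"
    then have "?a ^ s = ?a ^ (?r - Suc k) * ?a ^ k" by (simp flip: power_add)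
    then show "?b ^ (?r - Suc k) * ?a ^ k = ?a ^ s * e ^ (?r - Suc k)"
      unfolding b power_mult_distrib by (simp add: mult_ac)
  qed simp
  then have "cutoff_quotient ?r L ?a ?b = ?a ^ s * (E * F)"
    by (simp add: cutoff_quotient_def F_def mult.assoc)
  moreover have "l1norm (E * F) \<le> real ?r * (real L * 2 ^ L)"
  proof (rule l1norm_mult_le)
    have "l1norm E \<le> real ?r * 1"
      unfolding E_def by (rule l1norm_sum_le_card) (use l1norm_power_le[OF en] in simp)
    then show "l1norm E \<le> real ?r" by simp
    show "l1norm F \<le> real L * 2 ^ L"
      unfolding F_def
    proof (rule l1norm_sum_le_card)
      fix i assume "i < L"
      have "l1norm ((1 - ?a ^ ?r) ^ (L - Suc i) * (1 - ?b ^ ?r) ^ i) \<le> 2 ^ (L - Suc i) * 2 ^ i"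
        by (intro l1norm_mult_le l1norm_power_le l1norm_one_minus_power l1norm_dmean)
      also have "\<dots> \<le> 2 ^ L" using \<open>i < L\<close> by (subst power_add[symmetric], intro power_increasing) auto
      finally show "l1norm ((1 - ?a ^ ?r) ^ (L - Suc i) * (1 - ?b ^ ?r) ^ i) \<le> 2 ^ L" .
    qed
  qed
  moreover have "degree (E * F) \<le> (s + 2 * ?r * L) * 2 ^ j"
  proof -
    have "degree E \<le> 2 ^ j * s"
      unfolding E_def
    proof (rule degree_sum_le)
      fix k assume "k \<in> {..<?r}"
      have "degree (e ^ (?r - Suc k)) \<le> 2 ^ j * (?r - Suc k)" using ed by (rule degree_power_le_mult)
      also have "\<dots> \<le> 2 ^ j * s" by (intro mult_left_mono) auto
      finally show "degree (e ^ (?r - Suc k)) \<le> 2 ^ j * s" .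
    qed simp
    moreover have "degree F \<le> 2 ^ Suc j * ?r * L"
      unfolding F_def
    proof (rule degree_sum_le)
      fix i assume i: "i \<in> {..<L}"
      have a: "degree (1 - ?a ^ ?r) \<le> 2 ^ Suc j * ?r" "degree (1 - ?b ^ ?r) \<le> 2 ^ Suc j * ?r"
        using degree_dmean[of j] degree_dmean[of "Suc j"] by (intro degree_diff_le degree_power_le_mult; simp)+
      have "degree ((1 - ?a ^ ?r) ^ (L - Suc i) * (1 - ?b ^ ?r) ^ i) \<le> 2 ^ Suc j * ?r * (L - Suc i) + 2 ^ Suc j * ?r * i"
        by (intro degree_mult_le_add degree_power_le_mult a)
      also have "\<dots> = 2 ^ Suc j * ?r * (L - Suc i + i)" by (simp only: distrib_left)
      also have "\<dots> \<le> 2 ^ Suc j * ?r * L" using i by (intro mult_left_mono) auto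
      finally show "degree ((1 - ?a ^ ?r) ^ (L - Suc i) * (1 - ?b ^ ?r) ^ i) \<le> 2 ^ Suc j * ?r * L" .
    qed simp
    ultimately have "degree (E * F) \<le> 2 ^ j * s + 2 ^ Suc j * ?r * L" by (rule degree_mult_le_add)
    then show ?thesis by (simp add: algebra_simps)
  qed
  ultimately show ?thesis by (rule that)
qed

text \<open>Each term of the second geometric sum has \<open>L - 1\<close> factors, and each of them
  contains \<open>1 - pX\<close> with a cofactor of norm of order \<open>2 ^ j\<close>. This is the
  form to which analyticity applies.\<close>

lemma cutoff_quotient_small:
  obtains H where "cutoff_quotient (Suc s) L (dmean j) (dmean (Suc j)) = (1 - pX) ^ (L - 1) * H"
    "l1norm H \<le> real (Suc s) * (real L * (2 * real (Suc s)) ^ (L - 1)) * (2 ^ j) ^ (L - 1)"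
proof -
  let ?a = "dmean j" and ?b = "dmean (Suc j)" and ?r = "Suc s"
  obtain g where g: "1 - ?a ^ ?r = (1 - pX) * g" "l1norm g \<le> real ?r * 2 ^ j"
    by (rule one_minus_dmean_power)
  obtain h where h: "1 - ?b ^ ?r = (1 - pX) * h" "l1norm h \<le> real ?r * 2 ^ Suc j"
    by (rule one_minus_dmean_power)
  \<comment> \<open>Common bound for both cofactors; the factor 2 is due to the longer mean
    \<open>dmean (Suc j)\<close>.\<close>
  define B where "B = 2 * real ?r * 2 ^ j"
  have gh: "l1norm g \<le> B" "l1norm h \<le> B"
    unfolding B_def by (rule order_trans[OF g(2)], simp del: of_nat_Suc)
      (use h(2) in \<open>simp add: mult_ac del: of_nat_Suc\<close>)
  define E where "E = (\<Sum>k<?r. ?b ^ (?r - Suc k) * ?a ^ k)"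
  define F where "F = (\<Sum>i<L. g ^ (L - Suc i) * h ^ i)"
  have "(\<Sum>i<L. (1 - ?a ^ ?r) ^ (L - Suc i) * (1 - ?b ^ ?r) ^ i) = (1 - pX) ^ (L - 1) * F"
    unfolding F_def sum_distrib_left
  proof (rule sum.cong)
    fix i assume "i \<in> {..<L}"
    then have "(1 - pX) ^ (L - 1) = (1 - pX) ^ (L - Suc i) * (1 - pX) ^ i" by (simp flip: power_add)
    then show "(1 - ?a ^ ?r) ^ (L - Suc i) * (1 - ?b ^ ?r) ^ i = (1 - pX) ^ (L - 1) * (g ^ (L - Suc i) * h ^ i)"
      unfolding g(1) h(1) power_mult_distrib by (simp add: mult_ac)
  qed simp
  then have "cutoff_quotient ?r L ?a ?b = (1 - pX) ^ (L - 1) * (E * F)"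
    by (simp add: cutoff_quotient_def E_def mult_ac)
  moreover have "l1norm (E * F) \<le> real ?r * (real L * B ^ (L - 1))"
  proof (rule l1norm_mult_le)
    have "l1norm E \<le> real ?r * 1"
      unfolding E_def
    proof (rule l1norm_sum_le_card)
      fix k
      have "l1norm (?b ^ (?r - Suc k) * ?a ^ k) \<le> 1 ^ (?r - Suc k) * 1 ^ k"
        by (intro l1norm_mult_le l1norm_power_le l1norm_dmean)
      then show "l1norm (?b ^ (?r - Suc k) * ?a ^ k) \<le> 1" by simp
    qed
    then show "l1norm E \<le> real ?r" by simp
    show "l1norm F \<le> real L * B ^ (L - 1)"
      unfolding F_def
    proof (rule l1norm_sum_le_card)
      fix i assume "i < L"
      have "l1norm (g ^ (L - Suc i) * h ^ i) \<le> B ^ (L - Suc i) * B ^ i"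
        by (intro l1norm_mult_le l1norm_power_le gh)
      also have "\<dots> = B ^ (L - 1)" using \<open>i < L\<close> by (simp flip: power_add)
      finally show "l1norm (g ^ (L - Suc i) * h ^ i) \<le> B ^ (L - 1)" .
    qed
  qed
  then have "l1norm (E * F) \<le> real ?r * (real L * (2 * real ?r) ^ (L - 1)) * (2 ^ j) ^ (L - 1)"
    by (simp add: B_def power_mult_distrib mult_ac del: of_nat_Suc)
  ultimately show ?thesis by (rule that)
qed

text \<open>On the block \<open>2 ^ J <= n < 2 ^ Suc J\<close> the weight is comparable to
  \<open>(n + 1) ^ m\<close>. Being constant there, it commutes with differences in
  \<open>n\<close>.\<close>

definition weighted_orbit :: "nat \<Rightarrow> nat \<Rightarrow> nat \<Rightarrow> real poly" where
  "weighted_orbit m J n = smult (2 ^ (J * m)) (pX ^ n * (1 - pX) ^ m)"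

text \<open>The \<open>m\<close> factors \<open>1 - pX\<close> are paired with \<open>m\<close> of
  the \<open>m + 1\<close> means, each pair giving \<open>2 ^ (- j)\<close> times
  \<open>1 - pX ^ 2 ^ j\<close>; against the weight this leaves \<open>2 ^ ((J - j) * m)\<close>.
  The last mean keeps the coefficients of order \<open>2 ^ (- j)\<close>, which is
  \<open>2 ^ (J - j)\<close> times the size for a mean of length \<open>2 ^ J\<close>.\<close>

lemma weighted_orbit_flat:
  fixes m d :: nat and g :: real
  assumes n: "n < 2 ^ Suc J" and j: "j \<le> J" and G: "l1norm G \<le> g" "degree G \<le> d * 2 ^ j"
  defines "c \<equiv> weighted_orbit m J n * (dmean j ^ Suc m * G)"
    and "N \<equiv> (m + d + 3) * 2 ^ J"
  shows "degree c < N" and "\<bar>coeff c k\<bar> \<le> 2 ^ ((J - j) * Suc m) * (2 ^ m * g * (m + d + 3)) / N"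
proof -
  define R where "R = pX ^ n * (1 - pX ^ 2 ^ j) ^ m * G"
  have "(1 - pX) ^ m * dmean j ^ Suc m = ((1 - pX) * dmean j) ^ m * dmean j"
    by (simp add: power_mult_distrib mult_ac)
  also have "\<dots> = smult (1 / 2 ^ (j * m)) ((1 - pX ^ 2 ^ j) ^ m * dmean j)"
    unfolding one_minus_X_mult_dmean by (simp add: smult_power power_mult power_one_over)
  finally have *: "(1 - pX) ^ m * dmean j ^ Suc m = smult (1 / 2 ^ (j * m)) ((1 - pX ^ 2 ^ j) ^ m * dmean j)" .
  have "c = smult (2 ^ (J * m)) (pX ^ n * ((1 - pX) ^ m * dmean j ^ Suc m) * G)"
    by (simp add: c_def weighted_orbit_def mult_ac)
  also have "\<dots> = smult (2 ^ (J * m) / 2 ^ (j * m)) (dmean j * R)"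
    unfolding * R_def by (simp add: mult_ac)
  also have "2 ^ (J * m) / 2 ^ (j * m) = (2 :: real) ^ ((J - j) * m)"
    using j by (simp add: diff_mult_distrib power_diff)
  finally have c: "c = smult (2 ^ ((J - j) * m)) (dmean j * R)" .
  have Rn: "l1norm R \<le> 1 * 2 ^ m * g"
    unfolding R_def using l1norm_diff[of 1 "pX ^ 2 ^ j"]
    by (intro l1norm_mult_le l1norm_power_le G) auto
  have le2: "(2::nat) ^ j \<le> 2 ^ J" using j by (intro power_increasing) auto
  have "degree R \<le> n + 2 ^ j * m + d * 2 ^ j"
    unfolding R_def by (intro degree_mult_le_add degree_power_le_mult degree_diff_le G(2)) auto
  then have "degree (dmean j * R) \<le> (2 ^ j - 1) + (n + 2 ^ j * m + d * 2 ^ j)"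
    using degree_dmean[of j] by (intro degree_mult_le_add) auto
  also have "\<dots> < 2 ^ j + (2 ^ Suc J + 2 ^ j * m + d * 2 ^ j)" using n by (simp add: less_imp_diff_less)
  also have "\<dots> \<le> 2 ^ J + (2 ^ Suc J + 2 ^ J * m + d * 2 ^ J)"
    using le2 by (intro add_mono mult_right_mono mult_left_mono) auto
  also have "\<dots> = N" by (simp add: N_def algebra_simps)
  finally show "degree c < N" unfolding c by (rule le_less_trans[OF degree_smult_le])
  have g0: "0 \<le> g" using G(1) l1norm_nonneg[of G] by linarith
  have "\<bar>coeff c k\<bar> = 2 ^ ((J - j) * m) * \<bar>coeff (dmean j * R) k\<bar>" unfolding c by (simp add: abs_mult)
  also have "\<dots> \<le> 2 ^ ((J - j) * m) * (1 / 2 ^ j * (1 * 2 ^ m * g))"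
    using Rn by (intro mult_left_mono order_trans[OF abs_coeff_mult_le[OF abs_coeff_dmean]]) auto
  also have "\<dots> = 2 ^ ((J - j) * m) * (2 ^ (J - j) / 2 ^ J) * (2 ^ m * g)"
    using j by (simp add: power_diff)
  also have "\<dots> = 2 ^ ((J - j) * Suc m) * (2 ^ m * g * (m + d + 3)) / N"
  proof -
    define e where "e = real (m + d + 3)"
    have "real N = e * 2 ^ J" "e > 0" by (simp_all add: N_def e_def)
    then show ?thesis unfolding e_def[symmetric] by (simp add: power_add)
  qed
  finally show "\<bar>coeff c k\<bar> \<le> 2 ^ ((J - j) * Suc m) * (2 ^ m * g * (m + d + 3)) / N" .
qed

section \<open>Operator norm decay from analyticity\<close>

locale analytic_contraction = regular_contraction +
  fixes \<kappa> :: real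
  assumes \<kappa>_nonneg: "0 \<le> \<kappa>" and analytic: "op_le (pX ^ n * (1 - pX)) (\<kappa> / (n + 1))"
begin

text \<open>The power \<open>pX ^ n\<close> is shared among the \<open>s\<close> factors
  \<open>1 - pX\<close>, so that analyticity at time \<open>u = n div s\<close> applies to each;
  \<open>n + 1 <= s * (u + 1)\<close> converts the bound. The leftover power is a
  contraction.\<close>

lemma orbit_difference_bound: "op_le (pX ^ n * (1 - pX) ^ s) ((\<kappa> * s / (n + 1)) ^ s)"
proof (cases "s = 0")
  case True
  then show ?thesis using op_le_l1norm[of "pX ^ n" 1] by simp
next
  case False
  define u where "u = n div s"
  have n: "n = s * u + n mod s" by (simp add: u_def)
  have "pX ^ n * (1 - pX) ^ s = pX ^ (n mod s) * (pX ^ u * (1 - pX)) ^ s"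
    by (subst n) (simp add: power_add power_mult power_mult_distrib mult_ac flip: power_mult)
  moreover have "op_le (pX ^ (n mod s) * (pX ^ u * (1 - pX)) ^ s) (1 * (\<kappa> / (u + 1)) ^ s)"
    by (intro op_le_mult op_le_power analytic op_le_l1norm) simp
  moreover have "1 * (\<kappa> / (u + 1)) ^ s \<le> (\<kappa> * s / (n + 1)) ^ s"
  proof -
    have "n + 1 \<le> s * (u + 1)" using mod_less_divisor[of s n] False by (subst n) (simp add: less_eq_Suc_le)
    then have "real n + 1 \<le> real s * (real u + 1)" by (simp flip: of_nat_Suc of_nat_mult of_nat_add add: algebra_simps)
    then have "\<kappa> * (real n + 1) \<le> \<kappa> * (real s * (real u + 1))" using \<kappa>_nonneg by (rule mult_left_mono)
    then have "\<kappa> / (u + 1) \<le> \<kappa> * s / (n + 1)" by (simp add: field_simps)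
    then show ?thesis using \<kappa>_nonneg by (simp add: power_mono)
  qed
  ultimately show ?thesis using op_le_mono by metis
qed

text \<open>The first summand bounds the first value of a block, the second its total
  variation.\<close>

definition block_const :: "nat \<Rightarrow> real" where
  "block_const s = (\<kappa> * s) ^ s + (\<kappa> * Suc s) ^ Suc s"

lemma block_const_nonneg: "0 \<le> block_const s"
  using \<kappa>_nonneg by (simp add: block_const_def)

text \<open>On a dyadic block the supremum is controlled by the first value and the total variation; the
  latter has \<open>2 ^ J\<close> terms, each with one additional factor \<open>1 - X\<close>.\<close>

lemma block_bound:
  assumes f: "Lp_le M p f B" and H: "l1norm H \<le> h"
  shows "Lp_le M p (\<lambda>w. Max ((\<lambda>n. cmod (peval (weighted_orbit m J n * ((1 - pX) ^ L * H)) f w)) ` {2 ^ J..<2 ^ Suc J}))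
    (block_const (m + L) * h / 2 ^ (J * L) * B)"
proof -
  define s where "s = m + L"
  define c where "c = (\<lambda>n. weighted_orbit m J n * ((1 - pX) ^ L * H))"
  have fL: "f \<in> Lp M p" using f by (rule Lp_I)
  have B: "0 \<le> B" using f by (rule Lp_leD)
  have h: "0 \<le> h" using H l1norm_nonneg[of H] by linarith
  have c_eq: "c n = smult (2 ^ (J * m)) ((pX ^ n * (1 - pX) ^ s) * H)" for n
    by (simp add: c_def weighted_orbit_def s_def power_add mult_ac)
  have d_eq: "c (Suc n) - c n = smult (- (2 ^ (J * m))) ((pX ^ n * (1 - pX) ^ Suc s) * H)" for n
    unfolding c_eq by (simp add: algebra_simps smult_diff_right flip: smult_add_right)
  have quot: "(\<kappa> * t / (real n + 1)) ^ t \<le> (\<kappa> * t) ^ t / 2 ^ (J * t)" if "2 ^ J \<le> n" for n t :: nat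
  proof -
    have "real (2 ^ J) \<le> real n" using that by (simp only: of_nat_le_iff)
    then have "2 ^ J \<le> real n + 1" unfolding of_nat_power of_nat_numeral by linarith
    then have "\<kappa> * t / (real n + 1) \<le> \<kappa> * t / 2 ^ J" using \<kappa>_nonneg by (intro divide_left_mono) auto
    then have "(\<kappa> * t / (real n + 1)) ^ t \<le> (\<kappa> * t / 2 ^ J) ^ t" using \<kappa>_nonneg by (intro power_mono) auto
    then show ?thesis by (simp add: power_divide power_mult)
  qed
  have ob: "op_le (smult a (pX ^ n * (1 - pX) ^ t * H)) (\<bar>a\<bar> * ((\<kappa> * t) ^ t / 2 ^ (J * t) * h))" if "2 ^ J \<le> n" for a n t
    using quot[OF that, of t] by (intro op_le_smult op_le_mult op_le_mono[OF orbit_difference_bound] op_le_l1norm H) (simp add: add.commute)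
  define V where "V = (\<lambda>w. cmod (peval (c (2 ^ J)) f w) + (\<Sum>i\<in>{2 ^ J..<2 ^ Suc J}. cmod (peval (c (Suc i) - c i) f w)))"
  have cmod_bound: "Lp_le M p (\<lambda>w. cmod (peval d f w)) (b * B)" if "op_le d b" for d b
  proof -
    have "Lp_le M p (peval d f) (b * B)" using that f by (simp add: op_le_def)
    then show ?thesis by (rule Lp_le_dom[OF _ p_nonneg cmod_peval_measurable[OF fL]]) simp
  qed
  define b1 b2 where "b1 = 2 ^ (J * m) * ((\<kappa> * s) ^ s / 2 ^ (J * s) * h)"
    and "b2 = 2 ^ (J * m) * ((\<kappa> * Suc s) ^ Suc s / 2 ^ (J * Suc s) * h)"
  have V: "Lp_le M p V (b1 * B + (\<Sum>i\<in>{(2::nat) ^ J..<2 ^ Suc J}. b2 * B))"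
    unfolding V_def
  proof (rule Lp_le_add[OF p_gt_1])
    show "Lp_le M p (\<lambda>w. cmod (peval (c (2 ^ J)) f w)) (b1 * B)"
      using ob[of "2 ^ J" "2 ^ (J * m)" s] unfolding c_eq b1_def by (intro cmod_bound) simp
    have "Lp_le M p (\<lambda>w. cmod (peval (c (Suc i) - c i) f w)) (b2 * B)" if "i \<in> {2 ^ J..<2 ^ Suc J}" for i
      using ob[of i "- (2 ^ (J * m))" "Suc s"] that unfolding d_eq b2_def by (intro cmod_bound) simp
    then show "Lp_le M p (\<lambda>w. \<Sum>i\<in>{2 ^ J..<2 ^ Suc J}. cmod (peval (c (Suc i) - c i) f w)) (\<Sum>i\<in>{(2::nat) ^ J..<2 ^ Suc J}. b2 * B)"
      by (rule Lp_le_sum[OF p_gt_1])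
  qed
  \<comment> \<open>The number of terms cancels the additional \<open>2 ^ J\<close> in the
    denominator of \<open>b2\<close>.\<close>
  have card: "card {(2::nat) ^ J..<2 ^ Suc J} = 2 ^ J" by simp
  have "b1 * B + (\<Sum>i\<in>{(2::nat) ^ J..<2 ^ Suc J}. b2 * B) = block_const s * h / 2 ^ (J * L) * B"
    unfolding sum_constant card b1_def b2_def block_const_def s_def
    by (simp add: power_add add_mult_distrib2 field_simps del: power_Suc)
  note V' = V[unfolded this]
  have "Lp_le M p (\<lambda>w. Max ((\<lambda>n. cmod (peval (c n) f w)) ` {2 ^ J..<2 ^ Suc J})) (block_const s * h / 2 ^ (J * L) * B)"
  proof (rule Lp_le_dom[OF V' p_nonneg])
    show "(\<lambda>w. Max ((\<lambda>n. cmod (peval (c n) f w)) ` {2 ^ J..<2 ^ Suc J})) \<in> borel_measurable M"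
      by (rule borel_measurable_Max[OF _ cmod_peval_measurable[OF fL]]) simp
    show "AE w in M. norm (Max ((\<lambda>n. cmod (peval (c n) f w)) ` {2 ^ J..<2 ^ Suc J})) \<le> norm (V w)"
    proof (rule AE_I2)
      fix w
      have le: "cmod (peval (c n) f w) \<le> V w" if n: "n \<in> {2 ^ J..<2 ^ Suc J}" for n
      proof -
        have "cmod (peval (c n) f w) \<le> cmod (peval (c (2 ^ J)) f w) + (\<Sum>i\<in>{2 ^ J..<n}. cmod (peval (c (Suc i) - c i) f w))"
          if "2 ^ J \<le> n" for n
          using that
        proof (induction n rule: dec_induct)
          case (step n)
          have "cmod (peval (c (Suc n)) f w) \<le> cmod (peval (c n) f w) + cmod (peval (c (Suc n) - c n) f w)"
            unfolding peval_diff by (rule norm_triangle_sub)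
          then show ?case using step by (simp add: sum.atLeastLessThan_Suc)
        qed simp
        moreover have "(\<Sum>i\<in>{2 ^ J..<n}. cmod (peval (c (Suc i) - c i) f w)) \<le> (\<Sum>i\<in>{2 ^ J..<2 ^ Suc J}. cmod (peval (c (Suc i) - c i) f w))"
          using n by (intro sum_mono2) auto
        ultimately show ?thesis using n unfolding V_def by fastforce
      qed
      have ne: "{(2::nat) ^ J..<2 ^ Suc J} \<noteq> {}" by simp
      have "Max ((\<lambda>n. cmod (peval (c n) f w)) ` {2 ^ J..<2 ^ Suc J}) \<le> V w"
        using le ne by (subst Max_le_iff) auto
      moreover have "0 \<le> Max ((\<lambda>n. cmod (peval (c n) f w)) ` {2 ^ J..<2 ^ Suc J})"
        using ne by (subst Max_ge_iff) auto
      ultimately show "norm (Max ((\<lambda>n. cmod (peval (c n) f w)) ` {2 ^ J..<2 ^ Suc J})) \<le> norm (V w)" unfolding real_norm_def by linarith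
    qed
  qed
  then show ?thesis unfolding c_def s_def .
qed

end

section \<open>The energy inequality\<close>

context regular_contraction
begin

lemma Tpow_nn_integral:
  "f \<in> Lp M p \<Longrightarrow> Lp_pow M p ((T ^^ k) f) \<le> Lp_pow M p f"
proof (induction k)
  case (Suc k)
  then show ?case using T_nn_integral[OF Tpow_Lp[OF Suc.prems, of k]] by simp
qed simp

definition ddiff :: "nat \<Rightarrow> ('a \<Rightarrow> complex) \<Rightarrow> 'a \<Rightarrow> complex" where
  "ddiff j x = peval (dmean j - dmean (Suc j)) x"

lemma ddiff_eq: "ddiff j x w = peval (dmean j) x w - peval (dmean (Suc j)) x w"
  by (simp add: ddiff_def peval_diff)

lemma ddiff_Lp: "x \<in> Lp M p \<Longrightarrow> ddiff j x \<in> Lp M p"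
  unfolding ddiff_def by (rule peval_Lp)

definition large_part :: "real \<Rightarrow> ('a \<Rightarrow> real) \<Rightarrow> ('a \<Rightarrow> complex) \<Rightarrow> 'a \<Rightarrow> complex" where
  "large_part l G f = (\<lambda>w. if l * G w < cmod (f w) then f w else 0)"

definition small_part :: "real \<Rightarrow> ('a \<Rightarrow> real) \<Rightarrow> ('a \<Rightarrow> complex) \<Rightarrow> 'a \<Rightarrow> complex" where
  "small_part l G f = (\<lambda>w. if l * G w < cmod (f w) then 0 else f w)"

lemma split_parts: "(\<lambda>w. small_part l G f w + large_part l G f w) = f"
  by (auto simp: small_part_def large_part_def)

lemma parts_Lp:
  assumes f: "f \<in> Lp M p" and [measurable]: "G \<in> borel_measurable M"
  shows "small_part l G f \<in> Lp M p" "large_part l G f \<in> Lp M p"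
proof -
  have [measurable]: "f \<in> borel_measurable M" using f by (rule Lp_measurable)
  obtain B where B: "Lp_le M p f B" using f by (rule Lp_E)
  have "small_part l G f \<in> borel_measurable M" "large_part l G f \<in> borel_measurable M"
    unfolding small_part_def large_part_def by measurable
  then show "small_part l G f \<in> Lp M p" "large_part l G f \<in> Lp M p"
    by (auto intro!: Lp_I Lp_le_dom[OF B p_nonneg] simp: small_part_def large_part_def)
qed

text \<open>With \<open>b\<close> the image of \<open>a\<close> under the power \<open>2 ^ j\<close>
  of \<open>T\<close>, the next mean \<open>a'\<close> is the midpoint of \<open>a\<close> and
  \<open>b\<close>, and \<open>a - b\<close> is twice the dyadic difference. Uniform convexity
  applies where this difference is large, plain convexity elsewhere; since \<open>T\<close> is a
  contraction, the energy of \<open>b\<close> is at most that of \<open>a\<close>.\<close>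

lemma energy_step:
  assumes x: "x \<in> Lp M p" and l: "0 < l"
    and G: "AE w in M. cmod (peval (dmean j) x w) \<le> G w \<and> cmod (peval (dmean (Suc j)) x w) \<le> G w"
    and Gm: "G \<in> borel_measurable M"
  shows "2 * Lp_pow M p (peval (dmean (Suc j)) x)
    + ennreal (4 / 9 * cvx_const p * l\<^sup>2) * Lp_pow M p (large_part l G (ddiff j x))
    \<le> 2 * Lp_pow M p (peval (dmean j) x)"
proof -
  define k where "k = 4 / 9 * cvx_const p * l\<^sup>2"
  have k0: "0 \<le> k" using cvx_const_pos[OF p_gt_1] by (simp add: k_def)
  define a where "a = peval (dmean j) x"
  define a' where "a' = peval (dmean (Suc j)) x"
  define b where "b = (T ^^ (2 ^ j)) a"
  define D where "D = large_part l G (ddiff j x)"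
  have L: "a \<in> Lp M p" "a' \<in> Lp M p" "b \<in> Lp M p" "D \<in> Lp M p"
    unfolding a_def a'_def b_def D_def using x Gm by (auto intro!: peval_Lp Tpow_Lp parts_Lp ddiff_Lp)
  note [measurable] = L[THEN Lp_measurable]
  have "AE w in M. peval (pX ^ 2 ^ j * dmean j) x w = peval (pX ^ 2 ^ j) a w"
    unfolding a_def by (rule peval_mult[OF x])
  then have beq: "AE w in M. b w = 2 * a' w - a w"
  proof eventually_elim
    case (elim w)
    have "pX ^ 2 ^ j * dmean j = smult 2 (dmean (Suc j)) - dmean j"
      by (simp add: dmean_Suc distrib_left mult.commute)
    then show ?case using elim unfolding pX_power peval_monom by (simp add: a_def a'_def b_def peval_diff peval_smult)
  qed
  have pt: "AE w in M. 2 * ennreal (cmod (a' w) powr p) + ennreal k * ennreal (cmod (D w) powr p)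
    \<le> ennreal (cmod (a w) powr p) + ennreal (cmod (b w) powr p)"
    using beq G
  proof eventually_elim
    case (elim w)
    have mid: "(a w + b w) / 2 = a' w" and diff: "a w - b w = 2 * ddiff j x w"
      using elim(1) by (auto simp: ddiff_eq a_def a'_def)
    have Gb: "cmod (a w) \<le> G w" "cmod (a' w) \<le> G w" using elim(2) by (auto simp: a_def a'_def)
    have Gb': "cmod (b w) \<le> 3 * G w" "0 \<le> G w"
      using Gb norm_triangle_ineq4[of "2 * a' w" "a w"] norm_ge_zero[of "a w"]
      unfolding elim(1) norm_mult norm_numeral by linarith+
    have "2 * cmod (a' w) powr p + k * cmod (D w) powr p \<le> cmod (a w) powr p + cmod (b w) powr p"
    proof (cases "l * G w < cmod (ddiff j x w)")
      case True
      \<comment> \<open>\<open>b = 2 * a' - a\<close> gives \<open>|b| <= 3 * G\<close>, while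
        \<open>|a - b|\<close> exceeds \<open>2 * l * G\<close>; so the relative gap is
        \<open>2/3 * l\<close>, and its square accounts for the \<open>4 / 9\<close>.\<close>
      define l' where "l' = 2 / 3 * l"
      have l': "0 < l'" using l by (simp add: l'_def)
      have D3: "l' * (3 * G w) \<le> cmod (a w - b w)" using True by (simp add: l'_def diff norm_mult)
      have "cmod (a w) \<le> 3 * G w" using Gb Gb' by linarith
      then have "l' * cmod (a w) \<le> l' * (3 * G w)" "l' * cmod (b w) \<le> l' * (3 * G w)"
        using Gb'(1) l' by (simp_all only: mult_le_cancel_left_pos)
      then have "2 * cmod ((a w + b w) / 2) powr p + cvx_const p * l'\<^sup>2 * 2 powr (- p) * cmod (a w - b w) powr p
          \<le> cmod (a w) powr p + cmod (b w) powr p"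
        using D3 by (intro midpoint_powr_gap[OF p_gt_1 l']) linarith+
      moreover have "cmod (a w - b w) powr p = 2 powr p * cmod (D w) powr p"
        using True by (simp add: diff norm_mult powr_mult D_def large_part_def)
      moreover have "2 powr (- p) * (2 powr p :: real) = 1" by (simp flip: powr_add)
      then have "cvx_const p * l'\<^sup>2 * 2 powr (- p) * (2 powr p * cmod (D w) powr p) = k * cmod (D w) powr p"
        by (simp add: k_def l'_def power2_eq_square mult_ac)
      ultimately show ?thesis unfolding mid by simp
    next
      case False
      then show ?thesis using midpoint_powr_convex[OF p_gt_1, of "a w" "b w"] by (simp add: mid D_def large_part_def)
    qed
    then have "ennreal (2 * cmod (a' w) powr p + k * cmod (D w) powr p) \<le> ennreal (cmod (a w) powr p + cmod (b w) powr p)"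
      by (rule ennreal_leI)
    then show ?case using k0 by (simp add: ennreal_mult)
  qed
  have "2 * Lp_pow M p a' + ennreal k * Lp_pow M p D
    = (\<integral>\<^sup>+ w. 2 * ennreal (cmod (a' w) powr p) + ennreal k * ennreal (cmod (D w) powr p) \<partial>M)"
    by (simp add: nn_integral_add nn_integral_cmult)
  also have "\<dots> \<le> (\<integral>\<^sup>+ w. ennreal (cmod (a w) powr p) + ennreal (cmod (b w) powr p) \<partial>M)"
    using pt by (rule nn_integral_mono_AE)
  also have "\<dots> = Lp_pow M p a + Lp_pow M p b"
    by (rule nn_integral_add) auto
  also have "\<dots> \<le> Lp_pow M p a + Lp_pow M p a"
    unfolding b_def by (intro add_left_mono Tpow_nn_integral L)
  finally show ?thesis by (simp add: k_def a_def a'_def D_def mult_2)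
qed

text \<open>Telescoping over the scales, with the energies accumulated on the left so that no
  subtraction of extended reals occurs. The initial energy is that of \<open>x\<close>, as
  \<open>dmean 0 = 1\<close>.\<close>

lemma energy_sum:
  assumes x: "Lp_le M p x B" and l: "0 < l"
    and G: "\<And>j. j \<le> n \<Longrightarrow> AE w in M. cmod (peval (dmean j) x w) \<le> G w"
    and Gm: "G \<in> borel_measurable M"
  shows "(\<Sum>j<n. Lp_pow M p (large_part l G (ddiff j x)))
    \<le> ennreal (2 / (4 / 9 * cvx_const p * l\<^sup>2) * B powr p)"
proof -
  define k where "k = 4 / 9 * cvx_const p * l\<^sup>2"
  have k: "0 < k" using cvx_const_pos[OF p_gt_1] l by (simp add: k_def)
  define b where "b = (\<lambda>j. Lp_pow M p (large_part l G (ddiff j x)))"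
  define I where "I = (\<lambda>j. Lp_pow M p (peval (dmean j) x))"
  have step: "2 * I (Suc j) + ennreal k * b j \<le> 2 * I j" if "j < n" for j
    unfolding I_def b_def k_def using Lp_I[OF x] l Gm G[of j] G[of "Suc j"] that by (intro energy_step) auto
  have "2 * I i + ennreal k * (\<Sum>j<i. b j) \<le> 2 * I 0" if "i \<le> n" for i
    using that
  proof (induction i)
    case (Suc i)
    have "2 * I (Suc i) + ennreal k * (\<Sum>j<Suc i. b j) = (2 * I (Suc i) + ennreal k * b i) + ennreal k * (\<Sum>j<i. b j)"
      by (simp add: distrib_left add_ac)
    also have "\<dots> \<le> 2 * I i + ennreal k * (\<Sum>j<i. b j)" using step[of i] Suc.prems by (intro add_right_mono) auto
    also have "\<dots> \<le> 2 * I 0" using Suc by simp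
    finally show ?case .
  qed simp
  from this[of n] have "ennreal k * (\<Sum>j<n. b j) \<le> 2 * I 0" by (metis add_increasing order_refl order_trans zero_le le_add_same_cancel2)
  also have "\<dots> \<le> 2 * ennreal (B powr p)"
    using Lp_leD(3)[OF x] by (intro mult_left_mono) (auto simp: I_def dmean_0)
  finally have le: "ennreal k * (\<Sum>j<n. b j) \<le> ennreal (2 * B powr p)" by (simp add: ennreal_mult)
  have "(\<Sum>j<n. b j) = ennreal (1 / k) * (ennreal k * (\<Sum>j<n. b j))"
    using k by (simp flip: mult.assoc ennreal_mult)
  also have "\<dots> \<le> ennreal (1 / k) * ennreal (2 * B powr p)" using le by (rule mult_left_mono) simp
  also have "\<dots> = ennreal (2 / k * B powr p)" using k by (simp flip: ennreal_mult)
  finally show ?thesis by (simp add: b_def k_def)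
qed

end

section \<open>The dyadic maximal function\<close>

text \<open>Pairs of a level and a time in its dyadic block. Levels below \<open>l\<close> are
  excluded because the band at distance \<open>l\<close> sits at scale \<open>J - l\<close>; the cap
  \<open>J0\<close> keeps all maxima finite.\<close>

definition blocks :: "nat \<Rightarrow> nat \<Rightarrow> (nat \<times> nat) set" where
  "blocks l J0 = (SIGMA J:{l..J0}. {2 ^ J..<2 ^ Suc J})"

lemma blocks_finite: "finite (blocks l J0)"
  by (simp add: blocks_def)

lemma blocks_nonempty: "l \<le> J0 \<Longrightarrow> blocks l J0 \<noteq> {}"
proof -
  assume "l \<le> J0"
  then have "(l, 2 ^ l) \<in> blocks l J0" by (simp add: blocks_def)
  then show ?thesis by blast
qed

abbreviation block_orbit :: "nat \<Rightarrow> nat \<times> nat \<Rightarrow> real poly" where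
  "block_orbit m i \<equiv> weighted_orbit m (fst i) (snd i)"

context analytic_contraction
begin

abbreviation block_max :: "nat \<Rightarrow> ('a \<Rightarrow> complex) \<Rightarrow> nat \<Rightarrow> 'a \<Rightarrow> real" where
  "block_max m x J0 \<equiv> \<lambda>w. Max ((\<lambda>i. cmod (peval (block_orbit m i) x w)) ` blocks 0 J0)"

abbreviation orbit_max :: "nat \<Rightarrow> ('a \<Rightarrow> complex) \<Rightarrow> nat \<Rightarrow> 'a \<Rightarrow> real" where
  "orbit_max m x N \<equiv> \<lambda>w. Max ((\<lambda>n. (real n + 1) ^ m * cmod ((T ^^ n) ((minus_id T ^^ m) x) w)) ` {..N})"

text \<open>The exponent \<open>m + 2\<close> leaves \<open>m + 1\<close> means in the divided
  difference, just what \<open>weighted_orbit_flat\<close> consumes. The exponent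
  \<open>2 * m + 6\<close> gives a decay \<open>2 ^ (- (2 * m + 5) * l)\<close>, one factor
  \<open>2 ^ (- l)\<close> better than the loss \<open>2 ^ (2 * (m + 2) * l)\<close> in the energy
  inequality.\<close>

abbreviation low_pass :: "nat \<Rightarrow> nat \<Rightarrow> real poly" where
  "low_pass m J \<equiv> cutoff (Suc (Suc m)) (2 * m + 6) (dmean J)"

abbreviation band_quot :: "nat \<Rightarrow> nat \<Rightarrow> real poly" where
  "band_quot m j \<equiv> cutoff_quotient (Suc (Suc m)) (2 * m + 6) (dmean j) (dmean (Suc j))"

lemma Lp_le_dominated:
  fixes u v :: "'a \<Rightarrow> real"
  assumes "Lp_le M p u B" "0 \<le> p" "v \<in> borel_measurable M" "\<And>w. v w \<le> u w" "\<And>w. 0 \<le> v w"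
  shows "Lp_le M p v B"
proof (rule Lp_le_dom[OF assms(1-3)])
  show "AE w in M. norm (v w) \<le> norm (u w)"
    using assms(4,5) by (intro AE_I2) (metis abs_ge_self abs_of_nonneg order_trans real_norm_def)
qed

definition low_const :: "nat \<Rightarrow> real" where
  "low_const m = p / (p - 1) * (2 ^ m * (real (2 * m + 6) * 2 ^ (2 * m + 6)) * (m + (1 + Suc (Suc m) * (2 * m + 6)) + 3))"

lemma low_const_nonneg: "0 \<le> low_const m"
  using p_gt_1 by (simp add: low_const_def)

text \<open>Here mean and orbit have the same scale \<open>J\<close>, so flatness costs no power of
  2 depending on \<open>J\<close> and the maximal inequality applies with majorant
  \<open>|x|\<close>.\<close>

lemma low_pass_bound:
  assumes x: "Lp_le M p x B"
  shows "Lp_le M p (\<lambda>w. Max ((\<lambda>i. cmod (peval (block_orbit m i * low_pass m (fst i)) x w)) ` blocks 0 J0)) (low_const m * B)"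
proof -
  define L where "L = 2 * m + 6"
  define g where "g = real L * 2 ^ L"
  define d where "d = 1 + Suc (Suc m) * L"
  define K where "K = 2 ^ m * g * (m + d + 3)"
  have K0: "0 \<le> K" by (simp add: K_def g_def)
  have const: "p / (p - 1) * K = low_const m" by (simp only: K_def g_def d_def L_def low_const_def)
  let ?c = "\<lambda>i. block_orbit m i * low_pass m (fst i)" and ?I = "blocks 0 J0"
  have flat: "degree (?c i) < (m + d + 3) * 2 ^ fst i \<and> (\<forall>k. \<bar>coeff (?c i) k\<bar> \<le> K / ((m + d + 3) * 2 ^ fst i))"
    if i: "i \<in> ?I" for i
  proof -
    define J n where "J = fst i" and "n = snd i"
    have n: "n < 2 ^ Suc J" using i by (auto simp: blocks_def J_def n_def)
    obtain G where G: "low_pass m J = dmean J ^ Suc (Suc m) * G" "l1norm G \<le> real L * 2 ^ L"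
      "degree G \<le> (Suc (Suc m) * L) * 2 ^ J" unfolding L_def by (rule cutoff_dyadic_factor)
    \<comment> \<open>\<open>weighted_orbit_flat\<close> takes \<open>m + 1\<close> of the
      \<open>m + 2\<close> means; the spare one joins the cofactor and causes the summand 1 in
      \<open>d\<close>.\<close>
    have G1: "low_pass m J = dmean J ^ Suc m * (dmean J * G)" using G(1) by (simp add: mult_ac)
    have "l1norm (dmean J * G) \<le> 1 * g"
      unfolding g_def by (intro l1norm_mult_le l1norm_dmean G)
    then have G2: "l1norm (dmean J * G) \<le> g" by simp
    have "degree (dmean J * G) \<le> 2 ^ J + (Suc (Suc m) * L) * 2 ^ J"
      using degree_dmean[of J] by (intro degree_mult_le_add G) auto
    then have G3: "degree (dmean J * G) \<le> d * 2 ^ J" by (simp add: d_def algebra_simps)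
    show ?thesis
      using weighted_orbit_flat[OF n order_refl G2 G3, of m] unfolding K_def G1[symmetric] unfolding J_def n_def by simp
  qed
  have "Lp_le M p (\<lambda>w. cmod (x w)) B"
    using Lp_leD(1)[OF x] p_nonneg by (intro Lp_le_dom[OF x]) auto
  then have "Lp_le M p (\<lambda>w. Max ((\<lambda>i. cmod (peval (?c i) x w)) ` ?I)) (p / (p - 1) * K * B)"
    using flat Lp_I[OF x] K0 blocks_nonempty blocks_finite
    by (intro maximal_inequality[where N = "\<lambda>i. (m + d + 3) * 2 ^ fst i" and G = "\<lambda>w. cmod (x w)"]) auto
  then show ?thesis unfolding const .
qed

definition small_const :: "nat \<Rightarrow> real" where
  "small_const m = p / (p - 1) * (2 ^ m * (real (Suc (Suc m)) * (real (2 * m + 6) * 2 ^ (2 * m + 6))) *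
     (m + (Suc m + 2 * Suc (Suc m) * (2 * m + 6)) + 3))"

lemma small_const_nonneg: "0 \<le> small_const m"
  using p_gt_1 by (simp add: small_const_def)

text \<open>At distance \<open>l\<close> the coefficients exceed those of a mean by
  \<open>2 ^ (l * Suc m)\<close>. The maximal inequality passes this on as a loss, to be compensated
  by a small majorant \<open>G\<close>.\<close>

lemma small_part_bound:
  assumes l: "l \<le> J0" and f: "\<And>j. f j \<in> Lp M p" "\<And>j. AE w in M. cmod (f j w) \<le> G w" and G: "Lp_le M p G \<Gamma>"
  shows "Lp_le M p (\<lambda>w. Max ((\<lambda>i. cmod (peval (block_orbit m i * band_quot m (fst i - l)) (f (fst i - l)) w)) ` blocks l J0))
       (small_const m * 2 ^ (l * Suc m) * \<Gamma>)"
proof -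
  define L where "L = 2 * m + 6"
  define g where "g = real (Suc (Suc m)) * (real L * 2 ^ L)"
  define d where "d = Suc m + 2 * Suc (Suc m) * L"
  define K where "K = 2 ^ m * g * (m + d + 3)"
  have K0: "0 \<le> K" by (simp add: K_def g_def)
  have const: "small_const m = p / (p - 1) * K" by (simp only: K_def g_def d_def L_def small_const_def)
  let ?c = "\<lambda>i. block_orbit m i * band_quot m (fst i - l)" and ?I = "blocks l J0"
  have flat: "degree (?c i) < (m + d + 3) * 2 ^ fst i \<and> (\<forall>k. \<bar>coeff (?c i) k\<bar> \<le> 2 ^ (l * Suc m) * K / ((m + d + 3) * 2 ^ fst i))"
    if i: "i \<in> ?I" for i
  proof -
    define J n where "J = fst i" and "n = snd i"
    have n: "n < 2 ^ Suc J" and J: "J - l \<le> J" "J - (J - l) = l" using i by (auto simp: blocks_def J_def n_def)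
    obtain G where G: "band_quot m (J - l) = dmean (J - l) ^ Suc m * G" "l1norm G \<le> g"
      "degree G \<le> d * 2 ^ (J - l)" unfolding L_def g_def d_def by (rule cutoff_quotient_factor)
    show ?thesis
      using weighted_orbit_flat[OF n J(1) G(2,3), of m] unfolding K_def G(1)[symmetric] J(2) unfolding J_def n_def by simp
  qed
  have "Lp_le M p (\<lambda>w. Max ((\<lambda>i. cmod (peval (?c i) (f (fst i - l)) w)) ` ?I)) (p / (p - 1) * (2 ^ (l * Suc m) * K) * \<Gamma>)"
    using flat f K0 blocks_nonempty[OF l] blocks_finite
    by (intro maximal_inequality[where N = "\<lambda>i. (m + d + 3) * 2 ^ fst i" and G = G] G) auto
  then show ?thesis unfolding const by (simp add: mult_ac)
qed

definition large_const :: "nat \<Rightarrow> real" where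
  "large_const m = block_const (m + (2 * m + 5)) *
     (real (Suc (Suc m)) * (real (2 * m + 6) * (2 * real (Suc (Suc m))) ^ (2 * m + 5)))"

lemma large_const_nonneg: "0 \<le> large_const m"
  using block_const_nonneg by (simp add: large_const_def)

text \<open>The blocks are treated separately: \<open>block_bound\<close> turns the mismatch between
  the scale \<open>J - l\<close> of the band and the time \<open>2 ^ J\<close> into the decay in
  \<open>l\<close>. The \<open>p\<close>-th powers are then summed over the blocks, which matches
  the energy sum in the hypothesis.\<close>

lemma large_part_bound:
  assumes l: "l \<le> J0" and f: "\<And>j. f j \<in> Lp M p" and R: "0 \<le> R"
    and S: "(\<Sum>j<Suc J0 - l. Lp_pow M p (f j)) \<le> ennreal (R powr p)"
  shows "Lp_le M p (\<lambda>w. Max ((\<lambda>i. cmod (peval (block_orbit m i * band_quot m (fst i - l)) (f (fst i - l)) w)) ` blocks l J0))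
       (large_const m / 2 ^ (l * (2 * m + 5)) * R)"
proof -
  define L where "L = 2 * m + 6"
  define h where "h = real (Suc (Suc m)) * (real L * (2 * real (Suc (Suc m))) ^ (L - 1))"
  define K where "K = block_const (m + (L - 1)) * h"
  have K0: "0 \<le> K" using block_const_nonneg by (simp add: K_def h_def)
  have const: "large_const m = K" by (simp add: K_def h_def L_def large_const_def)
  let ?c = "\<lambda>i. block_orbit m i * band_quot m (fst i - l)" and ?I = "blocks l J0"
  define u where "u = (\<lambda>J w. Max ((\<lambda>n. cmod (peval (?c (J, n)) (f (J - l)) w)) ` {2 ^ J..<2 ^ Suc J}))"
  define k where "k = K / 2 ^ (l * (2 * m + 5))"
  have k0: "0 \<le> k" using K0 by (simp add: k_def)
  have ne: "{(2::nat) ^ J..<2 ^ Suc J} \<noteq> {}" for J by simp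
  have um: "u J \<in> borel_measurable M" for J
    unfolding u_def by (rule borel_measurable_Max[OF _ cmod_peval_measurable[OF f]]) simp
  have u0: "0 \<le> u J w" for J w unfolding u_def using ne[of J] by (subst Max_ge_iff) auto
  have ub: "(\<integral>\<^sup>+ w. ennreal (u J w powr p) \<partial>M) \<le> ennreal (k powr p) * Lp_pow M p (f (J - l))"
    if J: "J \<in> {l..J0}" for J
  proof -
    obtain B where B: "0 \<le> B" "Lp_pow M p (f (J - l)) = ennreal (B powr p)"
      using Lp_nn_integral[OF p_pos f] .
    then have fB: "Lp_le M p (f (J - l)) B" using Lp_measurable[OF f] by (simp add: Lp_le_def)
    obtain H where H: "band_quot m (J - l) = (1 - pX) ^ (L - 1) * H" "l1norm H \<le> h * (2 ^ (J - l)) ^ (L - 1)"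
      unfolding L_def h_def by (rule cutoff_quotient_small)
    have "(2 ^ (J - l)) ^ (L - 1) / 2 ^ (J * (L - 1)) = 1 / (2 :: real) ^ (l * (L - 1))"
    proof -
      obtain t where "J = l + t" using J le_Suc_ex[of l J] by auto
      then show ?thesis by (simp add: power_mult[symmetric] add_mult_distrib power_add)
    qed
    then have "block_const (m + (L - 1)) * (h * (2 ^ (J - l)) ^ (L - 1)) / 2 ^ (J * (L - 1)) = k"
      unfolding k_def K_def by (simp add: L_def divide_inverse mult.assoc)
    then have "Lp_le M p (u J) (k * B)"
      using block_bound[OF fB H(2), of m J "L - 1"] unfolding u_def H(1) fst_conv snd_conv by simp
    from Lp_leD(3)[OF this] show ?thesis using k0 B u0 by (simp add: powr_mult ennreal_mult)
  qed
  have "(\<Sum>J\<in>{l..J0}. \<integral>\<^sup>+ w. ennreal (u J w powr p) \<partial>M) \<le>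
    (\<Sum>J\<in>{l..J0}. ennreal (k powr p) * Lp_pow M p (f (J - l)))"
    by (rule sum_mono) (rule ub)
  also have "\<dots> = ennreal (k powr p) * (\<Sum>j<Suc J0 - l. Lp_pow M p (f j))"
    unfolding sum_distrib_left
    by (rule sum.reindex_bij_witness[of _ "\<lambda>j. j + l" "\<lambda>J. J - l"]) auto
  also have "\<dots> \<le> ennreal (k powr p) * ennreal (R powr p)" using S by (rule mult_left_mono) simp
  also have "\<dots> = ennreal ((k * R) powr p)" using k0 R by (simp add: powr_mult ennreal_mult)
  finally have sum: "(\<Sum>J\<in>{l..J0}. \<integral>\<^sup>+ w. ennreal (u J w powr p) \<partial>M) \<le> ennreal ((k * R) powr p)" .
  have "Lp_le M p (\<lambda>w. Max ((\<lambda>J. u J w) ` {l..J0})) (k * R)"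
    using l k0 R by (intro Lp_le_Max[OF p_gt_1 _ _ um u0 _ sum]) auto
  moreover have "Max ((\<lambda>i. cmod (peval (?c i) (f (fst i - l)) w)) ` ?I) \<le> Max ((\<lambda>J. u J w) ` {l..J0})" for w
  proof (subst Max_le_iff)
    show "\<forall>a\<in>(\<lambda>i. cmod (peval (?c i) (f (fst i - l)) w)) ` ?I. a \<le> Max ((\<lambda>J. u J w) ` {l..J0})"
    proof safe
      fix J n assume "(J, n) \<in> ?I"
      then have J: "J \<in> {l..J0}" and n: "n \<in> {2 ^ J..<2 ^ Suc J}" by (auto simp: blocks_def)
      have "cmod (peval (?c (J, n)) (f (J - l)) w) \<le> u J w" unfolding u_def using n by (intro Max_ge) auto
      also have "\<dots> \<le> Max ((\<lambda>J. u J w) ` {l..J0})" using J by (intro Max_ge) auto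
      finally show "cmod (peval (?c (J, n)) (f (fst (J, n) - l)) w) \<le> Max ((\<lambda>J. u J w) ` {l..J0})" by simp
    qed
  qed (use blocks_nonempty[OF l] blocks_finite in auto)
  moreover have "0 \<le> Max ((\<lambda>i. cmod (peval (?c i) (f (fst i - l)) w)) ` ?I)" for w
    using blocks_nonempty[OF l] blocks_finite by (subst Max_ge_iff) auto
  ultimately show ?thesis
    unfolding const k_def[symmetric]
    by (rule Lp_le_dominated[OF _ p_nonneg borel_measurable_Max[OF blocks_finite cmod_peval_measurable[OF f]]])
qed

end

section \<open>Assembly of the bands\<close>

lemma sum_halves_le: "(\<Sum>l\<in>{1..n}. c / 2 ^ l) \<le> (c :: real)" if "0 \<le> c"
proof -
  have "(\<Sum>l\<in>{1..n}. c / 2 ^ l) = c - c / 2 ^ n" by (induction n) auto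
  then show ?thesis using that by simp
qed

context analytic_contraction
begin

text \<open>Telescoping \<open>low_pass\<close> from level 0, where it is 1, to level
  \<open>J\<close> resolves the identity; \<open>l = J - j\<close> is the distance of a band from
  the current level. Each difference of cutoffs factors through a dyadic difference, which is split
  at height \<open>t l * G\<close>.\<close>

lemma band_decomposition:
  assumes x: "x \<in> Lp M p" and G: "G \<in> borel_measurable M"
  shows "AE w in M. peval (weighted_orbit m J n) x w = peval (weighted_orbit m J n * low_pass m J) x w +
    (\<Sum>l\<in>{1..J}. peval (weighted_orbit m J n * band_quot m (J - l)) (small_part (t l) G (ddiff (J - l) x)) w
      + peval (weighted_orbit m J n * band_quot m (J - l)) (large_part (t l) G (ddiff (J - l) x)) w)"
proof -
  let ?W = "weighted_orbit m J n"
  define c where "c = (\<lambda>j. ?W * band_quot m j)"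
  define d where "d = (\<lambda>j. dmean j - dmean (Suc j))"
  have "(\<Sum>j<J. low_pass m j - low_pass m (Suc j)) = low_pass m 0 - low_pass m J"
    by (rule sum_lessThan_telescope')
  also have "low_pass m 0 = 1" by (simp add: dmean_0 cutoff_one)
  finally have "1 = low_pass m J + (\<Sum>j<J. band_quot m j * d j)" by (simp add: cutoff_diff d_def)
  then have "?W = ?W * (low_pass m J + (\<Sum>j<J. band_quot m j * d j))" by simp
  also have "\<dots> = ?W * low_pass m J + (\<Sum>j<J. c j * d j)"
    by (simp add: distrib_left sum_distrib_left c_def mult.assoc)
  also have "(\<Sum>j<J. c j * d j) = (\<Sum>l\<in>{1..J}. c (J - l) * d (J - l))"
    by (rule sum.reindex_bij_witness[of _ "\<lambda>l. J - l" "\<lambda>j. J - j"]) auto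
  finally have W: "?W = ?W * low_pass m J + (\<Sum>l\<in>{1..J}. c (J - l) * d (J - l))" .
  have "AE w in M. peval (c (J - l) * d (J - l)) x w =
    peval (c (J - l)) (small_part (t l) G (ddiff (J - l) x)) w + peval (c (J - l)) (large_part (t l) G (ddiff (J - l) x)) w"
    for l
    using peval_mult[OF x, of "c (J - l)" "d (J - l)"]
      peval_add_arg[OF parts_Lp[OF ddiff_Lp[OF x] G], of "c (J - l)" "t l" "J - l" "t l" "J - l"]
    unfolding split_parts ddiff_def[of "J - l" x, folded d_def, symmetric]
    by eventually_elim (simp add: d_def ddiff_def)
  then have "AE w in M. \<forall>l\<in>{1..J}. peval (c (J - l) * d (J - l)) x w =
    peval (c (J - l)) (small_part (t l) G (ddiff (J - l) x)) w + peval (c (J - l)) (large_part (t l) G (ddiff (J - l) x)) w"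
    by (intro AE_finite_allI) auto
  then show ?thesis
  proof eventually_elim
    case (elim w)
    have "peval ?W x w = peval (?W * low_pass m J) x w + (\<Sum>l\<in>{1..J}. peval (c (J - l) * d (J - l)) x w)"
      by (subst W) (simp only: peval_add peval_sum)
    then show ?case using elim by (simp add: c_def)
  qed
qed

lemma dyadic_maximal:
  obtains C where "0 \<le> C"
    "\<And>x B J0. Lp_le M p x B \<Longrightarrow>
      Lp_le M p (block_max m x J0) (C * B)"
proof -
  define K0 K1 K2 where "K0 = low_const m" and "K1 = small_const m" and "K2 = large_const m"
  have K: "0 \<le> K0" "0 \<le> K1" "0 \<le> K2"
    unfolding K0_def K1_def K2_def by (rule low_const_nonneg small_const_nonneg large_const_nonneg)+
  define q where "q = p / (p - 1)"
  have q0: "0 \<le> q" using p_gt_1 by (simp add: q_def)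
  define k where "k = 4 / 9 * cvx_const p"
  have k: "0 < k" using cvx_const_pos[OF p_gt_1] by (simp add: k_def)
  \<comment> \<open>Chosen so that the bound of the energy inequality becomes a \<open>p\<close>-th
    power of a multiple of \<open>e * B\<close>.\<close>
  define e where "e = (2 / k) powr (1 / p)"
  have e: "0 \<le> e" "e powr p = 2 / k" using k p_pos by (auto simp: e_def powr_powr)
  define C1 where "C1 = K1 * q + K2 * e"
  have C1: "0 \<le> C1" using K q0 e by (simp add: C1_def)
  show ?thesis
  proof (rule that)
    show "0 \<le> K0 + C1" using K C1 by simp
    fix x :: "'a \<Rightarrow> complex" and B J0 assume x: "Lp_le M p x B"
    have xL: "x \<in> Lp M p" and B: "0 \<le> B" using x by (auto intro: Lp_I dest: Lp_leD)
    \<comment> \<open>The maximal function of the dyadic means up to \<open>J0\<close>. Its own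
      bound \<open>q * 1 * B\<close> comes from the maximal inequality, with a constant independent
      of \<open>J0\<close>.\<close>
    define G where "G = (\<lambda>w. Max ((\<lambda>j. cmod (peval (dmean j) x w)) ` {..J0}))"
    have nx: "Lp_le M p (\<lambda>w. cmod (x w)) B"
      using Lp_leD(1)[OF x] p_nonneg by (intro Lp_le_dom[OF x]) auto
    have GB: "Lp_le M p G (q * 1 * B)"
      unfolding G_def q_def using xL nx degree_dmean abs_coeff_dmean
      by (intro maximal_inequality[where N = "\<lambda>j. 2 ^ j" and G = "\<lambda>w. cmod (x w)"]) auto
    have Gm: "G \<in> borel_measurable M" using GB by (rule Lp_leD)
    have G_ge: "cmod (peval (dmean j) x w) \<le> G w" if "j \<le> J0" for j w
      unfolding G_def using that by (intro Max_ge) auto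
    have G0: "0 \<le> G w" for w using G_ge[of 0 w] norm_ge_zero order_trans by blast
    \<comment> \<open>Against the loss \<open>2 ^ (l * (m + 1))\<close> of the small parts this
      height leaves \<open>2 ^ (- l)\<close>. Its inverse square, which the energy inequality costs,
      is \<open>y\<close> below, and the decay of the large parts beats it by the same
      factor.\<close>
    define t where "t = (\<lambda>l. 1 / 2 ^ (l * (m + 2)) :: real)"
    have t: "0 < t l" for l by (simp add: t_def)
    define c where "c = (\<lambda>l i. block_orbit m i * band_quot m (fst i - l))"
    define u where "u = (\<lambda>l w. Max ((\<lambda>i. cmod (peval (c l i) (small_part (t l) G (ddiff (fst i - l) x)) w)) ` blocks l J0))"
    define v where "v = (\<lambda>l w. Max ((\<lambda>i. cmod (peval (c l i) (large_part (t l) G (ddiff (fst i - l) x)) w)) ` blocks l J0))"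
    define lo where "lo = (\<lambda>w. Max ((\<lambda>i. cmod (peval (block_orbit m i * low_pass m (fst i)) x w)) ` blocks 0 J0))"
    have parts: "small_part (t l) G (ddiff j x) \<in> Lp M p" "large_part (t l) G (ddiff j x) \<in> Lp M p" for l j
      using parts_Lp[OF ddiff_Lp[OF xL] Gm] by auto
    have uB: "Lp_le M p (u l) (K1 * q / 2 ^ l * B)" if l: "l \<in> {1..J0}" for l
    proof -
      have tG: "Lp_le M p (\<lambda>w. t l * G w) (t l * (q * 1 * B))"
        using Gm t[of l] G0 by (intro Lp_le_norm_scale[OF GB p_nonneg]) (auto simp: abs_mult)
      have "AE w in M. cmod (small_part (t l) G (ddiff j x) w) \<le> t l * G w" for j
        using t[of l] G0 by (intro AE_I2) (auto simp: small_part_def)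
      then have "Lp_le M p (u l) (K1 * 2 ^ (l * Suc m) * (t l * (q * 1 * B)))"
        unfolding u_def c_def K1_def using l by (intro small_part_bound[OF _ parts(1) _ tG]) auto
      also have "K1 * 2 ^ (l * Suc m) * (t l * (q * 1 * B)) = K1 * q / 2 ^ l * B"
      proof -
        have "2 ^ (l * Suc m) * t l = 1 / 2 ^ l" by (simp add: t_def power_add algebra_simps)
        then show ?thesis by (simp only: mult.assoc[symmetric] mult_1_right) (simp add: mult_ac)
      qed
      finally show ?thesis .
    qed
    have vB: "Lp_le M p (v l) (K2 * e / 2 ^ l * B)" if l: "l \<in> {1..J0}" for l
    proof -
      define y where "y = (2 :: real) ^ (2 * l * (m + 2))"
      have y: "1 \<le> y" "(t l)\<^sup>2 = 1 / y" by (auto simp: y_def t_def power_divide power_mult[symmetric] mult_ac)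
      \<comment> \<open>As \<open>l >= 1\<close>, the scales up to \<open>Suc J0 - l\<close> do not
        exceed \<open>J0\<close>, where \<open>G\<close> is a majorant of the means.\<close>
      have "(\<Sum>j<Suc J0 - l. Lp_pow M p (large_part (t l) G (ddiff j x)))
        \<le> ennreal (2 / (4 / 9 * cvx_const p * (t l)\<^sup>2) * B powr p)"
        using l by (intro energy_sum[OF x t _ Gm] AE_I2 G_ge) auto
      also have "\<dots> \<le> ennreal ((e * y * B) powr p)"
      proof (rule ennreal_leI)
        have "2 / (4 / 9 * cvx_const p * (t l)\<^sup>2) * B powr p = 2 / k * y * B powr p"
          unfolding y(2) by (simp add: k_def)
        \<comment> \<open>Since \<open>y >= 1\<close> and \<open>p > 1\<close>, replacing
          \<open>y\<close> by \<open>y powr p\<close> is allowed and makes the whole bound a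
          \<open>p\<close>-th power.\<close>
        also have "\<dots> \<le> 2 / k * y powr p * B powr p"
          using powr_mono[of 1 p y] p_gt_1 y k by (intro mult_right_mono mult_left_mono) auto
        also have "\<dots> = (e * y * B) powr p" using e y B by (simp add: powr_mult)
        finally show "2 / (4 / 9 * cvx_const p * (t l)\<^sup>2) * B powr p \<le> (e * y * B) powr p" .
      qed
      finally have "Lp_le M p (v l) (K2 / 2 ^ (l * (2 * m + 5)) * (e * y * B))"
        unfolding v_def c_def K2_def using l e y B by (intro large_part_bound parts) auto
      also have "K2 / 2 ^ (l * (2 * m + 5)) * (e * y * B) = K2 * e / 2 ^ l * B"
      proof -
        have "l * (2 * m + 5) = 2 * l * (m + 2) + l" by (simp add: algebra_simps)
        then have "(2 :: real) ^ (l * (2 * m + 5)) = y * 2 ^ l" unfolding y_def by (simp only: power_add)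
        then show ?thesis using y(1) by simp
      qed
      finally show ?thesis .
    qed
    have loB: "Lp_le M p lo (K0 * B)" unfolding lo_def K0_def by (rule low_pass_bound[OF x])
    have total: "Lp_le M p (\<lambda>w. lo w + (\<Sum>l\<in>{1..J0}. u l w + v l w)) (K0 * B + (\<Sum>l\<in>{1..J0}. K1 * q / 2 ^ l * B + K2 * e / 2 ^ l * B))"
      using uB vB by (intro Lp_le_add[OF p_gt_1 loB] Lp_le_sum[OF p_gt_1] Lp_le_add[OF p_gt_1])
    have "(\<Sum>l\<in>{1..J0}. K1 * q / 2 ^ l * B + K2 * e / 2 ^ l * B) \<le> C1 * B"
    proof -
      have "(\<Sum>l\<in>{1..J0}. K1 * q / 2 ^ l * B + K2 * e / 2 ^ l * B) = (\<Sum>l\<in>{1..J0}. C1 / 2 ^ l) * B"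
        unfolding sum_distrib_right by (intro sum.cong) (auto simp: C1_def add_divide_distrib distrib_right)
      then show ?thesis using sum_halves_le[OF C1, of J0] B by (simp add: mult_right_mono)
    qed
    then have le: "K0 * B + (\<Sum>l\<in>{1..J0}. K1 * q / 2 ^ l * B + K2 * e / 2 ^ l * B) \<le> (K0 + C1) * B"
      by (simp add: distrib_right)
    have W0: "(block_max m x J0) \<in> borel_measurable M"
      by (rule borel_measurable_Max[OF blocks_finite cmod_peval_measurable[OF xL]])
    have "AE w in M. \<forall>i\<in>blocks 0 J0. peval (block_orbit m i) x w =
      peval (block_orbit m i * low_pass m (fst i)) x w +
      (\<Sum>l\<in>{1..fst i}. peval (c l i) (small_part (t l) G (ddiff (fst i - l) x)) w + peval (c l i) (large_part (t l) G (ddiff (fst i - l) x)) w)"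
      unfolding c_def by (intro AE_finite_allI blocks_finite band_decomposition[OF xL Gm])
    then have ae: "AE w in M. norm (block_max m x J0 w)
      \<le> norm (lo w + (\<Sum>l\<in>{1..J0}. u l w + v l w))"
    proof eventually_elim
      case (elim w)
      have uv0: "0 \<le> u l w" "0 \<le> v l w" if "l \<le> J0" for l
        unfolding u_def v_def using blocks_nonempty[OF that] blocks_finite by (subst Max_ge_iff; auto)+
      have "cmod (peval (block_orbit m i) x w) \<le> lo w + (\<Sum>l\<in>{1..J0}. u l w + v l w)"
        if i: "i \<in> blocks 0 J0" for i
      proof -
        define a where "a = (\<lambda>l. peval (c l i) (small_part (t l) G (ddiff (fst i - l) x)) w + peval (c l i) (large_part (t l) G (ddiff (fst i - l) x)) w)"
        have "peval (block_orbit m i) x w =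
          peval (block_orbit m i * low_pass m (fst i)) x w + (\<Sum>l\<in>{1..fst i}. a l)"
          using bspec[OF elim i] by (simp only: a_def)
        then have "cmod (peval (block_orbit m i) x w) \<le>
          cmod (peval (block_orbit m i * low_pass m (fst i)) x w) + (\<Sum>l\<in>{1..fst i}. cmod (a l))"
          using norm_triangle_le[OF add_left_mono[OF norm_sum[of a "{1..fst i}"]]] by metis
        also have "cmod (peval (block_orbit m i * low_pass m (fst i)) x w) \<le> lo w"
          unfolding lo_def using i blocks_finite by (intro Max_ge) auto
        also have "(\<Sum>l\<in>{1..fst i}. cmod (a l)) \<le> (\<Sum>l\<in>{1..fst i}. u l w + v l w)"
        proof (rule sum_mono)
          fix l assume l: "l \<in> {1..fst i}"
          then have "i \<in> blocks l J0" using i by (auto simp: blocks_def)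
          then show "cmod (a l) \<le> u l w + v l w"
            unfolding a_def u_def v_def using blocks_finite by (intro order_trans[OF norm_triangle_ineq] add_mono Max_ge) auto
        qed
        also have "\<dots> \<le> (\<Sum>l\<in>{1..J0}. u l w + v l w)"
          using i uv0 by (intro sum_mono2) (auto simp: blocks_def)
        finally show ?thesis by simp
      qed
      then have "block_max m x J0 w \<le> lo w + (\<Sum>l\<in>{1..J0}. u l w + v l w)"
        using blocks_nonempty[of 0 J0] blocks_finite by (subst Max_le_iff) auto
      moreover have "0 \<le> block_max m x J0 w"
        using blocks_nonempty[of 0 J0] blocks_finite by (subst Max_ge_iff) auto
      ultimately show ?case unfolding real_norm_def by linarith
    qed
    show "Lp_le M p (block_max m x J0) ((K0 + C1) * B)"
      by (rule Lp_le_mono[OF total p_nonneg W0 ae le])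
  qed
qed

end

section \<open>Return from polynomials to the orbit of \<open>T\<close>\<close>

context regular_contraction
begin

lemma minus_id_power:
  assumes x: "x \<in> Lp M p"
  shows "(minus_id T ^^ m) x \<in> Lp M p \<and> (AE w in M. (minus_id T ^^ m) x w = peval ((pX - 1) ^ m) x w)"
proof (induction m)
  case 0
  then show ?case using x by simp
next
  case (Suc m)
  define y where "y = (minus_id T ^^ m) x"
  define z where "z = peval ((pX - 1) ^ m) x"
  have y: "y \<in> Lp M p" and z: "z \<in> Lp M p" and yz: "AE w in M. y w = z w"
    using Suc peval_Lp[OF x] by (auto simp: y_def z_def)
  have eq: "(minus_id T ^^ Suc m) x = (\<lambda>w. T y w + (-1) * y w)" by (simp add: y_def minus_id_def)
  have "AE w in M. T y w = T z w" using y z yz by (rule T_cong)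
  moreover have "AE w in M. peval ((pX - 1) * (pX - 1) ^ m) x w = peval (pX - 1) z w"
    unfolding z_def by (rule peval_mult[OF x])
  moreover have "peval (pX - 1) z w = T z w - z w" for w
    by (simp add: peval_diff pX_def peval_monom)
  ultimately have "AE w in M. (minus_id T ^^ Suc m) x w = peval ((pX - 1) ^ Suc m) x w"
    unfolding eq using yz by auto
  moreover have "(minus_id T ^^ Suc m) x \<in> Lp M p" unfolding eq using y by (intro Lp_add Lp_scale T_Lp)
  ultimately show ?case by blast
qed

text \<open>\<open>minus_id T\<close> is \<open>T - I\<close>, whereas the polynomials are written
  with \<open>1 - pX\<close>; the sign \<open>(-1) ^ m\<close> disappears in the modulus.\<close>

lemma cmod_orbit_minus_id:
  assumes x: "x \<in> Lp M p"
  shows "AE w in M. cmod ((T ^^ n) ((minus_id T ^^ m) x) w) = cmod (peval (pX ^ n * (1 - pX) ^ m) x w)"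
proof -
  note y = minus_id_power[OF x, of m]
  have "AE w in M. (T ^^ n) ((minus_id T ^^ m) x) w = (T ^^ n) (peval ((pX - 1) ^ m) x) w"
    using y peval_Lp[OF x] by (intro Tpow_cong) auto
  moreover have "AE w in M. peval (pX ^ n * (pX - 1) ^ m) x w = peval (pX ^ n) (peval ((pX - 1) ^ m) x) w"
    by (rule peval_mult[OF x])
  ultimately show ?thesis
  proof eventually_elim
    case (elim w)
    have "(1 - pX) ^ m = smult ((-1) ^ m) ((pX - 1) ^ m)"
    proof -
      have "1 - pX = smult (-1) (pX - 1)" by simp
      then show ?thesis by (simp only: smult_power)
    qed
    then have "peval (pX ^ n * (1 - pX) ^ m) x w = complex_of_real ((-1) ^ m) * peval (pX ^ n * (pX - 1) ^ m) x w"
      by (simp add: peval_smult)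
    then have "cmod (peval (pX ^ n * (1 - pX) ^ m) x w) = cmod (peval (pX ^ n * (pX - 1) ^ m) x w)"
      by (simp add: norm_mult norm_power)
    then show ?case using elim by (simp add: pX_power peval_monom)
  qed
qed

end

context analytic_contraction
begin

lemma maximal_finite:
  obtains C where "0 \<le> C" "\<And>x B N. Lp_le M p x B \<Longrightarrow>
    Lp_le M p (orbit_max m x N) (C * B)"
proof -
  obtain C where C: "0 \<le> C" "\<And>x B J0. Lp_le M p x B \<Longrightarrow>
      Lp_le M p (block_max m x J0) (C * B)"
    using dyadic_maximal[of m] by blast
  show ?thesis
  proof (rule that)
    show "0 \<le> 2 ^ m + 4 ^ m * C" using C by simp
    fix x :: "'a \<Rightarrow> complex" and B N assume x: "Lp_le M p x B"
    have xL: "x \<in> Lp M p" using x by (rule Lp_I)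
    define V where "V = (block_max m x N)"
    have V: "Lp_le M p V (C * B)" unfolding V_def by (rule C(2)[OF x])
    have V0: "0 \<le> V w" for w
      unfolding V_def using blocks_nonempty[of 0 N] blocks_finite by (subst Max_ge_iff) auto
    \<comment> \<open>The time \<open>n = 0\<close> lies in no dyadic block; it is bounded directly
      by the coefficient norm of \<open>(1 - pX) ^ m\<close>.\<close>
    define u where "u = (\<lambda>w. cmod (peval ((1 - pX) ^ m) x w))"
    have "op_le ((1 - pX) ^ m) (2 ^ m)"
      using l1norm_diff[of 1 pX] by (intro op_le_l1norm l1norm_power_le) simp
    then have "Lp_le M p (peval ((1 - pX) ^ m) x) (2 ^ m * B)" using x by (simp add: op_le_def)
    then have u: "Lp_le M p u (2 ^ m * B)"
      unfolding u_def by (rule Lp_le_dom[OF _ p_nonneg cmod_peval_measurable[OF xL]]) simp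
    have V4: "Lp_le M p (\<lambda>w. 4 ^ m * V w) (4 ^ m * (C * B))"
      using Lp_leD(1)[OF V] by (intro Lp_le_norm_scale[OF V p_nonneg]) (auto simp: abs_mult)
    note sum = Lp_le_add[OF p_gt_1 u V4]
    have "AE w in M. \<forall>n\<in>{..N}. cmod ((T ^^ n) ((minus_id T ^^ m) x) w) = cmod (peval (pX ^ n * (1 - pX) ^ m) x w)"
      by (intro AE_finite_allI cmod_orbit_minus_id xL) simp
    then have ae: "AE w in M. norm (orbit_max m x N w) \<le> norm (u w + 4 ^ m * V w)"
    proof eventually_elim
      case (elim w)
      have u0: "0 \<le> u w" by (simp add: u_def)
      have "(real n + 1) ^ m * cmod ((T ^^ n) ((minus_id T ^^ m) x) w) \<le> u w + 4 ^ m * V w" if n: "n \<in> {..N}" for n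
      proof (cases "n = 0")
        case True
        then show ?thesis using bspec[OF elim n] V0 by (simp add: u_def)
      next
        case False
        define J where "J = floor_log n"
        have J: "2 ^ J \<le> n" "n < 2 ^ Suc J"
          using False floor_log_exp2_le[of n] floor_log_exp2_gt[of n] by (auto simp: J_def)
        \<comment> \<open>This keeps the level of each \<open>n <= N\<close> below \<open>N\<close>,
          so the blocks up to level \<open>N\<close> contain all these times.\<close>
        have "J < 2 ^ J" by (rule less_exp)
        moreover have "n \<le> N" using n by simp
        ultimately have "J \<le> N" using J(1) by linarith
        then have mem: "(J, n) \<in> blocks 0 N" using J by (simp add: blocks_def)
        have "real (n + 1) \<le> real (2 ^ Suc J)" using J(2) by (subst of_nat_le_iff) simp
        then have "real n + 1 \<le> 4 * 2 ^ J" by simp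
        then have "(real n + 1) ^ m \<le> (4 * 2 ^ J) ^ m" by (intro power_mono) auto
        also have "\<dots> = 4 ^ m * 2 ^ (J * m)" by (simp add: power_mult_distrib power_mult)
        finally have "(real n + 1) ^ m * cmod (peval (pX ^ n * (1 - pX) ^ m) x w) \<le> 4 ^ m * 2 ^ (J * m) * cmod (peval (pX ^ n * (1 - pX) ^ m) x w)"
          by (rule mult_right_mono) simp
        also have "\<dots> = 4 ^ m * cmod (peval (block_orbit m (J, n)) x w)"
          by (simp add: weighted_orbit_def peval_smult norm_mult norm_power)
        also have "\<dots> \<le> 4 ^ m * V w"
          unfolding V_def using mem blocks_finite by (intro mult_left_mono Max_ge imageI) auto
        finally show ?thesis using bspec[OF elim n] u0 by simp
      qed
      then have "orbit_max m x N w \<le> u w + 4 ^ m * V w"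
        by (subst Max_le_iff) auto
      moreover have "0 \<le> orbit_max m x N w"
        by (subst Max_ge_iff) auto
      ultimately show ?case unfolding real_norm_def by linarith
    qed
    have [measurable]: "(T ^^ n) ((minus_id T ^^ m) x) \<in> borel_measurable M" for n
      using minus_id_power[OF xL] by (intro Lp_measurable Tpow_Lp) auto
    have "(orbit_max m x N) \<in> borel_measurable M"
      by measurable
    from Lp_le_dom[OF sum p_nonneg this ae]
    show "Lp_le M p (orbit_max m x N) ((2 ^ m + 4 ^ m * C) * B)"
      by (simp add: distrib_right mult.assoc)
  qed
qed

end

section \<open>From finite maxima to the supremum by monotone convergence\<close>

lemma lpnormE_SUP_le:
  fixes f :: "nat \<Rightarrow> 'a \<Rightarrow> real"
  assumes p: "0 < p" and f0: "\<And>n w. 0 \<le> f n w"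
    and bound: "\<And>N. Lp_le M p (\<lambda>w. Max ((\<lambda>n. f n w) ` {..N})) B"
  shows "lpnormE M p (\<lambda>w. SUP n. ennreal (f n w)) \<le> ennreal B"
proof -
  define g where "g = (\<lambda>N w. Max ((\<lambda>n. f n w) ` {..N}))"
  have B: "0 \<le> B" using bound by (rule Lp_leD)
  have [measurable]: "g N \<in> borel_measurable M" for N unfolding g_def using bound by (rule Lp_leD)
  have g0: "0 \<le> g N w" for N w unfolding g_def using f0 by (subst Max_ge_iff) auto
  have g_mono: "g N w \<le> g N' w" if "N \<le> N'" for N N' w
    unfolding g_def using that by (intro Max_mono) auto
  have inc: "incseq (\<lambda>N w. ennreal (g N w powr p))"
    using p g0 g_mono by (auto simp: incseq_def le_fun_def intro!: ennreal_leI powr_mono2)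
  have SUP_eq: "(SUP n. ennreal (f n w)) = (SUP N. ennreal (g N w))" for w
  proof (rule antisym)
    have "f n w \<le> g n w" for n unfolding g_def by (intro Max_ge) auto
    then show "(SUP n. ennreal (f n w)) \<le> (SUP N. ennreal (g N w))" by (intro SUP_mono) (auto intro: ennreal_leI)
    show "(SUP N. ennreal (g N w)) \<le> (SUP n. ennreal (f n w))"
    proof (rule SUP_least)
      fix N
      have "g N w \<in> (\<lambda>n. f n w) ` {..N}" unfolding g_def by (intro Max_in) auto
      then obtain n where "g N w = f n w" by auto
      then show "ennreal (g N w) \<le> (SUP n. ennreal (f n w))" using SUP_upper[of n UNIV "\<lambda>n. ennreal (f n w)"] by simp
    qed
  qed
  \<comment> \<open>The power is moved inside the supremum by taking \<open>p\<close>-th roots of a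
    finite bound; if the supremum of the powers is infinite there is nothing to show.\<close>
  have pt: "epowr (SUP n. ennreal (f n w)) p \<le> (SUP N. ennreal (g N w powr p))" for w
  proof (cases "SUP N. ennreal (g N w powr p)")
    case (real y)
    have "ennreal (g N w) \<le> ennreal (y powr (1 / p))" for N
    proof -
      have "ennreal (g N w powr p) \<le> ennreal y" unfolding real(2)[symmetric] by (rule SUP_upper) simp
      then have "(g N w powr p) powr (1 / p) \<le> y powr (1 / p)" using real p by (intro powr_mono2) auto
      then show ?thesis using p g0[of N w] by (simp add: powr_powr ennreal_leI)
    qed
    then have "(SUP n. ennreal (f n w)) \<le> ennreal (y powr (1 / p))" unfolding SUP_eq by (rule SUP_least)
    then obtain s where s: "(SUP n. ennreal (f n w)) = ennreal s" "0 \<le> s" "s \<le> y powr (1 / p)"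
      by (cases "SUP n. ennreal (f n w)") (auto simp: top_unique)
    have "s powr p \<le> (y powr (1 / p)) powr p" using s p by (intro powr_mono2) auto
    also have "\<dots> = y" using p real by (simp add: powr_powr)
    finally show ?thesis unfolding s(1) real(2) using s(2) by (simp add: epowr_ennreal ennreal_leI)
  next
    case top
    show ?thesis unfolding top by simp
  qed
  have "(\<integral>\<^sup>+ w. epowr (SUP n. ennreal (f n w)) p \<partial>M) \<le> (\<integral>\<^sup>+ w. (SUP N. ennreal (g N w powr p)) \<partial>M)"
    by (rule nn_integral_mono) (rule pt)
  also have "\<dots> = (SUP N. \<integral>\<^sup>+ w. ennreal (g N w powr p) \<partial>M)"
    by (rule nn_integral_monotone_convergence_SUP[OF inc]) measurable
  also have "\<dots> \<le> ennreal (B powr p)"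
  proof (rule SUP_least)
    fix N
    show "(\<integral>\<^sup>+ w. ennreal (g N w powr p) \<partial>M) \<le> ennreal (B powr p)"
    proof -
      have "Lp_le M p (g N) B" unfolding g_def by (rule bound)
      from Lp_leD(3)[OF this] show ?thesis using g0 by simp
    qed
  qed
  finally show ?thesis using lpnormE_le_iff[OF p B] by blast
qed

text \<open>The given constant may be negative, but \<open>ennreal\<close> sends it to 0, so it can
  be replaced by \<open>max K 0\<close>. Analyticity at time \<open>Suc n\<close> gives the decay
  \<open>1 / (n + 1)\<close>, and the sign of the difference does not affect the norm.\<close>

lemma (in regular_contraction) analytic_op_le:
  assumes "analytic_op M p T"
  obtains \<kappa> where "analytic_contraction M p T \<kappa>"
proof -
  obtain K where K: "\<And>n f. 1 \<le> n \<Longrightarrow> f \<in> Lp M p \<Longrightarrow>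
    ennreal (real n) * lpnorm M p (\<lambda>w. (T ^^ n) f w - (T ^^ (n - 1)) f w) \<le> ennreal K * lpnorm M p f"
    using assms unfolding analytic_op_def by blast
  define \<kappa> where "\<kappa> = max K 0"
  have \<kappa>: "0 \<le> \<kappa>" "ennreal K = ennreal \<kappa>" by (auto simp: \<kappa>_def max_def ennreal_neg)
  have "analytic_contraction M p T \<kappa>"
  proof (unfold_locales, rule \<kappa>(1))
    fix n :: nat
    have "op_le (pX ^ n * (1 - pX)) (\<kappa> / (real n + 1))"
      unfolding op_le_def
    proof (intro conjI allI impI)
      show "0 \<le> \<kappa> / (real n + 1)" using \<kappa> by simp
      fix f :: "'a \<Rightarrow> complex" and B assume f: "Lp_le M p f B"
      have fL: "f \<in> Lp M p" using f by (rule Lp_I)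
      have B: "0 \<le> B" using f by (rule Lp_leD)
      define d where "d = (\<lambda>w. (T ^^ Suc n) f w - (T ^^ n) f w)"
      have dL: "d \<in> Lp M p"
      proof -
        have "d = (\<lambda>w. (T ^^ Suc n) f w + (-1) * (T ^^ n) f w)" by (simp add: d_def)
        also have "\<dots> \<in> Lp M p" using fL by (intro Lp_add Lp_scale Tpow_Lp)
        finally show ?thesis .
      qed
      obtain D where D: "0 \<le> D" "lpnorm M p d = ennreal D" "Lp_le M p d D"
        using lpnorm_eq_Lp_le[OF p_pos dL] .
      have fB: "lpnorm M p f \<le> ennreal B" using f Lp_measurable[OF fL] lpnorm_le_iff[OF p_pos B] by blast
      have "ennreal (real (Suc n)) * lpnorm M p d \<le> ennreal \<kappa> * lpnorm M p f"
        using K[of "Suc n" f] fL unfolding \<kappa>(2) d_def by simp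
      also have "\<dots> \<le> ennreal \<kappa> * ennreal B" using fB by (rule mult_left_mono) simp
      finally have "ennreal (real (Suc n) * D) \<le> ennreal (\<kappa> * B)" using D \<kappa> B by (simp add: ennreal_mult del: of_nat_Suc)
      then have "real (Suc n) * D \<le> \<kappa> * B" using \<kappa> B by (subst (asm) ennreal_le_iff) auto
      then have "D \<le> \<kappa> / (real n + 1) * B" by (simp add: field_simps)
      then have dB: "Lp_le M p d (\<kappa> / (real n + 1) * B)"
        using Lp_le_mono[OF D(3) p_nonneg Lp_measurable[OF dL]] by simp
      have "pX ^ n * (1 - pX) = pX ^ n - pX ^ Suc n" by (simp add: algebra_simps)
      then have "peval (pX ^ n * (1 - pX)) f w = - d w" for w
        by (simp only: peval_diff pX_power peval_monom) (simp add: d_def)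
      then show "Lp_le M p (peval (pX ^ n * (1 - pX)) f) (\<kappa> / (real n + 1) * B)"
        by (intro Lp_le_dom[OF dB p_nonneg Lp_measurable[OF peval_Lp[OF fL]]]) simp
    qed
    then show "op_le (pX ^ n * (1 - pX)) (\<kappa> / real (n + 1))" by (simp add: add.commute)
  qed
  then show ?thesis by (rule that)
qed

theorem theorem4p1:
  fixes M :: "'a measure" and p :: real
    and T :: "('a \<Rightarrow> complex) \<Rightarrow> ('a \<Rightarrow> complex)"
  assumes "1 < p"
    and "Lp_operator M p T"
    and "contractively_regular M p T"
    and "analytic_op M p T"
  shows "\<forall>m::nat. \<exists>C::real. C \<ge> 0 \<and> (\<forall>x\<in>Lp M p.
           lpnormE M p (\<lambda>\<omega>. SUP n::nat. ennreal ((real n + 1) ^ m * cmod ((T ^^ n) ((minus_id T ^^ m) x) \<omega>)))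
             \<le> ennreal C * lpnorm M p x)"
proof
  fix m
  interpret regular_contraction M p T using assms by unfold_locales
  obtain \<kappa> where "analytic_contraction M p T \<kappa>" using assms(4) by (rule analytic_op_le)
  then interpret analytic_contraction M p T \<kappa> .
  obtain C where C: "0 \<le> C" "\<And>x B N. Lp_le M p x B \<Longrightarrow>
    Lp_le M p (orbit_max m x N) (C * B)"
    using maximal_finite[of m] by blast
  have "lpnormE M p (\<lambda>w. SUP n::nat. ennreal ((real n + 1) ^ m * cmod ((T ^^ n) ((minus_id T ^^ m) x) w))) \<le> ennreal C * lpnorm M p x"
    if x: "x \<in> Lp M p" for x
  proof -
    obtain B where B: "0 \<le> B" "lpnorm M p x = ennreal B" "Lp_le M p x B"
      using lpnorm_eq_Lp_le[OF p_pos x] .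
    have "lpnormE M p (\<lambda>w. SUP n::nat. ennreal ((real n + 1) ^ m * cmod ((T ^^ n) ((minus_id T ^^ m) x) w))) \<le> ennreal (C * B)"
      by (rule lpnormE_SUP_le[OF p_pos _ C(2)[OF B(3)]]) simp
    then show ?thesis using C(1) B by (simp add: ennreal_mult)
  qed
  then show "\<exists>C::real. C \<ge> 0 \<and> (\<forall>x\<in>Lp M p.
           lpnormE M p (\<lambda>w. SUP n::nat. ennreal ((real n + 1) ^ m * cmod ((T ^^ n) ((minus_id T ^^ m) x) w)))
             \<le> ennreal C * lpnorm M p x)"
    using C(1) by blast
qed

end
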